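(* Let $p$ and $q$ be monic polynomials with degree $2$ over $\mathbb{F}$, and assume that they are both irreducible and separable, with distinct splitting fields (in $\overline{\mathbb{F}}$) and distinct discriminants. Let $u$ be an endomorphism of a finite-dimensional vector space $V$ over $\mathbb{F}$. Then, the following conditions are equivalent: (i) The endomorphism $u$ is a d-exceptional $(p,q)$-difference. (ii) The minimal polynomial of $u$ is a power of $F_{p,q}$ and, if we denote by $r_1,\dots,r_k,\dots$ the invariant factors of $u$, then $r_{2k-1}=r_{2k}$ or $r_{2k-1}=r_{2k}\,F_{p,q}$, for all $k\geq 1$. (iii) In some basis of $V$, the endomorphism $u$ is represented by a block-diagonal matrix in which each diagonal block equals $C\bigl(F_{p,q}^n\bigr)\oplus C\bigl(F_{p,q}^n\bigr)$ or $C\bigl(F_{p,q}^n\bigr)\oplus C\bigl(F_{p,q}^{n-1}\bigr)$ for some positive integer $n$.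
   Context: $\mathbb{F}$ is an arbitrary field with algebraic closure $\overline{\mathbb{F}}$. $\operatorname{Root}(p)$ is the set of roots of $p$ in $\overline{\mathbb{F}}$. If $p(t)=(t-x_1)(t-x_2)$ and $q(t)=(t-y_1)(t-y_2)$ in $\overline{\mathbb{F}}[t]$, then $F_{p,q}(t):=\prod_{1\leq i,j\leq 2}\bigl(t-(x_i-y_j)\bigr)$, a monic polynomial of degree $4$ in $\mathbb{F}[t]$, and the discriminant of $p$ is $(x_1-x_2)^2$ (likewise for $q$). An endomorphism $u$ of $V$ is a $(p,q)$-difference if $u=a-b$ for some endomorphisms $a,b$ of $V$ with $p(a)=0$ and $q(b)=0$. It is d-exceptional with respect to $(p,q)$ if all its eigenvalues in $\overline{\mathbb{F}}$ belong to $\operatorname{Root}(p)-\operatorname{Root}(q)=\{x-y: x\in\operatorname{Root}(p),\,y\in\operatorname{Root}(q)\}$; a d-exceptional $(p,q)$-difference is a $(p,q)$-difference that is d-exceptional with respect to $(p,q)$. $C(r)$ is the companion matrix of the monic polynomial $r$ ($C(1)$ is the $0\times0$ matrix), and $\oplus$ is block-diagonal sum. The invariant factors of $u$ are the monic polynomials $r_1,r_2,\dots$ with $r_{i+1}\mid r_i$ such that $u$ is represented in some basis by $C(r_1)\oplus C(r_2)\oplus\cdots$; the finite list of nonconstant ones is extended to an infinite sequence by $r_i=1$. *)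

theory Defs
  imports
    "HOL-Algebra.Algebraic_Closure_Type"
    "HOL-Algebra.Generated_Fields"
    "Jordan_Normal_Form.Char_Poly"
begin

(* HOL-Algebra has a constant called degree for its list-based polynomials, so the one for
   the type of polynomials is written Polynomial.degree. *)

section \<open>Polynomials and the algebraic closure\<close>

abbreviation ac_poly :: "'a::field poly \<Rightarrow> 'a alg_closure poly" where
  "ac_poly \<equiv> map_poly to_ac"

definition Root :: "'a::field poly \<Rightarrow> 'a alg_closure set" where
  "Root p = {x. poly (ac_poly p) x = 0}"

definition separable_poly :: "'a::field poly \<Rightarrow> bool" where
  "separable_poly p \<longleftrightarrow> rsquarefree (ac_poly p)"

definition splitting_field :: "'a::field poly \<Rightarrow> 'a alg_closure set" where
  "splitting_field p = generate_field ring_of_type_algebra (range to_ac \<union> Root p)"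

definition quad_discr :: "'a::field poly \<Rightarrow> 'a alg_closure" where
  "quad_discr p = (THE d. \<exists>x1 x2. ac_poly p = [:-x1, 1:] * [:-x2, 1:] \<and> d = (x1 - x2)\<^sup>2)"

definition F_poly :: "'a::field poly \<Rightarrow> 'a poly \<Rightarrow> 'a poly" where
  "F_poly p q = (THE f. \<exists>x1 x2 y1 y2.
     ac_poly p = [:-x1, 1:] * [:-x2, 1:] \<and>
     ac_poly q = [:-y1, 1:] * [:-y2, 1:] \<and>
     ac_poly f = [:-(x1 - y1), 1:] * [:-(x1 - y2), 1:] * [:-(x2 - y1), 1:] * [:-(x2 - y2), 1:])"

section \<open>Endomorphisms\<close>

definition endo_poly ::
    "('a::field \<Rightarrow> 'v::ab_group_add \<Rightarrow> 'v) \<Rightarrow> 'a poly \<Rightarrow> ('v \<Rightarrow> 'v) \<Rightarrow> 'v \<Rightarrow> 'v" where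
  "endo_poly scale f u v = (\<Sum>i\<le>Polynomial.degree f. scale (coeff f i) ((u ^^ i) v))"

definition endo_min_poly ::
    "('a::field \<Rightarrow> 'v::ab_group_add \<Rightarrow> 'v) \<Rightarrow> ('v \<Rightarrow> 'v) \<Rightarrow> 'a poly" where
  "endo_min_poly scale u = (THE m. monic m \<and> endo_poly scale m u = (\<lambda>v. 0) \<and>
     (\<forall>f. endo_poly scale f u = (\<lambda>v. 0) \<longrightarrow> m dvd f))"

definition pq_difference ::
    "('a::field \<Rightarrow> 'v::ab_group_add \<Rightarrow> 'v) \<Rightarrow> 'a poly \<Rightarrow> 'a poly \<Rightarrow> ('v \<Rightarrow> 'v) \<Rightarrow> bool" where
  "pq_difference scale p q u \<longleftrightarrow>
     (\<exists>a b. Vector_Spaces.linear scale scale a \<and> Vector_Spaces.linear scale scale b \<and>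
        endo_poly scale p a = (\<lambda>v. 0) \<and> endo_poly scale q b = (\<lambda>v. 0) \<and>
        u = (\<lambda>v. a v - b v))"

definition represented_by ::
    "('a::field \<Rightarrow> 'v::ab_group_add \<Rightarrow> 'v) \<Rightarrow> ('v \<Rightarrow> 'v) \<Rightarrow> 'a mat \<Rightarrow> bool" where
  "represented_by scale u A \<longleftrightarrow>
     (\<exists>bs. distinct bs \<and> \<not> module.dependent scale (set bs) \<and>
        module.span scale (set bs) = UNIV \<and>
        A \<in> carrier_mat (length bs) (length bs) \<and>
        (\<forall>j<length bs. u (bs ! j) = (\<Sum>i<length bs. scale (A $$ (i, j)) (bs ! i))))"

definition ac_eigenvalue ::
    "('a::field \<Rightarrow> 'v::ab_group_add \<Rightarrow> 'v) \<Rightarrow> ('v \<Rightarrow> 'v) \<Rightarrow> 'a alg_closure \<Rightarrow> bool" where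
  "ac_eigenvalue scale u z \<longleftrightarrow>
     (\<exists>A. represented_by scale u A \<and> eigenvalue (map_mat to_ac A) z)"

definition d_exceptional ::
    "('a::field \<Rightarrow> 'v::ab_group_add \<Rightarrow> 'v) \<Rightarrow> 'a poly \<Rightarrow> 'a poly \<Rightarrow> ('v \<Rightarrow> 'v) \<Rightarrow> bool" where
  "d_exceptional scale p q u \<longleftrightarrow>
     (\<forall>z. ac_eigenvalue scale u z \<longrightarrow> z \<in> {x - y | x y. x \<in> Root p \<and> y \<in> Root q})"

definition companion_mat :: "'a::field poly \<Rightarrow> 'a mat" where
  "companion_mat r = (let n = Polynomial.degree r in
     mat n n (\<lambda>(i, j). if j = n - 1 then - coeff r i else if i = j + 1 then 1 else 0))"

(* The sequence is indexed from 0, so r k is the (k+1)-st invariant factor. Enlarging N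
   beyond the number of nonconstant factors only appends 0x0 blocks. *)
definition invariant_factors ::
    "('a::field \<Rightarrow> 'v::ab_group_add \<Rightarrow> 'v) \<Rightarrow> ('v \<Rightarrow> 'v) \<Rightarrow> (nat \<Rightarrow> 'a poly) \<Rightarrow> bool" where
  "invariant_factors scale u r \<longleftrightarrow>
     (\<forall>i. monic (r i)) \<and> (\<forall>i. r (Suc i) dvd r i) \<and>
     (\<exists>N. (\<forall>i\<ge>N. r i = 1) \<and>
        represented_by scale u (diag_block_mat (map (\<lambda>i. companion_mat (r i)) [0..<N])))"

section \<open>Well-definedness of the discriminant and of the quartic\<close>

lemma ac_poly_splits_quadratic:
  fixes p :: "'a::field poly"
  assumes "monic p" "Polynomial.degree p = 2"
  obtains x1 x2 where "ac_poly p = [:-x1, 1:] * [:-x2, 1:]"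
proof -
  let ?P = "ac_poly p"
  have deg: "Polynomial.degree ?P = 2"
    using assms by (subst degree_map_poly) auto
  have lc: "coeff ?P 2 = 1"
    using assms by (simp add: coeff_map_poly)
  obtain x1 where x1: "poly ?P x1 = 0"
    using alg_closed_imp_poly_has_root[of ?P] deg by auto
  then obtain g where g: "?P = [:-x1, 1:] * g"
    by (auto simp: poly_eq_0_iff_dvd elim: dvdE)
  have "g \<noteq> 0"
    using g deg by auto
  hence dg: "Polynomial.degree g = 1"
    using deg unfolding g by (subst (asm) degree_mult_eq) auto
  then obtain a b where ab: "g = [:a, b:]"
    using degree1_coeffs by blast
  have "b = 1"
    using lc unfolding g ab by (simp add: numeral_2_eq_2)
  hence "?P = [:-x1, 1:] * [:-(-a), 1:]"
    using g ab by simp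
  thus ?thesis by (rule that)
qed

lemma quadratic_factor_coeffs:
  fixes p :: "'a::field poly"
  assumes "ac_poly p = [:-x1, 1:] * [:-x2, 1:]"
  shows "x1 + x2 = to_ac (- coeff p 1)" and "x1 * x2 = to_ac (coeff p 0)"
proof -
  have "coeff (ac_poly p) 1 = - (x1 + x2)" "coeff (ac_poly p) 0 = x1 * x2"
    unfolding assms by simp_all
  thus "x1 + x2 = to_ac (- coeff p 1)" "x1 * x2 = to_ac (coeff p 0)"
    by (simp_all add: coeff_map_poly)
qed

lemma quad_discr_eq:
  fixes p :: "'a::field poly"
  assumes "ac_poly p = [:-x1, 1:] * [:-x2, 1:]"
  shows "quad_discr p = (x1 - x2)\<^sup>2"
  unfolding quad_discr_def
proof (rule the_equality)
  show "\<exists>z1 z2. ac_poly p = [:-z1, 1:] * [:-z2, 1:] \<and> (x1 - x2)\<^sup>2 = (z1 - z2)\<^sup>2"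
    using assms by blast
next
  fix d
  assume "\<exists>z1 z2. ac_poly p = [:-z1, 1:] * [:-z2, 1:] \<and> d = (z1 - z2)\<^sup>2"
  then obtain z1 z2 where z: "ac_poly p = [:-z1, 1:] * [:-z2, 1:]" "d = (z1 - z2)\<^sup>2"
    by blast
  have eq: "(a - b)\<^sup>2 = (a + b)\<^sup>2 - 4 * (a * b)" for a b :: "'a alg_closure"
    by (simp add: power2_eq_square algebra_simps)
  show "d = (x1 - x2)\<^sup>2"
    unfolding z(2) eq quadratic_factor_coeffs[OF assms] quadratic_factor_coeffs[OF z(1)] ..
qed

definition quartic_of_coeffs :: "'a::comm_ring_1 \<Rightarrow> 'a \<Rightarrow> 'a \<Rightarrow> 'a \<Rightarrow> 'a poly" where
  "quartic_of_coeffs s d S D =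
     [: D*D - s*D*S + d*(S*S - 2*D) + s*s*D - s*d*S + d*d,
        2*D*S - 2*s*D + 2*d*S - s*S*S + s*s*S - 2*s*d,
        S*S + 2*D - 3*s*S + 2*d + s*s,
        2*S - 2*s,
        1 :]"

lemma quartic_of_coeffs_eq:
  fixes x1 x2 y1 y2 :: "'a::comm_ring_1"
  shows "[:-(x1 - y1), 1:] * [:-(x1 - y2), 1:] * [:-(x2 - y1), 1:] * [:-(x2 - y2), 1:] =
    quartic_of_coeffs (x1 + x2) (x1 * x2) (y1 + y2) (y1 * y2)"
  unfolding quartic_of_coeffs_def by (simp add: algebra_simps)

lemma ac_poly_quartic_of_coeffs:
  "ac_poly (quartic_of_coeffs s d S D) =
   quartic_of_coeffs (to_ac s) (to_ac d) (to_ac S) (to_ac D)"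
  unfolding quartic_of_coeffs_def by (simp add: map_poly_pCons)

lemma ac_poly_inject: "ac_poly f = ac_poly g \<Longrightarrow> f = g"
  by (metis coeff_map_poly poly_eqI to_ac_0 to_ac_eq_iff)

lemma ac_poly_F_poly:
  fixes p q :: "'a::field poly"
  assumes p: "ac_poly p = [:-x1, 1:] * [:-x2, 1:]" and q: "ac_poly q = [:-y1, 1:] * [:-y2, 1:]"
  shows "ac_poly (F_poly p q) =
    [:-(x1 - y1), 1:] * [:-(x1 - y2), 1:] * [:-(x2 - y1), 1:] * [:-(x2 - y2), 1:]"
proof -
  define G where "G = quartic_of_coeffs (- coeff p 1) (coeff p 0) (- coeff q 1) (coeff q 0)"
  have G: "[:-(z1 - w1), 1:] * [:-(z1 - w2), 1:] * [:-(z2 - w1), 1:] * [:-(z2 - w2), 1:] =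
      ac_poly G"
    if "ac_poly p = [:-z1, 1:] * [:-z2, 1:]" "ac_poly q = [:-w1, 1:] * [:-w2, 1:]"
    for z1 z2 w1 w2
    unfolding quartic_of_coeffs_eq G_def ac_poly_quartic_of_coeffs
      quadratic_factor_coeffs[OF that(1)] quadratic_factor_coeffs[OF that(2)] ..
  have "F_poly p q = G"
    unfolding F_poly_def
  proof (rule the_equality)
    show "\<exists>x1 x2 y1 y2. ac_poly p = [:-x1, 1:] * [:-x2, 1:] \<and>
        ac_poly q = [:-y1, 1:] * [:-y2, 1:] \<and>
        ac_poly G = [:-(x1 - y1), 1:] * [:-(x1 - y2), 1:] * [:-(x2 - y1), 1:] * [:-(x2 - y2), 1:]"
      using p q G[OF p q] by metis
  next
    fix f
    assume "\<exists>x1 x2 y1 y2. ac_poly p = [:-x1, 1:] * [:-x2, 1:] \<and>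
        ac_poly q = [:-y1, 1:] * [:-y2, 1:] \<and>
        ac_poly f = [:-(x1 - y1), 1:] * [:-(x1 - y2), 1:] * [:-(x2 - y1), 1:] * [:-(x2 - y2), 1:]"
    then show "f = G"
      using G ac_poly_inject by metis
  qed
  thus ?thesis
    using G[OF p q] by simp
qed

end

theory Submission
  imports Defs
begin

text \<open>
  Write \<open>F\<close> for the quartic, \<open>\<delta> = tr p - tr q\<close> and \<open>\<tau> : t \<mapsto> \<delta> - t\<close>, which permutes the roots of \<open>F\<close>.
  If \<open>u = a - b\<close> with \<open>p(a) = q(b) = 0\<close>, then \<open>c = [a, b]\<close> satisfies \<open>c u = \<tau>(u) c\<close> and \<open>c\<^sup>2 = F(u)\<close>;
  conversely such a \<open>c\<close> gives back \<open>b\<close> by \<open>(2 u - \<delta>) b = g(u) + c\<close> with an explicit \<open>g\<close>, because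
  the discriminants differ and so \<open>2 u - \<delta>\<close> is invertible as soon as \<open>F(u)\<close> is nilpotent.

  Since the splitting fields differ, \<open>F\<close> is irreducible, and being d-exceptional means that \<open>F(u)\<close> is
  nilpotent. In the ring generated by \<open>u\<close> and \<open>c\<close> every nonzero element is then, up to a unit, a power of
  \<open>c\<close>. Among the families \<open>e\<^sub>l\<close> generating \<open>V\<close> over this ring and killed by \<open>c ^ m\<^sub>l\<close>, one
  with \<open>\<Sum> m\<^sub>l\<close> minimal satisfies no nontrivial relation, so that \<open>V\<close> is the direct sum of the cyclic
  \<open>u\<close>-spaces of \<open>e\<^sub>l\<close> and \<open>c e\<^sub>l\<close>, with annihilators \<open>F\<close> to the powers \<open>\<lceil>m\<^sub>l / 2\<rceil>\<close> and
  \<open>\<lfloor>m\<^sub>l / 2\<rfloor>\<close>. Conversely such a decomposition defines \<open>c\<close>.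

  In (iii) the multiset of all exponents has, for every \<open>t\<close> not occurring in it, an even number of elements
  above \<open>t\<close>; hence the sorted exponents have gaps at most 1 at the positions required in (ii).
\<close>

section \<open>Polynomials over a field\<close>

text \<open>With \<open>a* = tr p - a\<close> and \<open>b* = tr q - b\<close>, the algebra
  generated by \<open>a\<close> and \<open>b\<close> behaves like a quaternion algebra over its
  center, which contains \<open>z = a b* + b a*\<close>. There \<open>u\<close> has trace \<delta>,
  so that \<open>z = u^2 - \<delta> u + nrm p + nrm q\<close>, and \<open>[a, b]\<close> is a
  trace-zero element orthogonal to \<open>u\<close>: passing \<open>u\<close> through it replaces
  \<open>u\<close> by its conjugate \<delta> - u, and its square is quadratic in \<open>z\<close>,
  namely F(u). Trading the pair \<open>(a, b)\<close> for the single map \<open>c\<close> permits a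
  construction on a basis. The obstacle is that \<open>c\<close> need not commute with
  \<open>u\<close>, so that V is a module over a skew ring. An exchange argument deals with this: in
  a relation among generators the lowest power of \<open>c\<close> is divided out, one coefficient
  becomes a unit, and the quotient, killed by a smaller power of \<open>c\<close>, replaces that
  generator. The three conditions are each compared with one common form, a list of pairs of cyclic
  blocks with exponents \<open>n = m\<close> or \<open>n = m + 1\<close>.\<close>

lemma poly_ideal_generator:
  fixes I :: "'a::field poly set"
  assumes "f0 \<in> I" "f0 \<noteq> 0"
    and add: "\<And>f g. f \<in> I \<Longrightarrow> g \<in> I \<Longrightarrow> f + g \<in> I"
    and mult: "\<And>f g. f \<in> I \<Longrightarrow> g * f \<in> I"
  obtains d where "d \<in> I" "monic d" "\<And>f. f \<in> I \<Longrightarrow> d dvd f"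
proof -
  define P where "P = (\<lambda>f. f \<in> I \<and> f \<noteq> 0)"
  obtain d0 where d0: "P d0" and min: "\<And>f. P f \<Longrightarrow> Polynomial.degree d0 \<le> Polynomial.degree f"
    using ex_has_least_nat[of P f0 Polynomial.degree] assms(1,2) by (auto simp: P_def)
  define d where "d = [:inverse (lead_coeff d0):] * d0"
  have d0': "d0 \<in> I" "d0 \<noteq> 0"
    using d0 by (auto simp: P_def)
  have "d \<in> I"
    unfolding d_def using d0' by (intro mult)
  moreover have "monic d"
    using d0' by (simp add: d_def)
  moreover have "d dvd f" if "f \<in> I" for f
  proof -
    have "f mod d = f + (- (f div d)) * d"
      by (simp add: minus_div_mult_eq_mod[symmetric])
    hence "f mod d \<in> I"
      using that \<open>d \<in> I\<close> add mult by metis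
    moreover have "Polynomial.degree (f mod d) < Polynomial.degree d0" if "f mod d \<noteq> 0"
      using degree_mod_less'[of d f] that d0' by (auto simp: d_def)
    ultimately have "f mod d = 0"
      using min[of "f mod d"] unfolding P_def by linarith
    thus ?thesis by (simp add: mod_eq_0_iff_dvd)
  qed
  ultimately show ?thesis by (rule that)
qed

text \<open>The monic generator of the ideal spanned by f and F divides both. It cannot be
  associated with F, which does not divide f, so irreducibility makes it a unit.\<close>

lemma irreducible_poly_bezout:
  fixes F f :: "'a::field poly"
  assumes "Factorial_Ring.irreducible F" "\<not> F dvd f"
  obtains a b where "a * f + b * F = 1"
proof -
  define I where "I = {a * f + b * F | a b. True}"
  have "F \<noteq> 0"
    using assms(1) by auto
  moreover have F: "F \<in> I"
    unfolding I_def by (rule CollectI, rule exI[of _ 0], rule exI[of _ 1]) simp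
  moreover have "g + h \<in> I" if "g \<in> I" "h \<in> I" for g h
  proof -
    from that obtain a b c d where "g = a * f + b * F" "h = c * f + d * F"
      by (auto simp: I_def)
    hence "g + h = (a + c) * f + (b + d) * F" by (simp add: algebra_simps)
    thus ?thesis by (auto simp: I_def)
  qed
  moreover have "h * g \<in> I" if "g \<in> I" for g h
  proof -
    from that obtain a b where "g = a * f + b * F"
      by (auto simp: I_def)
    hence "h * g = (h * a) * f + (h * b) * F" by (simp add: algebra_simps)
    thus ?thesis by (auto simp: I_def)
  qed
  ultimately obtain d where d: "d \<in> I" "monic d" "\<And>g. g \<in> I \<Longrightarrow> d dvd g"
    using poly_ideal_generator[of F I] by metis
  have "f \<in> I"
    unfolding I_def by (rule CollectI, rule exI[of _ 1], rule exI[of _ 0]) simp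
  hence "d dvd f" "d dvd F"
    using d F by auto
  then obtain e where e: "F = d * e" by (elim dvdE)
  have "\<not> F dvd d"
    using assms(2) \<open>d dvd f\<close> dvd_trans by blast
  have "\<not> e dvd 1"
  proof
    assume "e dvd 1"
    then obtain k where "1 = e * k" by (elim dvdE)
    hence "d = F * k" using e by (metis mult.assoc mult.right_neutral)
    thus False using \<open>\<not> F dvd d\<close> by simp
  qed
  hence "d dvd 1"
    using Factorial_Ring.irreducibleD[OF assms(1) e] by blast
  then obtain k where "1 = d * k" by (elim dvdE)
  hence "1 \<in> I"
    using d(1) \<open>\<And>h g. g \<in> I \<Longrightarrow> h * g \<in> I\<close> by (metis mult.commute)
  then obtain a b where "1 = a * f + b * F" by (auto simp: I_def)
  thus ?thesis using that by metis
qed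

text \<open>A geometric series: \<open>1 - (b * F) ^ n\<close> is a multiple of
  \<open>1 - b * F = a * f\<close>. This is what makes a polynomial prime to F act invertibly on a
  space killed by \<open>F ^ n\<close>.\<close>

lemma irreducible_poly_bezout_power:
  fixes F f :: "'a::field poly"
  assumes "Factorial_Ring.irreducible F" "\<not> F dvd f"
  obtains a b where "a * f + b * F ^ n = 1"
proof -
  obtain a b where ab: "a * f + b * F = 1"
    using irreducible_poly_bezout[OF assms] .
  define S where "S = (\<Sum>i<n. (b * F) ^ i)"
  have "1 - (b * F) ^ n = (1 - b * F) * S"
    unfolding S_def by (rule one_diff_power_eq)
  also have "1 - b * F = a * f"
    using ab by (simp add: algebra_simps)
  finally have "(a * S) * f + b ^ n * F ^ n = 1"
    by (simp add: algebra_simps power_mult_distrib)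
  thus ?thesis by (rule that)
qed

lemma irreducible_poly_prime:
  fixes F f g :: "'a::field poly"
  assumes "Factorial_Ring.irreducible F" "F dvd f * g"
  shows "F dvd f \<or> F dvd g"
proof (rule ccontr)
  assume *: "\<not> ?thesis"
  then obtain a b where "a * f + b * F = 1"
    using irreducible_poly_bezout[OF assms(1)] by blast
  hence "g = a * (f * g) + b * F * g"
    by (metis mult.assoc mult_1 distrib_right)
  hence "F dvd g"
    using assms(2) by (metis dvd_add dvd_mult dvd_mult2 dvd_refl)
  thus False using * by simp
qed

lemma irreducible_degree_pos:
  fixes F :: "'a::field poly"
  assumes "Factorial_Ring.irreducible F"
  shows "Polynomial.degree F > 0"
  using assms by (auto simp: Factorial_Ring.irreducible_def is_unit_iff_degree intro: Nat.gr0I)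

text \<open>Factors F are split off while F divides g; once it does not, g is prime to the power of
  F that it divides, hence a unit. Applied later to the minimal polynomial and to every invariant
  factor.\<close>

lemma monic_dvd_irreducible_power:
  fixes F g :: "'a::field poly"
  assumes F: "Factorial_Ring.irreducible F" "monic F" and "monic g" "g dvd F ^ n"
  shows "\<exists>k\<le>n. g = F ^ k"
  using assms(3,4)
proof (induction n arbitrary: g)
  case 0
  hence "is_unit g" by simp
  hence "g = 1" using 0 
    by (metis monom_0 is_unit_iff_degree one_neq_zero degree_eq_zeroE dvd_0_left_iff lead_coeff_pCons(2) one_pCons)
  thus ?case by simp
next
  case (Suc n)
  show ?case
  proof (cases "F dvd g")
    case True
    then obtain g' where g': "g = F * g'" by (elim dvdE)
    have "F \<noteq> 0" using F(2) by auto
    have "g' dvd F ^ n"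
      using Suc.prems(2) \<open>F \<noteq> 0\<close> by (simp add: g')
    moreover have "monic g'"
      using Suc.prems(1) F(2) by (simp add: g' lead_coeff_mult)
    ultimately obtain k where "k \<le> n" "g' = F ^ k"
      using Suc.IH by blast
    thus ?thesis
      by (intro exI[of _ "Suc k"]) (simp add: g')
  next
    case False
    then obtain a b where "a * g + b * F ^ Suc n = 1"
      using irreducible_poly_bezout_power[OF F(1)] by blast
    hence "is_unit g"
      using Suc.prems(2) by (metis dvd_add dvd_mult dvd_refl)
    hence "g dvd F ^ n" by (meson one_dvd dvd_trans)
    thus ?thesis using Suc by (meson le_SucI)
  qed
qed

lemma irreducible_power_decomp:
  fixes F f :: "'a::field poly"
  assumes "Factorial_Ring.irreducible F" "f \<noteq> 0"
  obtains k g where "f = F ^ k * g" "\<not> F dvd g"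
proof -
  have "\<exists>k g. f = F ^ k * g \<and> \<not> F dvd g"
    using assms(2)
  proof (induction "Polynomial.degree f" arbitrary: f rule: less_induct)
    case (less f)
    show ?case
    proof (cases "F dvd f")
      case True
      then obtain h where h: "f = F * h" by (elim dvdE)
      with less.prems have "F \<noteq> 0" "h \<noteq> 0" by auto
      hence "Polynomial.degree h < Polynomial.degree f"
        using irreducible_degree_pos[OF assms(1)] by (simp add: h degree_mult_eq)
      then obtain k g where "h = F ^ k * g" "\<not> F dvd g"
        using less.hyps \<open>h \<noteq> 0\<close> by blast
      thus ?thesis
        by (intro exI[of _ "Suc k"] exI[of _ g]) (simp add: h)
    next
      case False
      thus ?thesis by (intro exI[of _ 0] exI[of _ f]) simp
    qed
  qed
  thus ?thesis using that by blast
qed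

text \<open>A divisor of least positive degree has no proper factorization.\<close>

lemma exists_monic_irreducible_factor:
  fixes f :: "'a::field poly"
  assumes "Polynomial.degree f > 0"
  obtains g where "Factorial_Ring.irreducible g" "monic g" "g dvd f"
proof -
  define P where "P = (\<lambda>g. g dvd f \<and> Polynomial.degree g > 0)"
  obtain g0 where g0: "P g0" and min: "\<And>h. P h \<Longrightarrow> Polynomial.degree g0 \<le> Polynomial.degree h"
    using ex_has_least_nat[of P f Polynomial.degree] assms by (auto simp: P_def)
  define g where "g = [:inverse (lead_coeff g0):] * g0"
  have nz: "g0 \<noteq> 0" using g0 by (auto simp: P_def)
  have unit: "is_unit [:inverse (lead_coeff g0):]"
    using nz by (simp add: is_unit_pCons_iff)
  have deg: "Polynomial.degree g = Polynomial.degree g0"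
    using nz by (simp add: g_def)
  have "g dvd f"
    using g0 nz by (auto simp: g_def P_def intro: smult_dvd)
  moreover have "monic g"
    using nz by (simp add: g_def)
  moreover have "Factorial_Ring.irreducible g"
    unfolding Factorial_Ring.irreducible_def
  proof (intro conjI allI impI)
    show "g \<noteq> 0" using \<open>monic g\<close> by auto
    show "\<not> is_unit g"
      using g0 \<open>g \<noteq> 0\<close> by (simp add: is_unit_iff_degree deg P_def)
    fix a b assume ab: "g = a * b"
    with \<open>g \<noteq> 0\<close> have nz': "a \<noteq> 0" "b \<noteq> 0" by auto
    have dab: "Polynomial.degree g0 = Polynomial.degree a + Polynomial.degree b"
      using ab nz' deg by (simp add: degree_mult_eq)
    have "a dvd f" using ab \<open>g dvd f\<close> by (metis dvd_mult_left)
    hence "Polynomial.degree a = 0 \<or> Polynomial.degree b = 0"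
      using min[of a] dab \<open>a dvd f\<close> unfolding P_def by linarith
    thus "is_unit a \<or> is_unit b"
      using nz' by (simp add: is_unit_iff_degree)
  qed
  ultimately show ?thesis using that by blast
qed

section \<open>Extension of coefficients to the algebraic closure\<close>

lemma ac_poly_add: "ac_poly (f + g) = ac_poly f + ac_poly g"
  by (rule poly_eqI) (simp add: coeff_map_poly)

lemma ac_poly_smult: "ac_poly (Polynomial.smult a f) = Polynomial.smult (to_ac a) (ac_poly f)"
  by (rule poly_eqI) (simp add: coeff_map_poly)

lemma ac_poly_pCons: "ac_poly (pCons a f) = pCons (to_ac a) (ac_poly f)"
  by (rule poly_eqI) (simp add: coeff_map_poly coeff_pCons split: nat.split)

lemma ac_poly_mult: "ac_poly (f * g) = ac_poly f * ac_poly g"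
proof (induction f)
  case (pCons a f)
  thus ?case by (simp add: ac_poly_add ac_poly_smult ac_poly_pCons mult_pCons_left)
qed simp

lemma ac_poly_1: "ac_poly 1 = 1"
  by (simp add: one_pCons ac_poly_pCons)

lemma ac_poly_power: "ac_poly (f ^ n) = ac_poly f ^ n"
  by (induction n) (simp_all add: ac_poly_1 ac_poly_mult)

lemma degree_ac_poly: "Polynomial.degree (ac_poly f) = Polynomial.degree f"
  by (rule degree_map_poly) simp

text \<open>Otherwise the Bezout identity, evaluated at the common root, would read 0 = 1.\<close>

lemma common_root_imp_dvd:
  fixes f g :: "'a::field poly"
  assumes "Factorial_Ring.irreducible g" "z \<in> Root f" "z \<in> Root g"
  shows "g dvd f"
proof (rule ccontr)
  assume "\<not> g dvd f"
  then obtain a b where "a * f + b * g = 1"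
    using irreducible_poly_bezout[OF assms(1)] by blast
  hence "ac_poly a * ac_poly f + ac_poly b * ac_poly g = 1"
    by (metis ac_poly_1 ac_poly_add ac_poly_mult)
  hence "poly (ac_poly a * ac_poly f + ac_poly b * ac_poly g) z = 1"
    by simp
  thus False using assms(2,3) by (simp add: Root_def)
qed

lemma poly_ac_poly: "poly (ac_poly f) (to_ac a) = to_ac (poly f a)"
  by (induction f) (simp_all add: ac_poly_pCons)

lemma Root_quadratic:
  assumes "ac_poly p = [:-x1, 1:] * [:-x2, 1:]"
  shows "Root p = {x1, x2}"
proof -
  have "poly (ac_poly p) x = (x - x1) * (x - x2)" for x
    unfolding assms by (simp add: algebra_simps)
  thus ?thesis by (auto simp: Root_def)
qed

lemma poly_linear_factors_roots:
  fixes a b c d :: "'a::idom"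
  shows "{z. poly ([:- a, 1:] * [:- b, 1:] * [:- c, 1:] * [:- d, 1:]) z = 0} = {a, b, c, d}"
proof -
  have "poly [:- w, 1:] z = z - w" for w z :: 'a
    by simp
  thus ?thesis
    unfolding poly_mult by auto
qed

lemma rsquarefree_imp_distinct:
  fixes a b :: "'a::idom"
  assumes "rsquarefree ([:- a, 1:] * [:- b, 1:])"
  shows "a \<noteq> b"
proof
  assume "a = b"
  have nz: "[:- a, 1:] * [:- b, 1:] \<noteq> 0" by simp
  have "[:- a, 1:] ^ 2 dvd [:- a, 1:] * [:- b, 1:]"
    unfolding \<open>a = b\<close> power2_eq_square by simp
  hence "2 \<le> Polynomial.order a ([:- a, 1:] * [:- b, 1:])"
    using nz unfolding order_divides by blast
  moreover have "Polynomial.order a ([:- a, 1:] * [:- b, 1:]) = 0 \<or>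
      Polynomial.order a ([:- a, 1:] * [:- b, 1:]) = 1"
    using assms unfolding rsquarefree_def by blast
  ultimately show False by linarith
qed

lemma root_exists:
  fixes f :: "'a::field poly"
  assumes "Polynomial.degree f > 0"
  obtains z where "z \<in> Root f"
  using alg_closed_imp_poly_has_root[of "ac_poly f"] assms
  by (auto simp: Root_def degree_ac_poly)

section \<open>Cyclic decompositions of an endomorphism\<close>

lemma degree_mod_less_degree:
  fixes f r :: "'a::field poly"
  assumes "Polynomial.degree r \<noteq> 0"
  shows "Polynomial.degree (f mod r) < Polynomial.degree r"
  using degree_mod_less[of r f] assms by fastforce

locale endo = finite_dimensional_vector_space scale Basis
  for scale :: "'a::field \<Rightarrow> 'v::ab_group_add \<Rightarrow> 'v" (infixr \<open>*s\<close> 75) and Basis +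
  fixes u :: "'v \<Rightarrow> 'v"
  assumes linear_u: "Vector_Spaces.linear scale scale u"
begin

sublocale u: Vector_Spaces.linear scale scale u
  by (rule linear_u)

abbreviation act :: "'a poly \<Rightarrow> 'v \<Rightarrow> 'v" (infixr \<open>\<triangleright>\<close> 75)
  where "f \<triangleright> v \<equiv> endo_poly scale f u v"

lemma act_altdef:
  assumes "Polynomial.degree f \<le> n"
  shows "f \<triangleright> v = (\<Sum>i\<le>n. coeff f i *s (u ^^ i) v)"
  unfolding endo_poly_def using assms
  by (intro sum.mono_neutral_left) (auto simp: coeff_eq_0)

lemma act_0 [simp]: "0 \<triangleright> v = 0"
  by (simp add: endo_poly_def)

lemma act_pCons: "pCons a f \<triangleright> v = a *s v + u (f \<triangleright> v)"
proof -
  have "pCons a f \<triangleright> v = (\<Sum>i\<le>Suc (Polynomial.degree f). coeff (pCons a f) i *s (u ^^ i) v)"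
    by (rule act_altdef) (simp add: degree_pCons_le)
  also have "\<dots> = a *s v + (\<Sum>i\<le>Polynomial.degree f. coeff f i *s u ((u ^^ i) v))"
    by (subst sum.atMost_Suc_shift) simp
  also have "(\<Sum>i\<le>Polynomial.degree f. coeff f i *s u ((u ^^ i) v)) = u (f \<triangleright> v)"
    by (simp add: endo_poly_def u.sum u.scale)
  finally show ?thesis .
qed

lemma act_add: "(f + g) \<triangleright> v = f \<triangleright> v + g \<triangleright> v"
proof -
  define n where "n = max (Polynomial.degree f) (Polynomial.degree g)"
  have "Polynomial.degree (f + g) \<le> n" "Polynomial.degree f \<le> n" "Polynomial.degree g \<le> n"
    using degree_add_le[of f n g] by (auto simp: n_def)
  thus ?thesis
    by (simp add: act_altdef scale_left_distrib sum.distrib)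
qed

lemma act_smult: "Polynomial.smult a f \<triangleright> v = a *s (f \<triangleright> v)"
  by (subst act_altdef[OF degree_smult_le]) (simp add: endo_poly_def scale_sum_right)

lemma act_mult: "(f * g) \<triangleright> v = f \<triangleright> g \<triangleright> v"
  by (induction f) (simp_all add: act_pCons act_add act_smult mult_pCons_left)

lemma act_add_right: "f \<triangleright> (v + w) = f \<triangleright> v + f \<triangleright> w"
  by (induction f) (simp_all add: act_pCons u.add scale_right_distrib algebra_simps)

lemma act_1 [simp]: "1 \<triangleright> v = v"
  by (simp add: one_pCons act_pCons u.zero)

lemma act_const [simp]: "[:a:] \<triangleright> v = a *s v"
  by (simp add: act_pCons u.zero)

lemma act_X [simp]: "[:0, 1:] \<triangleright> v = u v"
  by (simp add: act_pCons u.zero)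

text \<open>V is a module over the polynomial ring through u. Besides the scaling laws this gives
  \<open>P.span\<close>, the span over polynomials, as opposed to \<open>span\<close> over the
  field.\<close>

sublocale P: Modules.module "\<lambda>f v. f \<triangleright> v"
  by unfold_locales (simp_all add: act_add act_mult act_add_right)

lemma act_monom: "monom a i \<triangleright> v = a *s (u ^^ i) v"
  by (induction i) (simp_all add: monom_0 monom_Suc act_pCons u.scale)

lemma act_scale: "f \<triangleright> (a *s v) = a *s (f \<triangleright> v)"
  by (metis act_const act_mult mult.commute)

lemma act_u: "f \<triangleright> u v = u (f \<triangleright> v)"
  by (metis act_X act_mult mult.commute)

lemma act_commute: "f \<triangleright> g \<triangleright> v = g \<triangleright> f \<triangleright> v"
  by (metis act_mult mult.commute)

lemma act_dvd_eq_0: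
  assumes "f dvd g" "f \<triangleright> v = 0"
  shows "g \<triangleright> v = 0"
  using assms by (metis dvdE act_commute act_mult P.scale_zero_right)

lemma act_lessThan:
  assumes "Polynomial.degree f < n"
  shows "f \<triangleright> v = (\<Sum>i<n. coeff f i *s (u ^^ i) v)"
  using act_altdef[of f "n - 1" v] assms by (cases n) (auto simp: lessThan_Suc_atMost)

text \<open>Used with \<open>h = \<tau>\<close>: moving c past a polynomial in u twists that
  polynomial.\<close>

lemma semilinear_act:
  assumes "Vector_Spaces.linear scale scale c" "\<And>v. c (u v) = h \<triangleright> c v"
  shows "c (f \<triangleright> v) = (f \<circ>\<^sub>p h) \<triangleright> c v"
proof (induction f)
  case 0
  interpret c: Vector_Spaces.linear scale scale c by fact
  show ?case by (simp add: c.zero)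
next
  case (pCons a f)
  interpret c: Vector_Spaces.linear scale scale c by fact
  show ?case
    unfolding pcompose_pCons act_add act_mult act_const
    unfolding act_pCons c.add c.scale assms(2) pCons.IH ..
qed

definition cyc :: "'v \<Rightarrow> nat \<Rightarrow> 'v list"
  where "cyc e n = map (\<lambda>i. (u ^^ i) e) [0..<n]"

lemma length_cyc [simp]: "length (cyc e n) = n"
  by (simp add: cyc_def)

lemma cyc_0 [simp]: "cyc e 0 = []"
  by (simp add: cyc_def)

lemma set_cyc: "set (cyc e n) = (\<lambda>i. (u ^^ i) e) ` {..<n}"
  by (auto simp: cyc_def)

lemma act_mem_span_cyc:
  assumes "monic r" "r \<triangleright> e = 0"
  shows "f \<triangleright> e \<in> span (set (cyc e (Polynomial.degree r)))"
proof (cases "Polynomial.degree r = 0")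
  case True
  hence "r = 1" using assms(1) by (simp add: monic_degree_0)
  hence "e = 0" using assms(2) by simp
  thus ?thesis by (simp add: span_zero)
next
  case False
  have "f \<triangleright> e = (f mod r + f div r * r) \<triangleright> e" by simp
  also have "\<dots> = (f mod r) \<triangleright> e"
    unfolding act_add act_mult assms(2) P.scale_zero_right by simp
  also have "\<dots> = (\<Sum>i<Polynomial.degree r. coeff (f mod r) i *s (u ^^ i) e)"
    by (rule act_lessThan, rule degree_mod_less_degree) (use False assms(1) in auto)
  also have "\<dots> \<in> span (set (cyc e (Polynomial.degree r)))"
    by (intro span_sum span_scale span_base) (auto simp: set_cyc)
  finally show ?thesis .
qed

text \<open>An indexed family keeps coincidences \<open>b x = b y\<close> visible; testing with the
  coefficients 1 and -1 rules them out, so injectivity comes along with independence of the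
  image.\<close>

lemma family_independent:
  assumes "finite I"
    and zero: "\<And>g x. (\<Sum>x\<in>I. g x *s b x) = 0 \<Longrightarrow> x \<in> I \<Longrightarrow> g x = 0"
  shows "inj_on b I" "independent (b ` I)"
proof -
  show inj: "inj_on b I"
  proof (rule inj_onI, rule ccontr)
    fix x y assume xy: "x \<in> I" "y \<in> I" "b x = b y" "x \<noteq> y"
    define g where "g = (\<lambda>z. if z = x then 1 else if z = y then - 1 else 0 :: 'a)"
    have "(\<Sum>z\<in>I. g z *s b z) = (\<Sum>z\<in>{x, y}. g z *s b z)"
      using xy assms(1) by (intro sum.mono_neutral_right) (auto simp: g_def)
    also have "\<dots> = 0"
      using xy by (auto simp: g_def)
    finally show False
      using zero[of g x] xy by (simp add: g_def)
  qed
  show "independent (b ` I)"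
  proof (rule independent_if_scalars_zero)
    show "finite (b ` I)" using assms(1) by simp
    fix f x assume *: "(\<Sum>x\<in>b ` I. f x *s x) = 0" "x \<in> b ` I"
    then obtain i where i: "i \<in> I" "x = b i" by auto
    have "(\<Sum>x\<in>I. f (b x) *s b x) = 0"
      using *(1) by (simp add: sum.reindex[OF inj])
    from zero[OF this i(1)] show "f x = 0" using i by simp
  qed
qed

lemma cyc_independent:
  assumes "\<And>f. Polynomial.degree f < n \<Longrightarrow> f \<triangleright> e = 0 \<Longrightarrow> f = 0" "n > 0"
  shows "distinct (cyc e n)" "independent (set (cyc e n))"
proof -
  have zero: "g x = 0" if "(\<Sum>i<n. g i *s (u ^^ i) e) = 0" "x < n" for g x
  proof -
    \<comment> \<open>A linear relation among the first n iterates of e is a polynomial of degree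
      below n that kills e.\<close>
    define f where "f = (\<Sum>i<n. monom (g i) i)"
    have coeff: "coeff f i = (if i < n then g i else 0)" for i
      by (simp add: f_def coeff_sum)
    have deg: "Polynomial.degree f < n"
      using assms(2) by (intro degree_lessI) (auto simp: coeff)
    have "f \<triangleright> e = (\<Sum>i<n. g i *s (u ^^ i) e)"
      unfolding act_lessThan[OF deg] by (intro sum.cong) (simp_all add: coeff)
    hence "f \<triangleright> e = 0"
      using that(1) by simp
    hence "f = 0" using assms(1) deg by blast
    thus ?thesis using coeff[of x] that(2) by simp
  qed
  have *: "inj_on (\<lambda>i. (u ^^ i) e) {..<n}"
    by (rule family_independent(1)[OF finite_lessThan]) (rule zero, auto)
  have **: "independent ((\<lambda>i. (u ^^ i) e) ` {..<n})"
    by (rule family_independent(2)[OF finite_lessThan]) (rule zero, auto)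
  show "distinct (cyc e n)"
    using * by (simp add: cyc_def distinct_map atLeast0LessThan)
  show "independent (set (cyc e n))"
    using ** by (simp add: set_cyc)
qed

section \<open>Bases as lists and block-diagonal matrices\<close>

definition basis_list :: "'v list \<Rightarrow> bool"
  where "basis_list bs \<longleftrightarrow> distinct bs \<and> independent (set bs) \<and> span (set bs) = UNIV"

lemma linear_map_basis_list:
  assumes "distinct bs" "independent (set bs)" "length ys = length bs"
  obtains c where "Vector_Spaces.linear scale scale c" "map c bs = ys"
proof -
  interpret vector_space_pair scale scale ..
  obtain c where c: "Vector_Spaces.linear scale scale c"
      "\<forall>x\<in>set bs. c x = the (map_of (zip bs ys) x)"
    using linear_independent_extend[OF assms(2), of "\<lambda>x. the (map_of (zip bs ys) x)"] by blast
  have "map c bs = ys"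
  proof (rule nth_equalityI)
    fix i assume "i < length (map c bs)"
    thus "map c bs ! i = ys ! i"
      using c(2) assms(1,3) by (simp add: map_of_zip_nth)
  qed (use assms in simp)
  with c(1) show ?thesis by (rule that)
qed

text \<open>Only the column equations of \<open>represented_by\<close>. Being a basis is kept apart,
  because the sublist belonging to one diagonal block satisfies the equations without spanning
  V.\<close>

definition rep_list :: "'v list \<Rightarrow> 'a mat \<Rightarrow> bool" where
  "rep_list bs A \<longleftrightarrow> A \<in> carrier_mat (length bs) (length bs) \<and>
     (\<forall>j<length bs. u (bs ! j) = (\<Sum>i<length bs. A $$ (i, j) *s bs ! i))"

lemma represented_by_iff: "represented_by scale u A \<longleftrightarrow> (\<exists>bs. basis_list bs \<and> rep_list bs A)"
  by (auto simp: represented_by_def basis_list_def rep_list_def)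

lemma sum_lessThan_add:
  fixes f :: "nat \<Rightarrow> 'b::comm_monoid_add"
  shows "(\<Sum>i<m + n. f i) = (\<Sum>i<m. f i) + (\<Sum>i<n. f (m + i))"
  by (induction n) (simp_all add: add.assoc)

text \<open>The zero off-diagonal blocks confine each column sum to one part of the list, cut at
  position \<open>dim_row A\<close>.\<close>

lemma rep_list_four_block:
  assumes "square_mat A" "square_mat B"
  shows "rep_list bs (four_block_mat A (0\<^sub>m (dim_row A) (dim_col B)) (0\<^sub>m (dim_row B) (dim_col A)) B) \<longleftrightarrow>
    (\<exists>xs ys. bs = xs @ ys \<and> rep_list xs A \<and> rep_list ys B)" (is "?L \<longleftrightarrow> ?R")
proof -
  define n m where "n = dim_row A" and "m = dim_row B"
  have dims: "dim_row A = n" "dim_col A = n" "dim_row B = m" "dim_col B = m"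
    using assms by (auto simp: n_def m_def)
  let ?M = "four_block_mat A (0\<^sub>m n m) (0\<^sub>m m n) B"
  have key: "(\<forall>j<length (xs @ ys). u ((xs @ ys) ! j) = (\<Sum>i<length (xs @ ys). ?M $$ (i, j) *s (xs @ ys) ! i))
      \<longleftrightarrow> rep_list xs A \<and> rep_list ys B"
    if len: "length xs = n" "length ys = m" for xs ys
  proof -
    have 1: "(\<Sum>i<length (xs @ ys). ?M $$ (i, j) *s (xs @ ys) ! i) = (\<Sum>i<n. A $$ (i, j) *s xs ! i)"
      if "j < n" for j
      using that len dims
      by (simp add: sum_lessThan_add nth_append)
    have 2: "(\<Sum>i<length (xs @ ys). ?M $$ (i, n + j) *s (xs @ ys) ! i) = (\<Sum>i<m. B $$ (i, j) *s ys ! i)"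
      if "j < m" for j
      using that len dims
      by (simp add: sum_lessThan_add nth_append)
    have split: "(\<forall>j<n + m. Q j) \<longleftrightarrow> (\<forall>j<n. Q j) \<and> (\<forall>j<m. Q (n + j))" for Q :: "nat \<Rightarrow> bool"
    proof (intro iffI conjI allI impI)
      fix j assume "(\<forall>j<n. Q j) \<and> (\<forall>j<m. Q (n + j))" "j < n + m"
      thus "Q j" by (cases "j < n") (auto dest: spec[of _ "j - n"])
    qed auto
    define R where "R j \<longleftrightarrow> u ((xs @ ys) ! j) = (\<Sum>i<length (xs @ ys). ?M $$ (i, j) *s (xs @ ys) ! i)" for j
    define RA where "RA j \<longleftrightarrow> u (xs ! j) = (\<Sum>i<n. A $$ (i, j) *s xs ! i)" for j
    define RB where "RB j \<longleftrightarrow> u (ys ! j) = (\<Sum>i<m. B $$ (i, j) *s ys ! i)" for j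
    have "R j \<longleftrightarrow> RA j" if "j < n" for j
      unfolding R_def RA_def 1[OF that] using that by (simp add: nth_append len)
    moreover have "R (n + j) \<longleftrightarrow> RB j" if "j < m" for j
      unfolding R_def RB_def 2[OF that] using that by (simp add: nth_append len)
    moreover have "length (xs @ ys) = n + m"
      by (simp add: len)
    ultimately have "(\<forall>j<length (xs @ ys). R j) \<longleftrightarrow> (\<forall>j<n. RA j) \<and> (\<forall>j<m. RB j)"
      using split[of R] by simp
    moreover have "A \<in> carrier_mat n n" "B \<in> carrier_mat m m"
      unfolding carrier_mat_def using dims by blast+
    hence "rep_list xs A \<longleftrightarrow> (\<forall>j<n. RA j)" "rep_list ys B \<longleftrightarrow> (\<forall>j<m. RB j)"
      unfolding rep_list_def len RA_def RB_def by simp_all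
    ultimately show ?thesis
      unfolding R_def by (simp only:)
  qed
  show ?thesis
  proof
    assume L: ?L
    hence len: "length bs = n + m"
      unfolding rep_list_def by (auto simp: dims)
    define xs ys where "xs = take n bs" and "ys = drop n bs"
    have *: "bs = xs @ ys" "length xs = n" "length ys = m"
      using len by (auto simp: xs_def ys_def)
    from L have "rep_list xs A \<and> rep_list ys B"
      using key[OF *(2,3)] unfolding *(1) by (simp add: rep_list_def dims)
    thus ?R using * by blast
  next
    assume ?R
    then obtain xs ys where *: "bs = xs @ ys" "rep_list xs A" "rep_list ys B" by blast
    hence "length xs = n" "length ys = m"
      by (auto simp: rep_list_def n_def m_def)
    from key[OF this] this show ?L
      using * by (auto simp: rep_list_def dims)
  qed
qed

lemma rep_list_diag_block_mat:
  assumes "\<forall>A\<in>set As. square_mat A"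
  shows "rep_list bs (diag_block_mat As) \<longleftrightarrow> (\<exists>bss. bs = concat bss \<and> list_all2 rep_list bss As)"
  using assms
proof (induction As arbitrary: bs)
  case Nil
  show ?case by (auto simp: rep_list_def)
next
  case (Cons A As)
  have sq: "square_mat A" "square_mat (diag_block_mat As)"
    using Cons.prems diag_block_mat_square[of As] by (simp_all del: square_mat.simps)
  have IH: "rep_list ys (diag_block_mat As) \<longleftrightarrow> (\<exists>bss. ys = concat bss \<and> list_all2 rep_list bss As)" for ys
    using Cons.prems by (intro Cons.IH) (simp del: square_mat.simps)
  show ?case
    unfolding diag_block_mat.simps Let_def rep_list_four_block[OF sq] IH
  proof (intro iffI)
    assume "\<exists>xs ys. bs = xs @ ys \<and> rep_list xs A \<and> (\<exists>bss. ys = concat bss \<and> list_all2 rep_list bss As)"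
    then obtain xs bss where "bs = concat (xs # bss)" "list_all2 rep_list (xs # bss) (A # As)"
      by auto
    thus "\<exists>bss. bs = concat bss \<and> list_all2 rep_list bss (A # As)" by blast
  next
    assume "\<exists>bss. bs = concat bss \<and> list_all2 rep_list bss (A # As)"
    then obtain xs bss where "bs = xs @ concat bss" "rep_list xs A" "list_all2 rep_list bss As"
      by (auto simp: list_all2_Cons2)
    thus "\<exists>xs ys. bs = xs @ ys \<and> rep_list xs A \<and> (\<exists>bss. ys = concat bss \<and> list_all2 rep_list bss As)"
      by blast
  qed
qed

lemma funpow_act: "(u ^^ i) v = monom 1 i \<triangleright> v"
  by (simp add: act_monom)

text \<open>All columns but the last say that each vector is the image of the preceding one, so the
  list is cyclic; as r is monic, the last column then amounts to
  \<open>r \<triangleright> e = 0\<close>. In degree 0 the list is empty and e = 0.\<close>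

lemma rep_list_companion_mat:
  assumes "monic r"
  shows "rep_list bs (companion_mat r) \<longleftrightarrow> (\<exists>e. r \<triangleright> e = 0 \<and> bs = cyc e (Polynomial.degree r))"
proof (cases "Polynomial.degree r = 0")
  case True
  hence "r = 1" using assms by (simp add: monic_degree_0)
  thus ?thesis by (auto simp: rep_list_def companion_mat_def cyc_def)
next
  case False
  define n where "n = Polynomial.degree r"
  have n: "n > 0" using False by (simp add: n_def)
  have act_r: "r \<triangleright> e = (\<Sum>i<n. coeff r i *s (u ^^ i) e) + (u ^^ n) e" for e
    using assms by (simp add: endo_poly_def n_def lessThan_Suc_atMost[symmetric])
  have low: "(\<Sum>i<n. companion_mat r $$ (i, j) *s bs ! i) = bs ! Suc j"
    if "Suc j < n" for j and bs :: "'v list"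
  proof -
    have "(\<Sum>i<n. companion_mat r $$ (i, j) *s bs ! i) =
        (\<Sum>i<n. if i = Suc j then bs ! Suc j else 0)"
      using that by (intro sum.cong) (auto simp: companion_mat_def n_def[symmetric])
    thus ?thesis using that by simp
  qed
  have high: "(\<Sum>i<n. companion_mat r $$ (i, n - 1) *s bs ! i) = - (\<Sum>i<n. coeff r i *s bs ! i)"
    for bs :: "'v list"
    unfolding sum_negf[symmetric] using n
    by (intro sum.cong) (auto simp: companion_mat_def n_def[symmetric])
  have dims: "companion_mat r \<in> carrier_mat n n"
    by (simp add: companion_mat_def n_def Let_def)
  have Suc_n: "Suc (n - 1) = n" using n by simp
  show ?thesis
  proof
    assume "rep_list bs (companion_mat r)"
    hence len: "length bs = n" and rep: "\<And>j. j < n \<Longrightarrow> u (bs ! j) = (\<Sum>i<n. companion_mat r $$ (i, j) *s bs ! i)"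
      using dims by (auto simp: rep_list_def)
    have bs: "bs ! i = (u ^^ i) (bs ! 0)" if "i < n" for i
      using that
    proof (induction i)
      case (Suc i)
      thus ?case using rep[of i] low[of i bs] by simp
    qed simp
    have n1: "n - 1 < n" using n by simp
    have "(u ^^ n) (bs ! 0) = (u ^^ Suc (n - 1)) (bs ! 0)"
      by (simp only: Suc_n)
    also have "\<dots> = u (bs ! (n - 1))"
      unfolding funpow.simps o_apply by (subst bs[OF n1]) (rule refl)
    also have "\<dots> = - (\<Sum>i<n. coeff r i *s bs ! i)"
      unfolding rep[OF n1] high ..
    also have "(\<Sum>i<n. coeff r i *s bs ! i) = (\<Sum>i<n. coeff r i *s (u ^^ i) (bs ! 0))"
    proof (intro sum.cong refl)
      fix i assume "i \<in> {..<n}"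
      thus "coeff r i *s bs ! i = coeff r i *s (u ^^ i) (bs ! 0)"
        using bs[of i] by simp
    qed
    finally have "r \<triangleright> (bs ! 0) = 0"
      by (simp add: act_r)
    moreover have "bs = cyc (bs ! 0) n"
    proof (rule nth_equalityI)
      fix i assume "i < length bs"
      thus "bs ! i = cyc (bs ! 0) n ! i"
        using bs[of i] len by (simp add: cyc_def)
    qed (simp add: len)
    ultimately show "\<exists>e. r \<triangleright> e = 0 \<and> bs = cyc e (Polynomial.degree r)"
      by (auto simp: n_def[symmetric])
  next
    assume "\<exists>e. r \<triangleright> e = 0 \<and> bs = cyc e (Polynomial.degree r)"
    then obtain e where e: "r \<triangleright> e = 0" "bs = cyc e n"
      by (auto simp: n_def)
    have bs: "bs ! i = (u ^^ i) e" if "i < n" for i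
      using that by (simp add: e cyc_def)
    have "u (bs ! j) = (\<Sum>i<n. companion_mat r $$ (i, j) *s bs ! i)" if "j < n" for j
    proof (cases "Suc j < n")
      case True
      thus ?thesis using low[of j bs] bs by simp
    next
      case False
      with that have j: "j = n - 1" by simp
      have "(\<Sum>i<n. coeff r i *s bs ! i) = (\<Sum>i<n. coeff r i *s (u ^^ i) e)"
        using bs by (intro sum.cong) auto
      moreover have "u (bs ! j) = (u ^^ n) e"
        using bs[OF that] j Suc_n by (metis funpow.simps(2) o_apply)
      moreover have "(u ^^ n) e = - (\<Sum>i<n. coeff r i *s (u ^^ i) e)"
        using e(1) unfolding act_r by (metis eq_neg_iff_add_eq_0 add.commute)
      ultimately show ?thesis
        unfolding j high by simp
    qed
    thus "rep_list bs (companion_mat r)"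
      using dims by (simp add: rep_list_def e(2))
  qed
qed

text \<open>V as a direct sum of cyclic modules over the polynomial ring, recorded by generators e
  and annihilators r; directness is expressed through one common basis. A pair \<open>(0, 1)\<close>
  contributes the empty list, so padding by such pairs is harmless.\<close>

definition cyc_decomp :: "('v \<times> 'a poly) list \<Rightarrow> bool" where
  "cyc_decomp P \<longleftrightarrow> (\<forall>(e, r)\<in>set P. r \<triangleright> e = 0) \<and>
     basis_list (concat (map (\<lambda>(e, r). cyc e (Polynomial.degree r)) P))"

text \<open>The block-diagonal matrices of companion blocks enter the argument only through this
  equivalence; everything else about them is said in terms of cyclic generators.\<close>

lemma represented_by_companions:
  assumes "\<forall>r\<in>set rs. monic r"
  shows "represented_by scale u (diag_block_mat (map companion_mat rs)) \<longleftrightarrow>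
    (\<exists>P. map snd P = rs \<and> cyc_decomp P)"
proof -
  have blocks: "list_all2 rep_list bss (map companion_mat rs) \<longleftrightarrow>
      (\<exists>P. map snd P = rs \<and> (\<forall>(e, r)\<in>set P. r \<triangleright> e = 0) \<and>
        bss = map (\<lambda>(e, r). cyc e (Polynomial.degree r)) P)" for bss
    using assms
  proof (induction rs arbitrary: bss)
    case (Cons r rs)
    have IH: "list_all2 rep_list bss (map companion_mat rs) \<longleftrightarrow>
      (\<exists>P. map snd P = rs \<and> (\<forall>(e, r)\<in>set P. r \<triangleright> e = 0) \<and>
        bss = map (\<lambda>(e, r). cyc e (Polynomial.degree r)) P)" for bss
      using Cons by simp
    have r: "rep_list bs (companion_mat r) \<longleftrightarrow> (\<exists>e. r \<triangleright> e = 0 \<and> bs = cyc e (Polynomial.degree r))" for bs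
      using Cons.prems by (intro rep_list_companion_mat) simp
    show ?case
    proof
      assume "list_all2 rep_list bss (map companion_mat (r # rs))"
      then obtain bs bss' where *: "bss = bs # bss'" "rep_list bs (companion_mat r)"
          "list_all2 rep_list bss' (map companion_mat rs)"
        by (auto simp: list_all2_Cons2)
      from *(2) obtain e where "r \<triangleright> e = 0" "bs = cyc e (Polynomial.degree r)"
        using r by blast
      moreover from *(3) obtain P where "map snd P = rs" "\<forall>(e, r)\<in>set P. r \<triangleright> e = 0"
          "bss' = map (\<lambda>(e, r). cyc e (Polynomial.degree r)) P"
        using IH by blast
      ultimately show "\<exists>P. map snd P = r # rs \<and> (\<forall>(e, r)\<in>set P. r \<triangleright> e = 0) \<and>
          bss = map (\<lambda>(e, r). cyc e (Polynomial.degree r)) P"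
        using *(1) by (intro exI[of _ "(e, r) # P"]) simp
    next
      assume "\<exists>P. map snd P = r # rs \<and> (\<forall>(e, r)\<in>set P. r \<triangleright> e = 0) \<and>
          bss = map (\<lambda>(e, r). cyc e (Polynomial.degree r)) P"
      then obtain e P where "map snd P = rs" "r \<triangleright> e = 0" "\<forall>(e, r)\<in>set P. r \<triangleright> e = 0"
          "bss = map (\<lambda>(e, r). cyc e (Polynomial.degree r)) ((e, r) # P)"
        by (auto simp: map_eq_Cons_conv)
      thus "list_all2 rep_list bss (map companion_mat (r # rs))"
        using r IH by auto
    qed
  qed simp
  have "\<forall>A\<in>set (map companion_mat rs). square_mat A"
    by (auto simp: companion_mat_def Let_def)
  note diag = rep_list_diag_block_mat[OF this]
  have rep: "rep_list bs (diag_block_mat (map companion_mat rs)) \<longleftrightarrow>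
      (\<exists>P. map snd P = rs \<and> (\<forall>(e, r)\<in>set P. r \<triangleright> e = 0) \<and>
        bs = concat (map (\<lambda>(e, r). cyc e (Polynomial.degree r)) P))" for bs
    unfolding diag blocks by metis
  show ?thesis
    unfolding represented_by_iff rep cyc_decomp_def by fast
qed

lemma basis_list_mset:
  assumes "mset bs = mset bs'" "basis_list bs"
  shows "basis_list bs'"
  using assms mset_eq_imp_distinct_iff[OF assms(1)] mset_eq_setD[OF assms(1)]
  by (simp add: basis_list_def)

text \<open>Reordering is what links blocks listed in pairs with invariant factors listed in
  decreasing order.\<close>

lemma cyc_decomp_mset:
  assumes "mset P = mset P'" "cyc_decomp P"
  shows "cyc_decomp P'"
proof -
  have "mset (concat (map f P)) = mset (concat (map f P'))" for f :: "_ \<Rightarrow> 'v list"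
  proof -
    have *: "mset (concat (map f Q)) = (\<Sum>x\<in>#mset Q. mset (f x))" for Q
      by (induction Q) auto
    show ?thesis unfolding * assms(1) ..
  qed
  from basis_list_mset[OF this] show ?thesis
    using assms(2) mset_eq_setD[OF assms(1)] unfolding cyc_decomp_def by simp
qed

lemma cyc_decomp_cyc:
  assumes "cyc_decomp P" "(e, r) \<in> set P"
  shows "r \<triangleright> e = 0" "distinct (cyc e (Polynomial.degree r))"
    "independent (set (cyc e (Polynomial.degree r)))"
proof -
  show "r \<triangleright> e = 0" using assms by (auto simp: cyc_decomp_def)
  define C where "C = concat (map (\<lambda>(e, r). cyc e (Polynomial.degree r)) P)"
  have C: "distinct C" "independent (set C)"
    using assms(1) by (auto simp: cyc_decomp_def basis_list_def C_def)
  obtain P1 P2 where P: "P = P1 @ (e, r) # P2"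
    using assms(2) by (meson split_list)
  show "distinct (cyc e (Polynomial.degree r))"
    using C(1) by (simp add: C_def P)
  have "set (cyc e (Polynomial.degree r)) \<subseteq> set C"
    by (auto simp: C_def P)
  thus "independent (set (cyc e (Polynomial.degree r)))"
    using C(2) independent_mono by blast
qed

text \<open>The remainder of f modulo r is a relation among fewer iterates than the independent list
  has, so r is the exact annihilator of its generator.\<close>

lemma cyc_decomp_dvd:
  assumes "cyc_decomp P" "(e, r) \<in> set P" "monic r" "f \<triangleright> e = 0"
  shows "r dvd f"
proof (cases "Polynomial.degree r = 0")
  case True
  thus ?thesis using assms(3) by (simp add: monic_degree_0)
next
  case False
  define n where "n = Polynomial.degree r"
  have dist: "distinct (cyc e n)" and indep: "independent (set (cyc e n))"
    using cyc_decomp_cyc[OF assms(1,2)] by (auto simp: n_def)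
  have inj: "inj_on (\<lambda>i. (u ^^ i) e) {..<n}"
    using dist by (simp add: cyc_def distinct_map atLeast0LessThan)
  have deg: "Polynomial.degree (f mod r) < n"
    unfolding n_def by (rule degree_mod_less_degree) (use False assms(3) in auto)
  have "0 = (f mod r + f div r * r) \<triangleright> e" using assms(4) by simp
  also have "\<dots> = (f mod r) \<triangleright> e"
    unfolding act_add act_mult cyc_decomp_cyc(1)[OF assms(1,2)] P.scale_zero_right by simp
  also have "\<dots> = (\<Sum>i<n. coeff (f mod r) i *s (u ^^ i) e)"
    by (rule act_lessThan[OF deg])
  \<comment> \<open>Independence speaks of a set of vectors, so the coefficients indexed by
    exponents are transported along the inverse of the enumeration.\<close>
  also have "\<dots> = (\<Sum>v\<in>set (cyc e n). coeff (f mod r) (the_inv_into {..<n} (\<lambda>i. (u ^^ i) e) v) *s v)"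
    unfolding set_cyc by (subst sum.reindex[OF inj]) (auto intro!: sum.cong simp: the_inv_into_f_f[OF inj])
  finally have "coeff (f mod r) (the_inv_into {..<n} (\<lambda>i. (u ^^ i) e) v) = 0" if "v \<in> set (cyc e n)" for v
    using independentD[OF indep _ _ _ that] by force
  note zero = this
  have "coeff (f mod r) i = 0" if "i < n" for i
    using zero[of "(u ^^ i) e"] that the_inv_into_f_f[OF inj, of i] by (simp add: set_cyc)
  hence "f mod r = 0"
    using deg by (metis leading_coeff_0_iff)
  thus ?thesis by (simp add: mod_eq_0_iff_dvd)
qed

lemma cyc_decomp_induct:
  assumes "cyc_decomp P" "subspace S" "\<And>e r f. (e, r) \<in> set P \<Longrightarrow> f \<triangleright> e \<in> S"
  shows "v \<in> S"
proof -
  have "set (concat (map (\<lambda>(e, r). cyc e (Polynomial.degree r)) P)) \<subseteq> S"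
    using assms(3) by (auto simp: set_cyc funpow_act)
  hence "span (set (concat (map (\<lambda>(e, r). cyc e (Polynomial.degree r)) P))) \<subseteq> S"
    using assms(2) by (rule span_minimal)
  thus ?thesis using assms(1) by (auto simp: cyc_decomp_def basis_list_def)
qed

lemma cyc_decomp_annihilated:
  assumes "cyc_decomp P" "\<And>e r. (e, r) \<in> set P \<Longrightarrow> r dvd g"
  shows "g \<triangleright> v = 0"
proof -
  have "v \<in> {v. g \<triangleright> v = 0}"
  proof (rule cyc_decomp_induct[OF assms(1)])
    show "subspace {v. g \<triangleright> v = 0}"
      by (auto intro!: subspaceI simp: act_add_right act_scale)
    fix e r f assume *: "(e, r) \<in> set P"
    hence "g \<triangleright> e = 0"
      using assms(2) cyc_decomp_cyc(1)[OF assms(1) *] act_dvd_eq_0 by blast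
    hence "g \<triangleright> f \<triangleright> e = 0"
      unfolding act_commute[of g f] by (simp only: P.scale_zero_right)
    thus "f \<triangleright> e \<in> {v. g \<triangleright> v = 0}" by blast
  qed
  thus ?thesis by simp
qed

end

section \<open>Minimal polynomial and eigenvalues\<close>

context endo
begin

lemma act_eq_0_on_basis:
  assumes "span S = UNIV" "\<And>v. v \<in> S \<Longrightarrow> f \<triangleright> v = 0"
  shows "f \<triangleright> v = 0"
proof -
  have "subspace {v. f \<triangleright> v = 0}"
    by (auto intro!: subspaceI simp: act_add_right act_scale)
  hence "span S \<subseteq> {v. f \<triangleright> v = 0}"
    using assms(2) by (intro span_minimal) auto
  thus ?thesis using assms(1) by auto
qed

text \<open>Enough iterates of a single vector are dependent, which gives a polynomial killing that
  vector; the product of these polynomials over a basis kills the whole space.\<close>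

lemma exists_annihilator:
  obtains f where "f \<noteq> 0" "\<And>v. f \<triangleright> v = 0"
proof -
  have local: "\<exists>f. f \<noteq> 0 \<and> f \<triangleright> v = 0" for v
  proof (rule ccontr)
    assume *: "\<not> ?thesis"
    \<comment> \<open>These are \<open>card Basis + 1\<close> indices, one more than the
      dimension.\<close>
    define I where "I = {..card Basis}"
    have zero: "g x = 0" if g: "(\<Sum>i\<in>I. g i *s (u ^^ i) v) = 0" and x: "x \<in> I" for g x
    proof -
      define f where "f = (\<Sum>i\<in>I. monom (g i) i)"
      have "f \<triangleright> v = (\<Sum>i\<in>I. g i *s (u ^^ i) v)"
        unfolding f_def P.scale_sum_left act_monom ..
      hence "f = 0" using * g by auto
      moreover have "coeff f x = g x"
        using x by (simp add: f_def coeff_sum I_def)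
      ultimately show ?thesis by simp
    qed
    have fin: "finite I" by (simp add: I_def)
    have "inj_on (\<lambda>i. (u ^^ i) v) I"
      by (rule family_independent(1)[OF fin]) (rule zero)
    hence "card ((\<lambda>i. (u ^^ i) v) ` I) = Suc (card Basis)"
      by (simp add: card_image I_def)
    moreover have "independent ((\<lambda>i. (u ^^ i) v) ` I)"
      by (rule family_independent(2)[OF fin]) (rule zero)
    hence "card ((\<lambda>i. (u ^^ i) v) ` I) \<le> card Basis"
      using independent_card_le_dim[OF subset_UNIV] by simp
    ultimately show False by simp
  qed
  obtain f where f: "\<And>v. f v \<noteq> 0" "\<And>v. f v \<triangleright> v = 0"
    using local by metis
  define g where "g = (\<Prod>b\<in>Basis. f b)"
  have "g \<triangleright> v = 0" for v
  proof (rule act_eq_0_on_basis[OF span_Basis])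
    fix b assume "b \<in> Basis"
    hence "f b dvd g"
      unfolding g_def using finite_Basis by (intro dvd_prodI)
    thus "g \<triangleright> b = 0" using f(2) act_dvd_eq_0 by blast
  qed
  moreover have "g \<noteq> 0"
    using f(1) finite_Basis by (simp add: g_def)
  ultimately show ?thesis using that by blast
qed

lemma endo_poly_eq_0_iff: "endo_poly scale f u = (\<lambda>v. 0) \<longleftrightarrow> (\<forall>v. f \<triangleright> v = 0)"
  by (simp add: fun_eq_iff)

lemma endo_min_poly:
  shows "monic (endo_min_poly scale u)" "endo_min_poly scale u \<triangleright> v = 0"
    "(\<And>v. f \<triangleright> v = 0) \<Longrightarrow> endo_min_poly scale u dvd f"
proof -
  obtain f0 where f0: "f0 \<noteq> 0" "\<And>v. f0 \<triangleright> v = 0"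
    using exists_annihilator by blast
  define I where "I = {f. \<forall>v. f \<triangleright> v = 0}"
  have "f0 \<in> I" using f0 by (simp add: I_def)
  moreover have "f + g \<in> I" if "f \<in> I" "g \<in> I" for f g
    using that by (simp add: I_def act_add)
  moreover have "g * f \<in> I" if "f \<in> I" for f g
    using that act_dvd_eq_0[of f "g * f"] by (simp add: I_def)
  ultimately obtain m where m: "m \<in> I" "monic m" "\<And>f. f \<in> I \<Longrightarrow> m dvd f"
    using poly_ideal_generator[of f0 I] f0(1) by metis
  have "endo_min_poly scale u = m"
    unfolding endo_min_poly_def endo_poly_eq_0_iff
  proof (rule the_equality)
    show "monic m \<and> (\<forall>v. m \<triangleright> v = 0) \<and> (\<forall>f. (\<forall>v. f \<triangleright> v = 0) \<longrightarrow> m dvd f)"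
      using m by (auto simp: I_def)
    fix m' assume m': "monic m' \<and> (\<forall>v. m' \<triangleright> v = 0) \<and> (\<forall>f. (\<forall>v. f \<triangleright> v = 0) \<longrightarrow> m' dvd f)"
    hence "m dvd m'" "m' dvd m"
      using m by (auto simp: I_def)
    thus "m' = m"
      using m' m(2) by (intro poly_dvd_antisym) auto
  qed
  thus "monic (endo_min_poly scale u)" "endo_min_poly scale u \<triangleright> v = 0"
    "(\<And>v. f \<triangleright> v = 0) \<Longrightarrow> endo_min_poly scale u dvd f"
    using m by (auto simp: I_def)
qed

section \<open>Eigenvalues in the algebraic closure\<close>

lemma kernel_trivial_of_coprime:
  assumes "Factorial_Ring.irreducible g" "g \<triangleright> e = 0" "e \<noteq> 0"
    "Polynomial.degree f < Polynomial.degree g" "f \<triangleright> e = 0"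
  shows "f = 0"
proof (rule ccontr)
  assume "f \<noteq> 0"
  hence "\<not> g dvd f"
    using assms(4) dvd_imp_degree_le[of g f] by linarith
  then obtain a b where "a * f + b * g = 1"
    using irreducible_poly_bezout[OF assms(1)] by blast
  hence "e = (a * f + b * g) \<triangleright> e" by simp
  also have "\<dots> = 0"
    unfolding act_add act_mult assms(2,5) P.scale_zero_right by simp
  finally show False using assms(3) by simp
qed

lemma sum_representation_nth:
  assumes "basis_list bs"
  shows "(\<Sum>i<length bs. representation (set bs) v (bs ! i) *s bs ! i) = v"
proof -
  have bs: "distinct bs" "independent (set bs)" "span (set bs) = UNIV"
    using assms by (auto simp: basis_list_def)
  have "(\<Sum>b\<in>set bs. representation (set bs) v b *s b) = v"
    using bs by (intro sum_representation_eq) auto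
  moreover have "bij_betw (\<lambda>i. bs ! i) {..<length bs} (set bs)"
    using bs(1) by (rule bij_betw_nth) auto
  ultimately show ?thesis
    by (simp add: sum.reindex_bij_betw[symmetric])
qed

text \<open>Eigenvalues are defined through representing matrices, so the cyclic list of e is
  extended to a basis; the companion matrix of g then fills the top left corner, with zeros below it
  because the span of the list is stable under u.\<close>

lemma eigenvalue_of_irreducible:
  assumes g: "Factorial_Ring.irreducible g" "monic g" and e: "g \<triangleright> e = 0" "e \<noteq> 0"
    and z: "z \<in> Root g"
  shows "ac_eigenvalue scale u z"
proof -
  define k where "k = Polynomial.degree g"
  have k: "k > 0" using irreducible_degree_pos[OF g(1)] by (simp add: k_def)
  define cs where "cs = cyc e k"
  have len_cs: "length cs = k" by (simp add: cs_def)
  have cs: "distinct cs" "independent (set cs)"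
    using cyc_independent[of k e] kernel_trivial_of_coprime[OF g(1) e] k
    by (auto simp: cs_def k_def)
  have "rep_list cs (companion_mat g)"
    unfolding rep_list_companion_mat[OF g(2)] using e(1) by (intro exI[of _ e]) (simp add: cs_def k_def)
  hence u_cs: "\<And>j. j < k \<Longrightarrow> u (cs ! j) = (\<Sum>i<k. companion_mat g $$ (i, j) *s cs ! i)"
    unfolding rep_list_def len_cs by blast
  obtain B where B: "set cs \<subseteq> B" "independent B" "UNIV \<subseteq> span B"
    by (rule maximal_independent_subset_extend[OF subset_UNIV cs(2)])
  obtain ds where ds: "set ds = B - set cs" "distinct ds"
    using finite_distinct_list[of "B - set cs"] finiteI_independent[OF B(2)] by auto
  define bs where "bs = cs @ ds"
  have set_bs: "set bs = B"
    using B(1) ds(1) by (auto simp: bs_def)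
  have bs: "basis_list bs"
    unfolding basis_list_def set_bs using B(2,3) ds cs(1) by (auto simp: bs_def)
  define n where "n = length bs"
  have kn: "k \<le> n" by (simp add: n_def bs_def len_cs)
  define A where "A = mat n n (\<lambda>(i, j). if j < k then (if i < k then companion_mat g $$ (i, j) else 0)
     else representation (set bs) (u (bs ! j)) (bs ! i))"
  have "rep_list bs A"
    unfolding rep_list_def n_def[symmetric]
  proof (intro conjI allI impI)
    show "A \<in> carrier_mat n n" by (simp add: A_def)
    fix j assume j: "j < n"
    show "u (bs ! j) = (\<Sum>i<n. A $$ (i, j) *s bs ! i)"
    proof (cases "j < k")
      case True
      have "(\<Sum>i<n. A $$ (i, j) *s bs ! i) = (\<Sum>i<k. A $$ (i, j) *s bs ! i)"
        using kn j True by (intro sum.mono_neutral_right) (auto simp: A_def)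
      also have "\<dots> = (\<Sum>i<k. companion_mat g $$ (i, j) *s cs ! i)"
        using kn j True by (intro sum.cong) (auto simp: A_def bs_def nth_append len_cs)
      also have "\<dots> = u (bs ! j)"
        using u_cs[OF True] True by (simp add: bs_def nth_append len_cs)
      finally show ?thesis ..
    next
      case False
      have "(\<Sum>i<n. A $$ (i, j) *s bs ! i) =
          (\<Sum>i<n. representation (set bs) (u (bs ! j)) (bs ! i) *s bs ! i)"
        using False j by (intro sum.cong) (auto simp: A_def)
      thus ?thesis using sum_representation_nth[OF bs] by (simp add: n_def)
    qed
  qed
  hence "represented_by scale u A"
    using bs by (auto simp: represented_by_iff)
  moreover have "eigenvalue (map_mat to_ac A) z"
  proof -
    have "[:- z, 1:] dvd ac_poly g"
      using z by (simp add: Root_def poly_eq_0_iff_dvd)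
    then obtain h where h: "ac_poly g = [:- z, 1:] * h" by (elim dvdE)
    have "h \<noteq> 0" using h g(2) by (auto simp: map_poly_eq_0_iff)
    hence deg_h: "Suc (Polynomial.degree h) = k"
      using h degree_ac_poly[of g] by (simp add: degree_mult_eq k_def del: mult_pCons_left)
    have g_coeff: "to_ac (coeff g i) = (if i = 0 then 0 else coeff h (i - 1)) - z * coeff h i" for i
    proof -
      have "to_ac (coeff g i) = coeff (ac_poly g) i" by (simp add: coeff_map_poly)
      thus ?thesis unfolding h by (cases i) (simp_all add: coeff_pCons)
    qed
    have h_top: "coeff h (k - 1) = 1"
      using g_coeff[of k] g(2) k deg_h by (simp add: k_def coeff_eq_0)
    \<comment> \<open>The coefficients of \<open>h = g / (t - z)\<close>, padded by zeros: comparing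
      coefficients in \<open>g = (t - z) h\<close> is the eigenvector equation for the companion
      matrix, and the leading coefficient 1 makes the vector nonzero.\<close>
    define x where "x = vec n (\<lambda>i. if i < k then coeff h i else 0)"
    have "x \<noteq> 0\<^sub>v n"
    proof
      assume "x = 0\<^sub>v n"
      hence "x $ (k - 1) = 0" using k kn by simp
      thus False using k kn h_top by (simp add: x_def)
    qed
    moreover have "map_mat to_ac A *\<^sub>v x = z \<cdot>\<^sub>v x"
    proof (rule eq_vecI)
      fix i assume "i < dim_vec (z \<cdot>\<^sub>v x)"
      hence i: "i < n" by (simp add: x_def)
      have "(map_mat to_ac A *\<^sub>v x) $ i = (\<Sum>j<n. to_ac (A $$ (i, j)) * x $ j)"
        using i by (simp add: A_def x_def scalar_prod_def atLeast0LessThan)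
      also have "\<dots> = (\<Sum>j<k. to_ac (A $$ (i, j)) * x $ j)"
        using kn by (intro sum.mono_neutral_right) (auto simp: x_def)
      also have "\<dots> = (\<Sum>j<k. (if i < k then to_ac (companion_mat g $$ (i, j)) else 0) * coeff h j)"
        using kn i by (intro sum.cong) (auto simp: A_def x_def)
      also have "\<dots> = z * x $ i"
      proof (cases "i < k")
        case False
        thus ?thesis using i by (simp add: x_def)
      next
        case True
        have "(\<Sum>j<k. (if i < k then to_ac (companion_mat g $$ (i, j)) else 0) * coeff h j) =
          (\<Sum>j<k. (if j = k - 1 then - to_ac (coeff g i) else 0) +
             (if Suc j = i then coeff h j else 0))"
          using True h_top by (intro sum.cong) (auto simp: companion_mat_def k_def[symmetric])
        also have "\<dots> = - to_ac (coeff g i) + (\<Sum>j<k. if Suc j = i then coeff h j else 0)"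
          using k by (simp add: sum.distrib)
        also have "(\<Sum>j<k. if Suc j = i then coeff h j else 0) = (if i = 0 then 0 else coeff h (i - 1))"
          using True by (cases i) simp_all
        also have "- to_ac (coeff g i) + \<dots> = z * coeff h i"
          unfolding g_coeff by simp
        finally show ?thesis using True i by (simp add: x_def)
      qed
      finally show "(map_mat to_ac A *\<^sub>v x) $ i = (z \<cdot>\<^sub>v x) $ i"
        using i by (simp add: x_def)
    qed (simp add: A_def x_def)
    ultimately show ?thesis
      unfolding eigenvalue_def eigenvector_def
      by (intro exI[of _ x]) (simp add: A_def x_def)
  qed
  ultimately show ?thesis by (auto simp: ac_eigenvalue_def)
qed

text \<open>The eigenvalue lives in the closure while V is a space over the base field. A functional
  with values in the closure links the two and turns f(u) into multiplication by f(z). Transposing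
  the matrix preserves the eigenvalue because it preserves the characteristic polynomial.\<close>

lemma eigenvalue_root_of_annihilator:
  assumes f: "\<And>v. f \<triangleright> v = 0" and z: "ac_eigenvalue scale u z"
  shows "z \<in> Root f"
proof -
  obtain A bs where bs: "basis_list bs" "rep_list bs A" and ev: "eigenvalue (map_mat to_ac A) z"
    using z by (auto simp: ac_eigenvalue_def represented_by_iff)
  define n where "n = length bs"
  have A: "A \<in> carrier_mat n n"
    and rep: "\<And>j. j < n \<Longrightarrow> u (bs ! j) = (\<Sum>i<n. A $$ (i, j) *s bs ! i)"
    using bs(2) by (auto simp: rep_list_def n_def)
  have bs': "distinct bs" "independent (set bs)" "span (set bs) = UNIV"
    using bs(1) by (auto simp: basis_list_def)
  define M where "M = map_mat to_ac A"
  have M: "M \<in> carrier_mat n n" "M\<^sup>T \<in> carrier_mat n n"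
    using A by (auto simp: M_def)
  have "eigenvalue M\<^sup>T z"
    using ev unfolding M_def[symmetric] eigenvalue_root_char_poly[OF M(1)]
      eigenvalue_root_char_poly[OF M(2)] char_poly_transpose_mat[OF M(1)] .
  then obtain y where y: "y \<in> carrier_vec n" "y \<noteq> 0\<^sub>v n" "M\<^sup>T *\<^sub>v y = z \<cdot>\<^sub>v y"
    using M by (auto simp: eigenvalue_def eigenvector_def)
  \<comment> \<open>A left eigenvector of \<open>A\<close> is a functional on which \<open>u\<close> acts as the scalar \<open>z\<close>.\<close>
  define \<phi> where "\<phi> v = (\<Sum>i<n. to_ac (representation (set bs) v (bs ! i)) * y $ i)" for v
  have in_span: "v \<in> span (set bs)" for v using bs'(3) by simp
  have \<phi>_add: "\<phi> (v + w) = \<phi> v + \<phi> w" for v w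
    by (simp add: \<phi>_def representation_add[OF bs'(2) in_span in_span] distrib_right sum.distrib)
  have \<phi>_scale: "\<phi> (a *s v) = to_ac a * \<phi> v" for a v
    by (simp add: \<phi>_def representation_scale[OF bs'(2) in_span] sum_distrib_left mult.assoc)
  have \<phi>_0: "\<phi> 0 = 0"
    using \<phi>_scale[of 0 0] by simp
  have \<phi>_sum: "\<phi> (\<Sum>i\<in>I. h i) = (\<Sum>i\<in>I. \<phi> (h i))" for I :: "nat set" and h
    by (induction I rule: infinite_finite_induct) (simp_all add: \<phi>_0 \<phi>_add)
  have \<phi>_bs: "\<phi> (bs ! j) = y $ j" if "j < n" for j
  proof -
    have "bs ! j \<in> set bs" using that by (simp add: n_def)
    hence "\<phi> (bs ! j) = (\<Sum>i<n. if i = j then y $ i else 0)"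
      unfolding \<phi>_def using that bs'(1)
      by (intro sum.cong) (auto simp: representation_basis[OF bs'(2)] n_def nth_eq_iff_index_eq)
    thus ?thesis using that by simp
  qed
  have \<phi>_u_bs: "\<phi> (u (bs ! j)) = z * \<phi> (bs ! j)" if j: "j < n" for j
  proof -
    have "\<phi> (u (bs ! j)) = (\<Sum>i<n. to_ac (A $$ (i, j)) * y $ i)"
      unfolding rep[OF j] \<phi>_sum \<phi>_scale by (intro sum.cong) (simp_all add: \<phi>_bs)
    also have "\<dots> = (M\<^sup>T *\<^sub>v y) $ j"
      using j A y(1) by (simp add: M_def scalar_prod_def atLeast0LessThan)
    also have "\<dots> = z * \<phi> (bs ! j)"
      using j y(1) by (simp add: y(3) \<phi>_bs)
    finally show ?thesis .
  qed
  have \<phi>_u: "\<phi> (u v) = z * \<phi> v" for v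
  proof -
    have "subspace {v. \<phi> (u v) = z * \<phi> v}"
      by (auto intro!: subspaceI simp: \<phi>_0 \<phi>_add \<phi>_scale u.zero u.add u.scale algebra_simps)
    moreover have "set bs \<subseteq> {v. \<phi> (u v) = z * \<phi> v}"
      using \<phi>_u_bs by (auto simp: in_set_conv_nth n_def)
    ultimately have "span (set bs) \<subseteq> {v. \<phi> (u v) = z * \<phi> v}"
      by (intro span_minimal)
    thus ?thesis using in_span by auto
  qed
  have \<phi>_act: "\<phi> (h \<triangleright> v) = poly (ac_poly h) z * \<phi> v" for h v
    by (induction h) (simp_all add: \<phi>_0 act_pCons \<phi>_add \<phi>_scale \<phi>_u ac_poly_pCons algebra_simps)
  obtain j where j: "j < n" "y $ j \<noteq> 0"
    using y(1,2) by (metis eq_vecI carrier_vecD index_zero_vec)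
  have "poly (ac_poly f) z * \<phi> (bs ! j) = 0"
    using \<phi>_act[of f "bs ! j"] f \<phi>_0 by simp
  thus ?thesis using j \<phi>_bs[OF j(1)] by (simp add: Root_def)
qed

text \<open>Write the minimal polynomial as \<open>F ^ k * h\<close> with h prime to F. An
  irreducible factor g of h kills a nonzero vector, so a root of g is an eigenvalue and hence a root
  of F; then F divides g and thus h, which is absurd. So h is constant.\<close>

lemma eigenvalues_in_Root_iff:
  assumes F: "Factorial_Ring.irreducible F"
  shows "(\<forall>z. ac_eigenvalue scale u z \<longrightarrow> z \<in> Root F) \<longleftrightarrow> (\<exists>N. \<forall>v. F ^ N \<triangleright> v = 0)"
proof
  assume "\<exists>N. \<forall>v. F ^ N \<triangleright> v = 0"
  then obtain N where N: "\<And>v. F ^ N \<triangleright> v = 0" by blast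
  show "\<forall>z. ac_eigenvalue scale u z \<longrightarrow> z \<in> Root F"
  proof (intro allI impI)
    fix z assume "ac_eigenvalue scale u z"
    from eigenvalue_root_of_annihilator[OF N this] show "z \<in> Root F"
      by (simp add: Root_def ac_poly_power poly_power)
  qed
next
  assume ev: "\<forall>z. ac_eigenvalue scale u z \<longrightarrow> z \<in> Root F"
  define m where "m = endo_min_poly scale u"
  have m: "monic m" "\<And>v. m \<triangleright> v = 0" "\<And>f. (\<And>v. f \<triangleright> v = 0) \<Longrightarrow> m dvd f"
    unfolding m_def by (rule endo_min_poly; assumption)+
  have "m \<noteq> 0" using m(1) by auto
  then obtain k h where h: "m = F ^ k * h" "\<not> F dvd h"
    using irreducible_power_decomp[OF F] by metis
  have "h \<noteq> 0" using h \<open>m \<noteq> 0\<close> by auto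
  have "Polynomial.degree h = 0"
  proof (rule ccontr)
    assume "Polynomial.degree h \<noteq> 0"
    hence "Polynomial.degree h > 0" by simp
    then obtain g where g: "Factorial_Ring.irreducible g" "monic g" "g dvd h"
      by (rule exists_monic_irreducible_factor)
    then obtain h' where h': "h = g * h'" by (elim dvdE)
    \<comment> \<open>By minimality, m with the factor g removed does not annihilate V, and its
      nonzero values are killed by g.\<close>
    have "\<not> m dvd F ^ k * h'"
    proof
      assume "m dvd F ^ k * h'"
      hence "Polynomial.degree m \<le> Polynomial.degree (F ^ k * h')"
        using \<open>m \<noteq> 0\<close> h h' by (intro dvd_imp_degree_le) auto
      moreover have "m = g * (F ^ k * h')" using h h' by (simp add: mult_ac)
      hence "Polynomial.degree m = Polynomial.degree g + Polynomial.degree (F ^ k * h')"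
        using \<open>m \<noteq> 0\<close> by (metis degree_mult_eq mult_eq_0_iff)
      ultimately show False using irreducible_degree_pos[OF g(1)] by simp
    qed
    then obtain v where v: "(F ^ k * h') \<triangleright> v \<noteq> 0" using m(3) by blast
    have "g \<triangleright> (F ^ k * h') \<triangleright> v = m \<triangleright> v"
      unfolding act_mult[symmetric] h(1) h' by (simp only: mult_ac)
    hence e: "g \<triangleright> (F ^ k * h') \<triangleright> v = 0" using m(2) by simp
    obtain z where z: "z \<in> Root g"
      using root_exists[OF irreducible_degree_pos[OF g(1)]] .
    have "z \<in> Root F"
      using eigenvalue_of_irreducible[OF g(1,2) e v z] ev by blast
    hence "F dvd g"
      using common_root_imp_dvd[OF F z] by blast
    thus False using g(3) h(2) dvd_trans by blast
  qed
  then obtain c where c: "h = [:c:]" by (elim degree_eq_zeroE)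
  hence "c \<noteq> 0" using \<open>h \<noteq> 0\<close> by auto
  have "F ^ k \<triangleright> v = 0" for v
  proof -
    have "m = Polynomial.smult c (F ^ k)" using h c by simp
    hence "c *s (F ^ k \<triangleright> v) = 0" using m(2)[of v] by (metis act_smult)
    thus ?thesis using \<open>c \<noteq> 0\<close> by simp
  qed
  thus "\<exists>N. \<forall>v. F ^ N \<triangleright> v = 0" by blast
qed

end

section \<open>The quartic of a pair of quadratic polynomials\<close>

lemma generate_field_mono_range:
  fixes S T :: "'a::field alg_closure set"
  assumes "S \<subseteq> generate_field ring_of_type_algebra (range to_ac \<union> T)"
  shows "generate_field ring_of_type_algebra (range to_ac \<union> S) \<subseteq>
    generate_field ring_of_type_algebra (range to_ac \<union> T)"
proof
  fix z assume "z \<in> generate_field ring_of_type_algebra (range to_ac \<union> S)"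
  thus "z \<in> generate_field ring_of_type_algebra (range to_ac \<union> T)"
  proof induction
    case (incl h)
    thus ?case using assms by (auto intro: generate_field.incl)
  qed (auto intro: generate_field.intros)
qed

locale quadratic_pair =
  fixes p q :: "'a::field poly"
  assumes monic_p: "monic p" and degree_p: "Polynomial.degree p = 2"
    and monic_q: "monic q" and degree_q: "Polynomial.degree q = 2"
begin

definition "tr_p = - coeff p 1"
definition "nrm_p = coeff p 0"
definition "tr_q = - coeff q 1"
definition "nrm_q = coeff q 0"

definition \<tau> :: "'a poly" where "\<tau> = [:tr_p - tr_q, - 1:]"

lemma p_eq: "p = [:nrm_p, - tr_p, 1:]"
proof -
  have "coeff p 2 = 1" using monic_p degree_p by simp
  thus ?thesis
    using degree_p by (intro poly_eqI) (auto simp: tr_p_def nrm_p_def coeff_pCons coeff_eq_0 numeral_2_eq_2 split: nat.split)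
qed

lemma q_eq: "q = [:nrm_q, - tr_q, 1:]"
proof -
  have "coeff q 2 = 1" using monic_q degree_q by simp
  thus ?thesis
    using degree_q by (intro poly_eqI) (auto simp: tr_q_def nrm_q_def coeff_pCons coeff_eq_0 numeral_2_eq_2 split: nat.split)
qed

lemma Root_p_square: "x \<in> Root p \<Longrightarrow> x * x = to_ac tr_p * x - to_ac nrm_p"
proof -
  have "ac_poly p = [:to_ac nrm_p, - to_ac tr_p, 1:]"
    by (subst p_eq) (simp add: ac_poly_pCons)
  thus "x \<in> Root p \<Longrightarrow> x * x = to_ac tr_p * x - to_ac nrm_p"
    by (simp add: Root_def algebra_simps)
qed

lemma Root_q_square: "y \<in> Root q \<Longrightarrow> y * y = to_ac tr_q * y - to_ac nrm_q"
proof -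
  have "ac_poly q = [:to_ac nrm_q, - to_ac tr_q, 1:]"
    by (subst q_eq) (simp add: ac_poly_pCons)
  thus "y \<in> Root q \<Longrightarrow> y * y = to_ac tr_q * y - to_ac nrm_q"
    by (simp add: Root_def algebra_simps)
qed

abbreviation F where "F \<equiv> F_poly p q"

text \<open>Replaces the description of F by roots in the closure by explicit coefficients in the
  base field, on which the later polynomial identities are computed.\<close>

lemma F_eq: "F = quartic_of_coeffs tr_p nrm_p tr_q nrm_q"
proof -
  obtain x1 x2 where p: "ac_poly p = [:-x1, 1:] * [:-x2, 1:]"
    using ac_poly_splits_quadratic[OF monic_p degree_p] .
  obtain y1 y2 where q: "ac_poly q = [:-y1, 1:] * [:-y2, 1:]"
    using ac_poly_splits_quadratic[OF monic_q degree_q] .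
  have "ac_poly F = ac_poly (quartic_of_coeffs tr_p nrm_p tr_q nrm_q)"
    unfolding ac_poly_F_poly[OF p q] quartic_of_coeffs_eq ac_poly_quartic_of_coeffs
      quadratic_factor_coeffs[OF p] quadratic_factor_coeffs[OF q]
    by (simp add: tr_p_def nrm_p_def tr_q_def nrm_q_def)
  thus ?thesis by (rule ac_poly_inject)
qed

lemma monic_F: "monic F" and degree_F: "Polynomial.degree F = 4"
  by (simp_all add: F_eq quartic_of_coeffs_def)

text \<open>The substitution exchanges x - y with the difference of the conjugate roots; the degree
  of F is even, so no sign appears.\<close>

lemma F_pcompose_tau: "F \<circ>\<^sub>p \<tau> = F"
  by (simp add: F_eq quartic_of_coeffs_def \<tau>_def pcompose_pCons algebra_simps)

lemma tau_pcompose_tau: "\<tau> \<circ>\<^sub>p \<tau> = [:0, 1:]"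
  by (simp add: \<tau>_def pcompose_pCons)

lemma Root_F: "Root F = {x - y | x y. x \<in> Root p \<and> y \<in> Root q}"
proof -
  obtain x1 x2 where p: "ac_poly p = [:-x1, 1:] * [:-x2, 1:]"
    using ac_poly_splits_quadratic[OF monic_p degree_p] .
  obtain y1 y2 where q: "ac_poly q = [:-y1, 1:] * [:-y2, 1:]"
    using ac_poly_splits_quadratic[OF monic_q degree_q] .
  note Root_quadratic[OF p] Root_quadratic[OF q]
  moreover have "Root F = {x1 - y1, x1 - y2, x2 - y1, x2 - y2}"
    unfolding Root_def ac_poly_F_poly[OF p q] by (rule poly_linear_factors_roots)
  ultimately show ?thesis by auto
qed

end

locale distinct_quadratic_pair = quadratic_pair +
  assumes irreducible_p: "Factorial_Ring.irreducible p"
    and irreducible_q: "Factorial_Ring.irreducible q"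
    and separable_p: "separable_poly p"
    and separable_q: "separable_poly q"
    and splitting_ne: "splitting_field p \<noteq> splitting_field q"
    and discr_ne: "quad_discr p \<noteq> quad_discr q"
begin

lemma Root_not_in_base:
  fixes f :: "'a poly"
  assumes "Factorial_Ring.irreducible f" "Polynomial.degree f = 2"
  shows "to_ac a \<notin> Root f"
proof
  assume "to_ac a \<in> Root f"
  hence "to_ac (poly f a) = 0"
    unfolding Root_def by (simp add: poly_ac_poly)
  hence "[:- a, 1:] dvd f"
    by (simp add: poly_eq_0_iff_dvd)
  then obtain g where g: "f = [:- a, 1:] * g" by (elim dvdE)
  have "g \<noteq> 0" using g assms(2) by auto
  hence "Polynomial.degree g = 1"
    using assms(2) unfolding g by (subst (asm) degree_mult_eq) auto
  moreover have "[:- a, 1:] dvd 1 \<or> g dvd 1"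
    using Factorial_Ring.irreducibleD[OF assms(1) g] .
  ultimately show False
    using \<open>g \<noteq> 0\<close> by (auto simp: is_unit_iff_degree)
qed

lemma root_sum:
  assumes "ac_poly p = [:-x1, 1:] * [:-x2, 1:]" "ac_poly q = [:-y1, 1:] * [:-y2, 1:]"
  shows "x2 = to_ac tr_p - x1" "y2 = to_ac tr_q - y1"
  using quadratic_factor_coeffs(1)[OF assms(1)] quadratic_factor_coeffs(1)[OF assms(2)]
  by (auto simp: tr_p_def tr_q_def algebra_simps)

lemma Root_split:
  assumes "x \<in> Root p" "y \<in> Root q"
  shows "ac_poly p = [:- x, 1:] * [:- (to_ac tr_p - x), 1:]"
    "ac_poly q = [:- y, 1:] * [:- (to_ac tr_q - y), 1:]"
    "Root p = {x, to_ac tr_p - x}" "Root q = {y, to_ac tr_q - y}"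
proof -
  obtain x1 x2 where p: "ac_poly p = [:-x1, 1:] * [:-x2, 1:]"
    using ac_poly_splits_quadratic[OF monic_p degree_p] .
  obtain y1 y2 where q: "ac_poly q = [:-y1, 1:] * [:-y2, 1:]"
    using ac_poly_splits_quadratic[OF monic_q degree_q] .
  have x: "x = x1 \<or> x = to_ac tr_p - x1" and y: "y = y1 \<or> y = to_ac tr_q - y1"
    using assms root_sum[OF p q] unfolding Root_quadratic[OF p] Root_quadratic[OF q] by auto
  show p': "ac_poly p = [:- x, 1:] * [:- (to_ac tr_p - x), 1:]"
    using x
  proof
    assume "x = to_ac tr_p - x1"
    hence "to_ac tr_p - x = x1" "to_ac tr_p - x1 = x" by simp_all
    thus ?thesis unfolding p root_sum[OF p q] by (simp only: mult.commute)
  qed (simp add: p root_sum[OF p q])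
  show q': "ac_poly q = [:- y, 1:] * [:- (to_ac tr_q - y), 1:]"
    using y
  proof
    assume "y = to_ac tr_q - y1"
    hence "to_ac tr_q - y = y1" "to_ac tr_q - y1 = y" by simp_all
    thus ?thesis unfolding q root_sum[OF p q] by (simp only: mult.commute)
  qed (simp add: q root_sum[OF p q])
  show "Root p = {x, to_ac tr_p - x}" "Root q = {y, to_ac tr_q - y}"
    by (rule Root_quadratic[OF p'], rule Root_quadratic[OF q'])
qed

lemma generate_combination:
  assumes "z \<in> K" "K = generate_field ring_of_type_algebra (range to_ac \<union> T)"
  shows "to_ac a + to_ac b * z \<in> K"
proof -
  have "to_ac c \<in> K" for c
    unfolding assms(2) by (intro generate_field.incl) auto
  moreover have "v + w \<in> K" "v * w \<in> K" if "v \<in> K" "w \<in> K" for v w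
    using generate_field.eng_add[OF that[unfolded assms(2)]]
      generate_field.eng_mult[OF that[unfolded assms(2)]]
    by (simp_all add: assms(2) ring_of_type_algebra_def)
  ultimately show ?thesis using assms(1) by simp
qed

text \<open>The coefficient b cannot vanish, since y is not in the base field, so x is affine in y
  as well. Each splitting field then contains the roots of the other polynomial, and the two fields
  coincide.\<close>

lemma root_not_affine:
  assumes "x \<in> Root p" "y \<in> Root q"
  shows "y \<noteq> to_ac a + to_ac b * x"
proof
  assume eq: "y = to_ac a + to_ac b * x"
  have "b \<noteq> 0"
    using Root_not_in_base[OF irreducible_q degree_q, of a] eq assms by auto
  have "to_ac (- a / b) + to_ac (1 / b) * (to_ac a + to_ac b * x) =
      to_ac (- a / b + 1 / b * a) + to_ac (1 / b * b) * x"
    unfolding to_ac_add to_ac_mult by (simp only: distrib_left mult.assoc add.assoc)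
  hence "to_ac (- a / b) + to_ac (1 / b) * (to_ac a + to_ac b * x) = x"
    using \<open>b \<noteq> 0\<close> by simp
  hence eq': "x = to_ac (- a / b) + to_ac (1 / b) * y"
    unfolding eq by (rule sym)
  define K where "K T = generate_field ring_of_type_algebra (range to_ac \<union> T)" for T :: "'a alg_closure set"
  have incl: "z \<in> K T" if "z \<in> T" for z T
    unfolding K_def using that by (intro generate_field.incl) auto
  note comb = generate_combination[OF _ K_def]
  have "to_ac tr_p - x \<in> K (Root q)" "x \<in> K (Root q)"
  proof -
    have "y \<in> K (Root q)" using assms incl by blast
    thus x: "x \<in> K (Root q)" unfolding eq' by (rule comb)
    show "to_ac tr_p - x \<in> K (Root q)"
      using comb[OF x, of tr_p "- 1"] by simp
  qed
  hence "Root p \<subseteq> K (Root q)"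
    unfolding Root_split(3)[OF assms] by blast
  moreover have "to_ac tr_q - y \<in> K (Root p)" "y \<in> K (Root p)"
  proof -
    have "x \<in> K (Root p)" using assms incl by blast
    thus y: "y \<in> K (Root p)" unfolding eq by (rule comb)
    show "to_ac tr_q - y \<in> K (Root p)"
      using comb[OF y, of tr_q "- 1"] by simp
  qed
  hence "Root q \<subseteq> K (Root p)"
    unfolding Root_split(4)[OF assms] by blast
  ultimately have "K (Root p) = K (Root q)"
    unfolding K_def by (intro equalityI generate_field_mono_range)
  thus False using splitting_ne by (simp add: splitting_field_def K_def)
qed

text \<open>The left side is A + B y with A and B affine in x. If B were nonzero, dividing by it,
  with the inverse made explicit through the norm N of B, would make y affine in x.\<close>

lemma roots_independent:
  assumes "x \<in> Root p" "y \<in> Root q"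
    and eq: "to_ac a + to_ac b * x + to_ac c * y + to_ac d * (x * y) = 0"
  shows "a = 0" "b = 0" "c = 0" "d = 0"
proof -
  define A B where "A = to_ac a + to_ac b * x" and "B = to_ac c + to_ac d * x"
  have AB: "A + B * y = 0"
    using eq by (simp add: A_def B_def algebra_simps)
  note xx = Root_p_square[OF assms(1)]
  have zero: "s = 0 \<and> t = 0" if "to_ac s + to_ac t * x = 0" for s t
  proof -
    have "t = 0"
    proof (rule ccontr)
      assume "t \<noteq> 0"
      hence "x = to_ac (- s / t)"
        using that by (simp add: field_simps add_eq_0_iff)
      thus False
        using Root_not_in_base[OF irreducible_p degree_p] assms(1) by blast
    qed
    thus ?thesis using that by simp
  qed
  have "B = 0"
  proof (rule ccontr)
    assume "B \<noteq> 0"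
    \<comment> \<open>The conjugate of \<open>B\<close> over the base field.\<close>
    define B' where "B' = to_ac (c + d * tr_p) - to_ac d * x"
    define N where "N = c * c + c * d * tr_p + d * d * nrm_p"
    have N: "B * B' = to_ac N"
    proof -
      have "B * B' = to_ac (c * (c + d * tr_p)) + to_ac (d * (c + d * tr_p) - c * d) * x - to_ac (d * d) * (x * x)"
        by (simp add: B_def B'_def algebra_simps)
      also have "\<dots> = to_ac N"
        unfolding xx N_def by (simp add: algebra_simps)
      finally show ?thesis .
    qed
    have "B' \<noteq> 0"
    proof
      assume "B' = 0"
      hence "to_ac (c + d * tr_p) + to_ac (- d) * x = 0" by (simp add: B'_def)
      hence "c = 0" "d = 0" using zero[of "c + d * tr_p" "- d"] by auto
      thus False using \<open>B \<noteq> 0\<close> by (simp add: B_def)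
    qed
    hence "N \<noteq> 0"
      using N \<open>B \<noteq> 0\<close> by (metis mult_eq_0_iff to_ac_0)
    have "to_ac N * y = (B * y) * B'"
      unfolding N[symmetric] by (simp only: mult_ac)
    also have "\<dots> = - A * B'"
      using AB by (simp add: add_eq_0_iff)
    also have "\<dots> = to_ac (- a * (c + d * tr_p)) + to_ac (a * d - b * (c + d * tr_p)) * x + to_ac (b * d) * (x * x)"
      by (simp add: A_def B'_def algebra_simps)
    also have "\<dots> = to_ac (- a * (c + d * tr_p) - b * d * nrm_p) + to_ac (a * d - b * c) * x"
      unfolding xx by (simp add: algebra_simps)
    finally have "y = to_ac ((- a * (c + d * tr_p) - b * d * nrm_p) / N) + to_ac ((a * d - b * c) / N) * x"
      using \<open>N \<noteq> 0\<close> by (simp add: divide_simps algebra_simps)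
    thus False using root_not_affine[OF assms(1,2)] by blast
  qed
  hence "A = 0" using AB by simp
  from zero[of a b] zero[of c d] show "a = 0" "b = 0" "c = 0" "d = 0"
    using \<open>A = 0\<close> \<open>B = 0\<close> by (auto simp: A_def B_def)
qed

text \<open>The point is that the coefficients do not depend on the choice of x and y. This
  uniformity plays the part of a Galois group: by independence, a polynomial vanishing at one
  difference x - y has zero coefficients here and so vanishes at all of them.\<close>

lemma poly_difference_normal_form:
  "\<exists>a b c d. \<forall>x\<in>Root p. \<forall>y\<in>Root q.
     poly (ac_poly f) (x - y) = to_ac a + to_ac b * x + to_ac c * y + to_ac d * (x * y)"
proof (induction f)
  case 0
  show ?case by (intro exI[of _ 0]) simp
next
  case (pCons k f)
  then obtain a b c d where IH: "\<And>x y. x \<in> Root p \<Longrightarrow> y \<in> Root q \<Longrightarrow>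
     poly (ac_poly f) (x - y) = to_ac a + to_ac b * x + to_ac c * y + to_ac d * (x * y)"
    by blast
  \<comment> \<open>The form for f is multiplied by x - y, k is added, and the squares of x and y
    are reduced by p and q.\<close>
  define a' b' c' d' where "a' = k - b * nrm_p + c * nrm_q" and "b' = a + b * tr_p + d * nrm_q"
    and "c' = - a - c * tr_q - d * nrm_p" and "d' = c - b + d * tr_p - d * tr_q"
  have "poly (ac_poly (pCons k f)) (x - y) = to_ac a' + to_ac b' * x + to_ac c' * y + to_ac d' * (x * y)"
    if "x \<in> Root p" "y \<in> Root q" for x y
  proof -
    note xx = Root_p_square[OF that(1)] and yy = Root_q_square[OF that(2)]
    have "poly (ac_poly (pCons k f)) (x - y) = to_ac k + to_ac a * x - to_ac a * y + to_ac b * (x * x)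
        - to_ac b * (x * y) + to_ac c * (x * y) - to_ac c * (y * y) + to_ac d * (x * x) * y - to_ac d * x * (y * y)"
      by (simp add: ac_poly_pCons IH[OF that] algebra_simps)
    also have "\<dots> = to_ac a' + to_ac b' * x + to_ac c' * y + to_ac d' * (x * y)"
      unfolding xx yy by (simp add: a'_def b'_def c'_def d'_def algebra_simps)
    finally show ?thesis .
  qed
  thus ?case by blast
qed

text \<open>A nonconstant factor has a root among the differences x - y, hence vanishes at all four
  by the normal form. These are distinct, so its degree is 4.\<close>

lemma irreducible_F: "Factorial_Ring.irreducible F"
proof -
  obtain x1 x2 where p: "ac_poly p = [:-x1, 1:] * [:-x2, 1:]"
    using ac_poly_splits_quadratic[OF monic_p degree_p] .
  obtain y1 y2 where q: "ac_poly q = [:-y1, 1:] * [:-y2, 1:]"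
    using ac_poly_splits_quadratic[OF monic_q degree_q] .
  have "x1 \<noteq> x2" "y1 \<noteq> y2"
    using separable_p separable_q unfolding separable_poly_def p q by (blast dest: rsquarefree_imp_distinct)+
  \<comment> \<open>Once p and q are separable, two of the four differences can coincide only if x1
    - x2 is plus or minus y1 - y2, that is, if the discriminants agree.\<close>
  moreover have "(x1 - x2)\<^sup>2 \<noteq> (y1 - y2)\<^sup>2"
    using discr_ne unfolding quad_discr_eq[OF p] quad_discr_eq[OF q] .
  hence "x1 - x2 \<noteq> y1 - y2" "x1 - x2 \<noteq> y2 - y1"
    by (auto simp: power2_commute)
  ultimately have card: "card (Root F) = 4"
    unfolding Root_def ac_poly_F_poly[OF p q]
  proof -
    have "{x. poly ([:- (x1 - y1), 1:] * [:- (x1 - y2), 1:] * [:- (x2 - y1), 1:] * [:- (x2 - y2), 1:]) x = 0} =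
      {x1 - y1, x1 - y2, x2 - y1, x2 - y2}" by (rule poly_linear_factors_roots)
    moreover have "distinct [x1 - y1, x1 - y2, x2 - y1, x2 - y2]"
      using \<open>x1 \<noteq> x2\<close> \<open>y1 \<noteq> y2\<close> \<open>x1 - x2 \<noteq> y1 - y2\<close> \<open>x1 - x2 \<noteq> y2 - y1\<close>
      by (auto simp: algebra_simps)
    ultimately show "card {x. poly ([:- (x1 - y1), 1:] * [:- (x1 - y2), 1:] * [:- (x2 - y1), 1:] * [:- (x2 - y2), 1:]) x = 0} = 4"
      using distinct_card[of "[x1 - y1, x1 - y2, x2 - y1, x2 - y2]"] by simp
  qed
  show ?thesis
    unfolding Factorial_Ring.irreducible_def
  proof (intro conjI allI impI)
    show "F \<noteq> 0" using monic_F by auto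
    show "\<not> is_unit F"
      using degree_F \<open>F \<noteq> 0\<close> by (simp add: is_unit_iff_degree)
    fix f g assume fg: "F = f * g"
    hence nz: "f \<noteq> 0" "g \<noteq> 0" using \<open>F \<noteq> 0\<close> by auto
    have deg: "Polynomial.degree f + Polynomial.degree g = 4"
      using fg degree_F nz by (simp add: degree_mult_eq)
    show "is_unit f \<or> is_unit g"
    proof (cases "Polynomial.degree f = 0")
      case True
      thus ?thesis using nz by (simp add: is_unit_iff_degree)
    next
      case False
      then obtain z where z: "z \<in> Root f"
        using root_exists[of f] by auto
      hence "z \<in> Root F"
        by (simp add: Root_def fg ac_poly_mult)
      then obtain x y where xy: "z = x - y" "x \<in> Root p" "y \<in> Root q"
        by (auto simp: Root_F)
      obtain a b c d where nf: "\<forall>x\<in>Root p. \<forall>y\<in>Root q.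
          poly (ac_poly f) (x - y) = to_ac a + to_ac b * x + to_ac c * y + to_ac d * (x * y)"
        using poly_difference_normal_form by blast
      have "to_ac a + to_ac b * x + to_ac c * y + to_ac d * (x * y) = 0"
        using nf xy z by (simp add: Root_def)
      note zero = roots_independent[OF xy(2,3) this]
      have "Root F \<subseteq> Root f"
      proof
        fix w assume "w \<in> Root F"
        then obtain x' y' where "w = x' - y'" "x' \<in> Root p" "y' \<in> Root q"
          by (auto simp: Root_F)
        thus "w \<in> Root f" using nf zero by (simp add: Root_def[of f])
      qed
      moreover have "finite (Root f)"
        unfolding Root_def using nz by (intro poly_roots_finite) (simp add: map_poly_eq_0_iff)
      ultimately have "4 \<le> card (Root f)"
        using card card_mono by metis
      also have "\<dots> \<le> Polynomial.degree f"
        unfolding Root_def using nz card_poly_roots_bound[of "ac_poly f"]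
        by (simp add: degree_ac_poly map_poly_eq_0_iff)
      finally have "Polynomial.degree g = 0" using deg by simp
      thus ?thesis using nz by (simp add: is_unit_iff_degree)
    qed
  qed
qed

text \<open>Vanishing would mean characteristic 2 and equal traces. In characteristic 2 the
  discriminant is the square of the trace, so the discriminants would agree.\<close>

lemma kappa_nonzero: "[:- (tr_p - tr_q), 2:] \<noteq> (0 :: 'a poly)"
proof
  assume "[:- (tr_p - tr_q), 2:] = (0 :: 'a poly)"
  hence two: "(2::'a) = 0" and s: "tr_p = tr_q" by simp_all
  obtain x1 x2 where p: "ac_poly p = [:-x1, 1:] * [:-x2, 1:]"
    using ac_poly_splits_quadratic[OF monic_p degree_p] .
  obtain y1 y2 where q: "ac_poly q = [:-y1, 1:] * [:-y2, 1:]"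
    using ac_poly_splits_quadratic[OF monic_q degree_q] .
  have "to_ac (2::'a) = 0" using two by simp
  hence "(2 :: 'a alg_closure) = 0" by simp
  hence "4 = (0 :: 'a alg_closure)" by (metis mult_2 numeral_Bit0 add.right_neutral)
  hence eq: "(a - b)\<^sup>2 = (a + b)\<^sup>2" for a b :: "'a alg_closure"
    by (simp add: power2_eq_square algebra_simps)
  have "x1 + x2 = y1 + y2"
    using s unfolding quadratic_factor_coeffs(1)[OF p] quadratic_factor_coeffs(1)[OF q]
    by (simp add: tr_p_def tr_q_def)
  thus False
    using discr_ne unfolding quad_discr_eq[OF p] quad_discr_eq[OF q] eq by simp
qed

end

section \<open>Differences and twisted square roots of the quartic\<close>

locale endo_pair = endo scale Basis u + quadratic_pair p q
  for scale :: "'a::field \<Rightarrow> 'v::ab_group_add \<Rightarrow> 'v" (infixr \<open>*s\<close> 75) and Basis and u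
    and p q :: "'a poly"
begin

definition twisted_root :: "('v \<Rightarrow> 'v) \<Rightarrow> bool" where
  "twisted_root c \<longleftrightarrow> Vector_Spaces.linear scale scale c \<and>
     (\<forall>v. c (u v) = \<tau> \<triangleright> c v) \<and> (\<forall>v. c (c v) = F \<triangleright> v)"

lemma endo_poly_quadratic:
  "endo_poly scale [:k, - s, 1:] a v = a (a v) - s *s a v + k *s v"
proof -
  have "endo_poly scale [:k, - s, 1:] a v = k *s v + ((- s) *s a v + a (a v))"
    by (simp add: endo_poly_def numeral_2_eq_2)
  thus ?thesis by (simp add: algebra_simps)
qed

lemma tau_act: "\<tau> \<triangleright> v = (tr_p - tr_q) *s v - u v"
  by (simp add: \<tau>_def act_pCons u.scale u.zero u.neg)

lemma twisted_root_of_pq_difference: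
  assumes "pq_difference scale p q u"
  shows "\<exists>c. twisted_root c"
proof -
  obtain a b where a: "Vector_Spaces.linear scale scale a" and b: "Vector_Spaces.linear scale scale b"
    and pa: "endo_poly scale p a = (\<lambda>v. 0)" and qb: "endo_poly scale q b = (\<lambda>v. 0)"
    and u: "u = (\<lambda>v. a v - b v)"
    using assms by (auto simp: pq_difference_def)
  interpret A: Vector_Spaces.linear scale scale a by fact
  interpret B: Vector_Spaces.linear scale scale b by fact
  have aa: "a (a v) = tr_p *s a v - nrm_p *s v" for v
  proof -
    have "endo_poly scale [:nrm_p, - tr_p, 1:] a v = 0" using pa p_eq by metis
    thus ?thesis unfolding endo_poly_quadratic by (simp add: algebra_simps)
  qed
  have bb: "b (b v) = tr_q *s b v - nrm_q *s v" for v
  proof -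
    have "endo_poly scale [:nrm_q, - tr_q, 1:] b v = 0" using qb q_eq by metis
    thus ?thesis unfolding endo_poly_quadratic by (simp add: algebra_simps)
  qed
  note lin = A.add A.diff A.scale A.neg B.add B.diff B.scale B.neg
  define c where "c v = a (b v) - b (a v)" for v
  have "Vector_Spaces.linear scale scale c"
    by unfold_locales (simp_all add: c_def lin algebra_simps)
  moreover have "c (u v) = \<tau> \<triangleright> c v" for v
    unfolding tau_act by (simp add: c_def u lin aa bb algebra_simps)
  moreover have "c (c v) = F \<triangleright> v" for v
  proof -
    \<comment> \<open>\<open>N(u)\<close> is the element \<open>a b* + b a*\<close>, where
      \<open>a* = tr_p - a\<close> and \<open>b* = tr_q - b\<close>. At the roots of F, N takes the
      values x1 y2 + x2 y1 and x1 y1 + x2 y2, whose sum is \<open>tr_p * tr_q\<close> and whose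
      product is \<open>C\<close>; hence F is a quadratic polynomial in N.\<close>
    define N where "N = [:nrm_p + nrm_q, - (tr_p - tr_q), 1:]"
    define C where "C = nrm_q * tr_p * tr_p + nrm_p * tr_q * tr_q - nrm_p * nrm_q - nrm_p * nrm_q - nrm_p * nrm_q - nrm_p * nrm_q"
    have F: "F = N * N - Polynomial.smult (tr_p * tr_q) N + [:C:]"
      by (simp add: F_eq quartic_of_coeffs_def N_def C_def algebra_simps)
    have N: "N \<triangleright> w = tr_q *s a w + tr_p *s b w - a (b w) - b (a w)" for w
    proof -
      have "N \<triangleright> w = (nrm_p + nrm_q) *s w + (- (tr_p - tr_q)) *s u w + u (u w)"
        by (simp add: N_def act_pCons u.add u.scale u.zero)
      thus ?thesis by (simp add: u lin aa bb algebra_simps)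
    qed
    have "F \<triangleright> v = N \<triangleright> N \<triangleright> v - (tr_p * tr_q) *s N \<triangleright> v + C *s v"
      unfolding F act_add P.scale_left_diff_distrib act_smult act_const act_mult ..
    moreover have "(nrm_p * (nrm_q * 4)) *s v = (nrm_p * nrm_q) *s v + ((nrm_p * nrm_q) *s v + ((nrm_p * nrm_q) *s v + (nrm_p * nrm_q) *s v))"
      by (simp add: scale_left_distrib[symmetric])
    ultimately show ?thesis
      unfolding N by (simp add: c_def C_def lin aa bb algebra_simps)
  qed
  ultimately show ?thesis by (auto simp: twisted_root_def)
qed

text \<open>This is t - \<tau>(t), so it changes sign under the substitution \<tau>.\<close>

definition \<kappa> :: "'a poly" where "\<kappa> = [:- (tr_p - tr_q), 2:]"

text \<open>For \<open>u = a - b\<close> one has \<open>c = u b - b u\<close>, and eliminating the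
  square of b from \<open>p(u + b) = 0\<close> by \<open>q(b) = 0\<close> gives
  \<open>u b + b u = \<delta> b + g(u)\<close>. The sum of both determines b where
  \<open>\<kappa>\<close> acts invertibly. What has to be verified is that this b, together with a =
  u + b, satisfies the two quadratic equations.\<close>

lemma pq_difference_of_twisted_root:
  assumes c: "twisted_root c" and w: "\<And>v. w \<triangleright> \<kappa> \<triangleright> v = v"
  shows "pq_difference scale p q u"
proof -
  interpret c: Vector_Spaces.linear scale scale c
    using c by (simp add: twisted_root_def)
  have c_u: "c (u v) = \<tau> \<triangleright> c v" and c_c: "c (c v) = F \<triangleright> v" for v
    using c by (auto simp: twisted_root_def)
  have c_act: "c (f \<triangleright> v) = (f \<circ>\<^sub>p \<tau>) \<triangleright> c v" for f v
    using c by (intro semilinear_act) (auto simp: twisted_root_def)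
  have inj: "v = 0" if "\<kappa> \<triangleright> v = 0" for v
    using w[of v] that P.scale_zero_right by metis
  \<comment> \<open>If \<open>c = [a, b]\<close> with \<open>u = a - b\<close>, then \<open>(2 u - (tr p - tr q)) b = g(u) + c\<close>.\<close>
  define g where "g = [:nrm_q - nrm_p, tr_p, - 1:]"
  define b where "b v = w \<triangleright> (g \<triangleright> v + c v)" for v
  define a where "a v = u v + b v" for v
  have \<kappa>_b: "\<kappa> \<triangleright> b v = g \<triangleright> v + c v" for v
    unfolding b_def using w[of "g \<triangleright> v + c v"] act_commute[of w \<kappa>] by metis
  have lin_b: "Vector_Spaces.linear scale scale b"
    by unfold_locales
      (simp_all only: b_def act_add_right act_scale c.add c.scale scale_right_distrib add_ac)
  interpret b: Vector_Spaces.linear scale scale b by (rule lin_b)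
  have lin_a: "Vector_Spaces.linear scale scale a"
    by unfold_locales (simp_all add: a_def u.add u.scale b.add b.scale algebra_simps)
  have \<kappa>_tau: "\<kappa> \<circ>\<^sub>p \<tau> = - \<kappa>"
    by (simp add: \<kappa>_def \<tau>_def pcompose_pCons)
  \<comment> \<open>In \<open>\<kappa>^2 q(b)\<close>, \<open>id1\<close> cancels the terms
    containing c and \<open>id2\<close> the others; the sign change of \<open>\<kappa>\<close>
    enters when c is moved past it.\<close>
  have id1: "g - g \<circ>\<^sub>p \<tau> - Polynomial.smult tr_q \<kappa> = 0"
    by (simp add: g_def \<kappa>_def \<tau>_def pcompose_pCons algebra_simps)
  have id2: "g * g - F - Polynomial.smult tr_q (\<kappa> * g) + Polynomial.smult nrm_q (\<kappa> * \<kappa>) = 0"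
    by (simp add: g_def \<kappa>_def F_eq quartic_of_coeffs_def algebra_simps)
  have id3: "[:nrm_p - nrm_q, - tr_p, 1:] + g = 0"
    by (simp add: g_def)
  have regroup: "x1 + x2 - x3 - x4 - s *s (x5 + x6) + n *s x7 =
      (x1 - x4 - s *s x5 + n *s x7) + (x2 - x3 - s *s x6)" for x1 x2 x3 x4 x5 x6 x7 :: 'v and s n
    by (simp add: scale_right_distrib)
  have bb: "b (b v) - tr_q *s b v + nrm_q *s v = 0" for v
  proof -
    have "\<kappa> \<triangleright> \<kappa> \<triangleright> b (b v) = g \<triangleright> \<kappa> \<triangleright> b v + \<kappa> \<triangleright> c (b v)"
      unfolding \<kappa>_b[of "b v"] act_add_right by (simp only: act_commute)
    also have "\<kappa> \<triangleright> c (b v) = - c (\<kappa> \<triangleright> b v)"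
      unfolding c_act \<kappa>_tau P.scale_minus_left by simp
    also have "c (\<kappa> \<triangleright> b v) = (g \<circ>\<^sub>p \<tau>) \<triangleright> c v + F \<triangleright> v"
      unfolding \<kappa>_b c.add c_act c_c ..
    finally have 1: "\<kappa> \<triangleright> \<kappa> \<triangleright> b (b v) =
        g \<triangleright> g \<triangleright> v + g \<triangleright> c v - (g \<circ>\<^sub>p \<tau>) \<triangleright> c v - F \<triangleright> v"
      unfolding \<kappa>_b act_add_right by (simp add: algebra_simps del: P.scale_scale)
    have 2: "\<kappa> \<triangleright> \<kappa> \<triangleright> b v = \<kappa> \<triangleright> g \<triangleright> v + \<kappa> \<triangleright> c v"
      unfolding \<kappa>_b act_add_right ..
    have "\<kappa> \<triangleright> \<kappa> \<triangleright> (b (b v) - tr_q *s b v + nrm_q *s v) =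
      (g * g - F - Polynomial.smult tr_q (\<kappa> * g) + Polynomial.smult nrm_q (\<kappa> * \<kappa>)) \<triangleright> v +
      (g - g \<circ>\<^sub>p \<tau> - Polynomial.smult tr_q \<kappa>) \<triangleright> c v"
      unfolding act_add_right P.scale_right_diff_distrib 1 2 act_add P.scale_left_diff_distrib act_smult
        act_mult act_scale
      by (rule regroup)
    also have "\<dots> = 0"
      by (simp only: id1 id2 act_0 add_0_left)
    finally show ?thesis by (rule inj[OF inj])
  qed
  \<comment> \<open>After multiplication by \<open>\<kappa>\<close> the terms containing c cancel,
    because \<open>u c + c u = \<delta> c\<close>; the rest vanishes by \<open>id3\<close>.\<close>
  have aa: "a (a v) - tr_p *s a v + nrm_p *s v = 0" for v
  proof -
    have bbv: "b (b v) = tr_q *s b v - nrm_q *s v"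
      using bb[of v] by (simp add: algebra_simps)
    have "a (a v) - tr_p *s a v + nrm_p *s v =
      [:nrm_p - nrm_q, - tr_p, 1:] \<triangleright> v + u (b v) + b (u v) - (tr_p - tr_q) *s b v"
      by (simp add: a_def u.add u.diff b.add bbv act_pCons u.scale u.zero algebra_simps)
    hence "\<kappa> \<triangleright> (a (a v) - tr_p *s a v + nrm_p *s v) = \<kappa> \<triangleright> [:nrm_p - nrm_q, - tr_p, 1:] \<triangleright> v
      + u (\<kappa> \<triangleright> b v) + \<kappa> \<triangleright> b (u v) - (tr_p - tr_q) *s \<kappa> \<triangleright> b v"
      by (simp only: act_add_right P.scale_right_diff_distrib act_scale act_u)
    also have "\<dots> = \<kappa> \<triangleright> [:nrm_p - nrm_q, - tr_p, 1:] \<triangleright> v + (u (g \<triangleright> v) + u (g \<triangleright> v) - (tr_p - tr_q) *s g \<triangleright> v)"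
      unfolding \<kappa>_b c_u tau_act act_u u.add scale_right_distrib by (simp add: algebra_simps del: P.scale_scale)
    also have "u (g \<triangleright> v) + u (g \<triangleright> v) - (tr_p - tr_q) *s g \<triangleright> v = \<kappa> \<triangleright> g \<triangleright> v"
    proof -
      have "\<kappa> \<triangleright> w = u w + u w - (tr_p - tr_q) *s w" for w
      proof -
        have "\<kappa> \<triangleright> w = (- (tr_p - tr_q)) *s w + u ((1 + 1) *s w)"
          by (simp add: \<kappa>_def act_pCons u.zero)
        thus ?thesis unfolding scale_left_distrib u.add by (simp add: algebra_simps)
      qed
      thus ?thesis by (simp only:)
    qed
    also have "\<kappa> \<triangleright> [:nrm_p - nrm_q, - tr_p, 1:] \<triangleright> v + \<kappa> \<triangleright> g \<triangleright> v = \<kappa> \<triangleright> ([:nrm_p - nrm_q, - tr_p, 1:] + g) \<triangleright> v"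
      unfolding act_add act_add_right ..
    also have "\<dots> = 0" unfolding id3 by simp
    finally show ?thesis by (rule inj)
  qed
  show ?thesis
    unfolding pq_difference_def
  proof (intro exI conjI)
    show "endo_poly scale p a = (\<lambda>v. 0)"
      by (subst p_eq) (simp add: endo_poly_quadratic aa fun_eq_iff)
    show "endo_poly scale q b = (\<lambda>v. 0)"
      by (subst q_eq) (simp add: endo_poly_quadratic bb fun_eq_iff)
  qed (use lin_a lin_b in \<open>auto simp: a_def\<close>)
qed

text \<open>The degree of \<open>\<kappa>\<close> is at most 1 and that of F is 4, so a nonzero
  \<open>\<kappa>\<close> is prime to F and acts invertibly when F(u) is nilpotent.\<close>

lemma pq_difference_iff_twisted_root:
  assumes "Factorial_Ring.irreducible F" "\<kappa> \<noteq> 0" "\<And>v. F ^ N \<triangleright> v = 0"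
  shows "pq_difference scale p q u \<longleftrightarrow> (\<exists>c. twisted_root c)"
proof
  assume "\<exists>c. twisted_root c"
  then obtain c where c: "twisted_root c" by blast
  have "Polynomial.degree \<kappa> < Polynomial.degree F"
    by (simp add: \<kappa>_def degree_F)
  hence "\<not> F dvd \<kappa>"
    using dvd_imp_degree_le[of F \<kappa>] assms(2) by linarith
  then obtain w b where wb: "w * \<kappa> + b * F ^ N = 1"
    using irreducible_poly_bezout_power[OF assms(1)] by blast
  have "w \<triangleright> \<kappa> \<triangleright> v = v" for v
  proof -
    have "v = (w * \<kappa> + b * F ^ N) \<triangleright> v" unfolding wb by simp
    also have "\<dots> = w \<triangleright> \<kappa> \<triangleright> v"
      unfolding act_add act_mult[of w] act_mult[of b] assms(3) by (simp del: P.scale_scale)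
    finally show ?thesis ..
  qed
  thus "pq_difference scale p q u"
    using pq_difference_of_twisted_root[OF c] by blast
qed (rule twisted_root_of_pq_difference)

end

section \<open>Decomposition under a twisted square root\<close>

lemma sum_lessThan_double:
  fixes f :: "nat \<Rightarrow> 'b::comm_monoid_add"
  shows "(\<Sum>i<2 * n. f i) = (\<Sum>i<n. f (2 * i) + f (2 * i + 1))"
  by (induction n) (simp_all add: add.assoc)

context endo
begin

text \<open>Generation is tested on subspaces, independence on polynomial coefficients reduced
  modulo the annihilators. The guard \<open>\<phi> i \<noteq> 0\<close> allows annihilators equal to
  1, for which no polynomial meets the degree bound.\<close>

lemma cyc_decompI:
  assumes monic: "\<And>i. i < length P \<Longrightarrow> monic (snd (P ! i))"
    and zero: "\<And>i. i < length P \<Longrightarrow> snd (P ! i) \<triangleright> fst (P ! i) = 0"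
    and gen: "\<And>S. subspace S \<Longrightarrow> (\<And>i f. i < length P \<Longrightarrow> f \<triangleright> fst (P ! i) \<in> S) \<Longrightarrow> S = UNIV"
    and indep: "\<And>\<phi> i. (\<And>i. i < length P \<Longrightarrow> \<phi> i \<noteq> 0 \<Longrightarrow> Polynomial.degree (\<phi> i) < Polynomial.degree (snd (P ! i))) \<Longrightarrow>
       (\<Sum>i<length P. \<phi> i \<triangleright> fst (P ! i)) = 0 \<Longrightarrow> i < length P \<Longrightarrow> \<phi> i = 0"
  shows "cyc_decomp P"
proof -
  define L where "L = length P"
  define d where "d i = Polynomial.degree (snd (P ! i))" for i
  define I where "I = Sigma {..<L} (\<lambda>i. {..<d i})"
  define b where "b = (\<lambda>(i, j). (u ^^ j) (fst (P ! i)))"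
  define xs where "xs = concat (map (\<lambda>i. map (Pair i) [0..<d i]) [0..<L])"
  have set_xs: "set xs = I"
    by (auto simp: xs_def I_def)
  have "distinct (concat (map (\<lambda>i. map (Pair i) [0..<d i]) [0..<n]))" for n
    by (induction n) (auto simp: distinct_map inj_on_def)
  hence distinct_xs: "distinct xs" by (simp add: xs_def)
  have fin: "finite I" by (simp add: I_def)
  have coeff_zero: "g x = 0" if g: "(\<Sum>x\<in>I. g x *s b x) = 0" and x: "x \<in> I" for g x
  proof -
    define \<phi> where "\<phi> i = (\<Sum>j<d i. monom (g (i, j)) j)" for i
    have coeff: "coeff (\<phi> i) j = (if j < d i then g (i, j) else 0)" for i j
      by (simp add: \<phi>_def coeff_sum)
    have deg: "Polynomial.degree (\<phi> i) < d i" if "\<phi> i \<noteq> 0" for i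
    proof (rule ccontr)
      assume "\<not> ?thesis"
      hence "coeff (\<phi> i) (Polynomial.degree (\<phi> i)) = 0" by (simp add: coeff)
      thus False using that by simp
    qed
    have "\<phi> i \<triangleright> e = (\<Sum>j<d i. g (i, j) *s (u ^^ j) e)" for i e
      unfolding \<phi>_def P.scale_sum_left act_monom ..
    hence "(\<Sum>i<L. \<phi> i \<triangleright> fst (P ! i)) = (\<Sum>i<L. \<Sum>j<d i. g (i, j) *s b (i, j))"
      by (simp add: b_def)
    also have "\<dots> = (\<Sum>x\<in>I. g x *s b x)"
      unfolding I_def by (subst sum.Sigma) (auto intro!: sum.cong)
    finally have "\<phi> i = 0" if "i < L" for i
      using indep[of \<phi> i] deg that g by (simp add: L_def d_def)
    moreover obtain i j where "x = (i, j)" "i < L" "j < d i"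
      using x by (auto simp: I_def)
    ultimately show ?thesis
      using coeff[of i j] by simp
  qed
  have inj: "inj_on b I"
    by (rule family_independent(1)[OF fin]) (rule coeff_zero)
  have ind: "independent (b ` I)"
    by (rule family_independent(2)[OF fin]) (rule coeff_zero)
  have bs: "concat (map (\<lambda>(e, r). cyc e (Polynomial.degree r)) P) = map b xs"
  proof -
    have "map (\<lambda>(e, r). cyc e (Polynomial.degree r)) P =
        map (\<lambda>i. map b (map (Pair i) [0..<d i])) [0..<L]"
      by (rule nth_equalityI) (auto simp: L_def d_def cyc_def b_def case_prod_unfold)
    thus ?thesis by (simp add: xs_def map_concat o_def)
  qed
  have "span (b ` I) = UNIV"
  proof (rule gen)
    show "subspace (span (b ` I))" by simp
    fix i f assume i: "i < length P"
    have "f \<triangleright> fst (P ! i) \<in> span (set (cyc (fst (P ! i)) (d i)))"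
      unfolding d_def by (rule act_mem_span_cyc) (use monic zero i in auto)
    also have "set (cyc (fst (P ! i)) (d i)) \<subseteq> b ` I"
      using i by (force simp: set_cyc b_def I_def L_def)
    hence "span (set (cyc (fst (P ! i)) (d i))) \<subseteq> span (b ` I)"
      by (rule span_mono)
    finally show "f \<triangleright> fst (P ! i) \<in> span (b ` I)" .
  qed
  moreover have "\<forall>(e, r)\<in>set P. r \<triangleright> e = 0"
    using zero by (force simp: in_set_conv_nth)
  ultimately show ?thesis
    using inj ind distinct_xs
    by (simp add: cyc_decomp_def basis_list_def bs set_xs distinct_map)
qed

end

locale endo_twisted = endo_pair scale Basis u p q
  for scale :: "'a::field \<Rightarrow> 'v::ab_group_add \<Rightarrow> 'v" (infixr \<open>*s\<close> 75) and Basis and u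
    and p q :: "'a poly" +
  fixes c :: "'v \<Rightarrow> 'v" and N :: nat
  assumes twisted_c: "twisted_root c"
    and irreducible_F: "Factorial_Ring.irreducible F"
    and nilpotent: "F ^ N \<triangleright> v = 0"
begin

sublocale c: Vector_Spaces.linear scale scale c
  using twisted_c by (simp add: twisted_root_def)

lemma c_u: "c (u v) = \<tau> \<triangleright> c v" and c_c: "c (c v) = F \<triangleright> v"
  using twisted_c by (auto simp: twisted_root_def)

lemma c_act: "c (f \<triangleright> v) = (f \<circ>\<^sub>p \<tau>) \<triangleright> c v"
  using twisted_c by (intro semilinear_act) (auto simp: twisted_root_def)

lemma c_even_power: "(c ^^ (2 * i)) v = F ^ i \<triangleright> v"
proof (induction i)
  case (Suc i)
  have "(c ^^ (2 * Suc i)) v = c (c ((c ^^ (2 * i)) v))" by simp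
  thus ?case unfolding Suc c_c by simp
qed simp

lemma c_odd_power: "(c ^^ (2 * i + 1)) v = F ^ i \<triangleright> c v"
  using c_even_power[of i "c v"] by (simp add: funpow_swap1)

lemma c_power_0: "(c ^^ i) 0 = 0"
  by (induction i) (simp_all add: c.zero)

lemma c_power_mono:
  assumes "(c ^^ i) v = 0" "i \<le> j"
  shows "(c ^^ j) v = 0"
proof -
  have "(c ^^ j) v = (c ^^ (j - i)) ((c ^^ i) v)"
    using assms(2) by (metis funpow_add le_add_diff_inverse2 o_apply)
  thus ?thesis using assms(1) c_power_0 by simp
qed

lemma c_power_sum: "(c ^^ i) (\<Sum>x\<in>I. h x) = (\<Sum>x\<in>I. (c ^^ i) (h x))"
  by (induction i) (simp_all add: c.sum)

text \<open>The submodules for the ring generated by u and c.\<close>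

definition invariant :: "'v set \<Rightarrow> bool" where
  "invariant S \<longleftrightarrow> subspace S \<and> (\<forall>v\<in>S. u v \<in> S) \<and> (\<forall>v\<in>S. c v \<in> S)"

lemma invariantD:
  assumes "invariant S"
  shows "subspace S" "v \<in> S \<Longrightarrow> f \<triangleright> v \<in> S" "v \<in> S \<Longrightarrow> (c ^^ i) v \<in> S"
proof -
  show S: "subspace S" using assms by (simp add: invariant_def)
  show "f \<triangleright> v \<in> S" if "v \<in> S"
    using that assms
    by (induction f)
      (auto simp: invariant_def act_pCons intro!: subspace_add[OF S] subspace_scale[OF S] subspace_0[OF S])
  show "(c ^^ i) v \<in> S" if "v \<in> S"
    using that assms by (induction i) (auto simp: invariant_def)
qed

text \<open>\<tau> is an involution fixing F, so the divisibility can be twisted back.\<close>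

lemma F_dvd_pcompose_tau:
  assumes "F dvd f \<circ>\<^sub>p \<tau>"
  shows "F dvd f"
proof -
  obtain g where "f \<circ>\<^sub>p \<tau> = F * g" using assms by (elim dvdE)
  hence "f \<circ>\<^sub>p \<tau> \<circ>\<^sub>p \<tau> = F * (g \<circ>\<^sub>p \<tau>)"
    by (simp add: pcompose_mult F_pcompose_tau)
  hence "f = F * (g \<circ>\<^sub>p \<tau>)"
    by (simp add: pcompose_assoc[symmetric] tau_pcompose_tau pcompose_idR)
  thus ?thesis by (rule dvdI)
qed

text \<open>With \<open>f\<^sup>\<tau> = f \<circ> \<tau>\<close>, the identity \<open>(f\<^sup>\<tau> - g c) (f + g c) = f f\<^sup>\<tau> - g g\<^sup>\<tau> F\<close> shows that
  \<open>f + g c\<close> is invertible on invariant subspaces.\<close>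

lemma invariant_cancel:
  assumes S: "invariant S" and f: "\<not> F dvd f" and mem: "f \<triangleright> e + g \<triangleright> c e \<in> S"
  shows "e \<in> S"
proof -
  define x where "x = f \<triangleright> e + g \<triangleright> c e"
  define h where "h = (f \<circ>\<^sub>p \<tau>) * f - g * (g \<circ>\<^sub>p \<tau>) * F"
  have "(f \<circ>\<^sub>p \<tau>) \<triangleright> x - g \<triangleright> c x = h \<triangleright> e"
    unfolding x_def h_def act_add_right c.add c_act c_c
    by (simp add: P.scale_left_diff_distrib algebra_simps)
  moreover have "c x \<in> S" using invariantD(3)[OF S, of x 1] mem by (simp add: x_def)
  ultimately have h: "h \<triangleright> e \<in> S"
    using invariantD[OF S] mem subspace_diff[OF invariantD(1)[OF S]] unfolding x_def by metis
  \<comment> \<open>Modulo F, h is f times its twist, and the prime F divides neither.\<close>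
  have "\<not> F dvd h"
  proof
    assume "F dvd h"
    hence "F dvd h + g * (g \<circ>\<^sub>p \<tau>) * F" by simp
    hence "F dvd (f \<circ>\<^sub>p \<tau>) * f" by (simp add: h_def)
    thus False
      using irreducible_poly_prime[OF irreducible_F] F_dvd_pcompose_tau f by blast
  qed
  then obtain a b where ab: "a * h + b * F ^ N = 1"
    using irreducible_poly_bezout_power[OF irreducible_F] by blast
  have "e = (a * h + b * F ^ N) \<triangleright> e" unfolding ab by simp
  also have "\<dots> = a \<triangleright> h \<triangleright> e"
    unfolding act_add act_mult[of a] act_mult[of b] nilpotent by (simp del: P.scale_scale)
  finally show ?thesis
    using invariantD(2)[OF S h, of a] by simp
qed

text \<open>Powers of F act as even powers of c, and powers of F followed by c as odd ones, so the
  lowest of them can be taken out on the left, leaving a coefficient f prime to F. The degree bounds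
  are the degrees of F to the powers \<open>(m + 1) div 2\<close> and \<open>m div 2\<close>; they
  force j < m.\<close>

lemma leading_power:
  fixes \<alpha> \<beta> :: "'a poly" and m :: nat
  assumes nz: "\<alpha> \<noteq> 0 \<or> \<beta> \<noteq> 0"
    and \<alpha>: "\<alpha> \<noteq> 0 \<Longrightarrow> Polynomial.degree \<alpha> < 4 * ((m + 1) div 2)"
    and \<beta>: "\<beta> \<noteq> 0 \<Longrightarrow> Polynomial.degree \<beta> < 4 * (m div 2)"
  shows "\<exists>j f g. j < m \<and> \<not> F dvd f \<and> (\<forall>v. \<alpha> \<triangleright> v + \<beta> \<triangleright> c v = (c ^^ j) (f \<triangleright> v + g \<triangleright> c v))"
proof -
  have F0: "F \<noteq> 0" using monic_F by auto
  have deg: "4 * a \<le> Polynomial.degree (F ^ a * f)" if "f \<noteq> 0" for a f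
    using that F0 by (simp add: degree_mult_eq degree_power_eq degree_F)
  obtain a \<alpha>' where a: "\<alpha> \<noteq> 0 \<Longrightarrow> \<alpha> = F ^ a * \<alpha>' \<and> \<not> F dvd \<alpha>'"
    using irreducible_power_decomp[OF irreducible_F] by metis
  obtain b \<beta>' where b: "\<beta> \<noteq> 0 \<Longrightarrow> \<beta> = F ^ b * \<beta>' \<and> \<not> F dvd \<beta>'"
    using irreducible_power_decomp[OF irreducible_F] by metis
  show ?thesis
  \<comment> \<open>The exponents to compare are \<open>2 * a\<close> and \<open>2 * b + 1\<close>,
    so a tie a = b goes to the even power.\<close>
  proof (cases "\<alpha> \<noteq> 0 \<and> (\<beta> = 0 \<or> a \<le> b)")
    case True
    define g where "g = (if \<beta> = 0 then 0 else F ^ (b - a) * \<beta>')"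
    have \<beta>_eq: "\<beta> = F ^ a * g"
      using True b by (auto simp: g_def mult.assoc[symmetric] power_add[symmetric])
    have \<alpha>_eq: "\<alpha> = F ^ a * \<alpha>'" "\<not> F dvd \<alpha>'" using a True by auto
    have "4 * a < 4 * ((m + 1) div 2)"
      using deg[of \<alpha>' a] \<alpha> \<alpha>_eq True by fastforce
    hence "2 * a < m" by simp
    moreover have "\<alpha> \<triangleright> v + \<beta> \<triangleright> c v = (c ^^ (2 * a)) (\<alpha>' \<triangleright> v + g \<triangleright> c v)" for v
      unfolding c_even_power \<alpha>_eq(1) \<beta>_eq act_add_right act_mult ..
    ultimately show ?thesis using \<alpha>_eq(2) by blast
  next
    case False
    hence \<beta>_nz: "\<beta> \<noteq> 0" using nz by blast
    \<comment> \<open>Taking c out on the left twists the coefficients, which the composition with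
      \<tau> compensates. The product of c, g and c is the twist of g times F, so one factor F of
      \<alpha> is used up; hence \<open>a - b - 1\<close>.\<close>
    define f where "f = \<beta>' \<circ>\<^sub>p \<tau>"
    define g where "g = (if \<alpha> = 0 then 0 else F ^ (a - b - 1) * \<alpha>') \<circ>\<^sub>p \<tau>"
    have tau2: "h \<circ>\<^sub>p \<tau> \<circ>\<^sub>p \<tau> = h" for h :: "'a poly"
      by (simp add: pcompose_assoc[symmetric] tau_pcompose_tau pcompose_idR)
    have \<beta>_eq: "\<beta> = F ^ b * \<beta>'" "\<not> F dvd \<beta>'" using b \<beta>_nz by auto
    have \<alpha>_eq: "\<alpha> = F ^ b * ((g \<circ>\<^sub>p \<tau>) * F)"
    proof (cases "\<alpha> = 0")
      case False
      hence "b < a" using \<open>\<not> (\<alpha> \<noteq> 0 \<and> (\<beta> = 0 \<or> a \<le> b))\<close> by simp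
      hence "F ^ a = F ^ b * F ^ (a - b - 1) * F"
        by (simp flip: power_add power_Suc2)
      thus ?thesis
        using a False by (simp add: g_def tau2 mult_ac)
    qed (simp add: g_def)
    have "\<not> F dvd f"
      using \<beta>_eq(2) F_dvd_pcompose_tau unfolding f_def by blast
    moreover have "4 * b < 4 * (m div 2)"
      using deg[of \<beta>' b] \<beta> \<beta>_eq \<beta>_nz by fastforce
    hence "b < m div 2" by simp
    hence "2 * b + 1 < m" by presburger
    moreover have "\<alpha> \<triangleright> v + \<beta> \<triangleright> c v = (c ^^ (2 * b + 1)) (f \<triangleright> v + g \<triangleright> c v)" for v
    proof -
      have "(c ^^ (2 * b + 1)) (f \<triangleright> v + g \<triangleright> c v) =
          F ^ b \<triangleright> \<beta>' \<triangleright> c v + F ^ b \<triangleright> (g \<circ>\<^sub>p \<tau>) \<triangleright> F \<triangleright> v"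
        unfolding c_odd_power c.add c_act c_c act_add_right f_def tau2 ..
      thus ?thesis
        unfolding \<alpha>_eq \<beta>_eq(1) by (simp add: mult.assoc add.commute)
    qed
    ultimately show ?thesis by blast
  qed
qed

definition generates :: "nat \<Rightarrow> (nat \<Rightarrow> 'v) \<Rightarrow> bool" where
  "generates K E \<longleftrightarrow> (\<forall>S. invariant S \<longrightarrow> (\<forall>l<K. E l \<in> S) \<longrightarrow> S = UNIV)"

definition admissible :: "nat \<Rightarrow> (nat \<Rightarrow> 'v) \<Rightarrow> (nat \<Rightarrow> nat) \<Rightarrow> bool" where
  "admissible K E m \<longleftrightarrow> generates K E \<and> (\<forall>l<K. (c ^^ m l) (E l) = 0)"

lemma exists_admissible: "\<exists>E. admissible (card Basis) E (\<lambda>_. 2 * N)"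
proof -
  obtain E where E: "bij_betw E {0..<card Basis} Basis"
    using ex_bij_betw_nat_finite[OF finite_Basis] by blast
  have "generates (card Basis) E"
    unfolding generates_def
  proof (intro allI impI)
    fix S assume S: "invariant S" "\<forall>l<card Basis. E l \<in> S"
    have "Basis = E ` {0..<card Basis}"
      using E by (simp add: bij_betw_def)
    also have "\<dots> \<subseteq> S"
      using S(2) by auto
    finally have "Basis \<subseteq> S" .
    hence "span Basis \<subseteq> S"
      using invariantD(1)[OF S(1)] by (rule span_minimal)
    thus "S = UNIV" using span_Basis by auto
  qed
  thus ?thesis
    using nilpotent by (auto simp: admissible_def c_even_power)
qed

text \<open>Dividing the relation by the lowest power \<open>c ^^ j l0\<close> that occurs leaves a
  vector e killed by this power. The coefficient of \<open>E l0\<close> in e is invertible, so e can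
  replace \<open>E l0\<close>, and the exponent drops from \<open>m l0\<close> to
  \<open>j l0\<close>.\<close>

lemma admissible_reduce:
  assumes adm: "admissible K E m"
    and rel: "(\<Sum>l<K. \<alpha> l \<triangleright> E l + \<beta> l \<triangleright> c (E l)) = 0"
    and \<alpha>: "\<And>l. l < K \<Longrightarrow> \<alpha> l \<noteq> 0 \<Longrightarrow> Polynomial.degree (\<alpha> l) < 4 * ((m l + 1) div 2)"
    and \<beta>: "\<And>l. l < K \<Longrightarrow> \<beta> l \<noteq> 0 \<Longrightarrow> Polynomial.degree (\<beta> l) < 4 * (m l div 2)"
    and nz: "l1 < K" "\<alpha> l1 \<noteq> 0 \<or> \<beta> l1 \<noteq> 0"
  shows "\<exists>E' m'. admissible K E' m' \<and> (\<Sum>l<K. m' l) < (\<Sum>l<K. m l)"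
proof -
  define L where "L = {l. l < K \<and> (\<alpha> l \<noteq> 0 \<or> \<beta> l \<noteq> 0)}"
  have "\<forall>l\<in>L. \<exists>j f g. j < m l \<and> \<not> F dvd f \<and>
      (\<forall>v. \<alpha> l \<triangleright> v + \<beta> l \<triangleright> c v = (c ^^ j) (f \<triangleright> v + g \<triangleright> c v))"
    using \<alpha> \<beta> by (intro ballI leading_power) (auto simp: L_def)
  then obtain j f g where jfg: "\<And>l. l \<in> L \<Longrightarrow> j l < m l" "\<And>l. l \<in> L \<Longrightarrow> \<not> F dvd f l"
      "\<And>l v. l \<in> L \<Longrightarrow> \<alpha> l \<triangleright> v + \<beta> l \<triangleright> c v = (c ^^ j l) (f l \<triangleright> v + g l \<triangleright> c v)"
    by metis
  have "l1 \<in> L" using nz by (simp add: L_def)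
  then obtain l0 where l0: "l0 \<in> L" and min: "\<And>l. l \<in> L \<Longrightarrow> j l0 \<le> j l"
    using ex_has_least_nat[of "\<lambda>l. l \<in> L" l1 j] by blast
  have "l0 < K" using l0 by (simp add: L_def)
  \<comment> \<open>The l-th term of the relation, divided by \<open>c ^^ j l0\<close>.\<close>
  define y where "y l = (if l \<in> L then (c ^^ (j l - j l0)) (f l \<triangleright> E l + g l \<triangleright> c (E l)) else 0)" for l
  have y: "\<alpha> l \<triangleright> E l + \<beta> l \<triangleright> c (E l) = (c ^^ j l0) (y l)" if "l < K" for l
  proof (cases "l \<in> L")
    case True
    have "c ^^ j l = c ^^ j l0 \<circ> c ^^ (j l - j l0)"
      using min[OF True] by (simp flip: funpow_add)
    thus ?thesis using jfg(3)[OF True] True by (simp add: y_def)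
  next
    case False
    hence "\<alpha> l = 0" "\<beta> l = 0" using that by (auto simp: L_def)
    thus ?thesis using False by (simp add: y_def c_power_0)
  qed
  define e where "e = (\<Sum>l<K. y l)"
  define E' where "E' = E(l0 := e)"
  define m' where "m' = m(l0 := j l0)"
  have e0: "(c ^^ j l0) e = 0"
    unfolding e_def c_power_sum rel[symmetric] using y by simp
  have "generates K E'"
    unfolding generates_def
  proof (intro allI impI)
    fix S assume S: "invariant S" and E': "\<forall>l<K. E' l \<in> S"
    note sub = invariantD(1)[OF S]
    have E_S: "E l \<in> S" if "l < K" "l \<noteq> l0" for l
      using E' that by (auto simp: E'_def)
    have "y l \<in> S" if "l < K" "l \<noteq> l0" for l
    proof (cases "l \<in> L")
      case True
      have "c (E l) \<in> S" using S E_S[OF that] by (simp add: invariant_def)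
      thus ?thesis
        using True E_S[OF that] invariantD[OF S] subspace_add[OF sub] by (simp add: y_def)
    next
      case False
      thus ?thesis using subspace_0[OF sub] by (simp add: y_def)
    qed
    hence "(\<Sum>l\<in>{..<K} - {l0}. y l) \<in> S"
      by (intro subspace_sum[OF sub]) auto
    moreover have "e \<in> S"
      using E' \<open>l0 < K\<close> by (auto simp: E'_def)
    moreover have "y l0 = e - (\<Sum>l\<in>{..<K} - {l0}. y l)"
      unfolding e_def using \<open>l0 < K\<close> by (subst sum.remove[of "{..<K}" l0]) auto
    ultimately have "y l0 \<in> S"
      using subspace_diff[OF sub] by simp
    \<comment> \<open>At l0 no power of c is left over, so \<open>y l0\<close> has the form to which
      cancellation applies.\<close>
    hence "f l0 \<triangleright> E l0 + g l0 \<triangleright> c (E l0) \<in> S"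
      using l0 by (simp add: y_def)
    hence "E l0 \<in> S"
      by (rule invariant_cancel[OF S jfg(2)[OF l0]])
    hence "\<forall>l<K. E l \<in> S" using E_S by blast
    thus "S = UNIV"
      using adm S by (auto simp: admissible_def generates_def)
  qed
  hence "admissible K E' m'"
    using adm e0 by (auto simp: admissible_def E'_def m'_def)
  moreover have "(\<Sum>l<K. m' l) < (\<Sum>l<K. m l)"
    using jfg(1)[OF l0] l0
    by (intro sum_strict_mono_ex1) (auto simp: m'_def L_def intro: less_imp_le)
  ultimately show ?thesis by blast
qed

lemma twisted_decomposition:
  obtains K n n' E where "\<And>l. n l = n' l \<or> n l = n' l + (1::nat)"
    "cyc_decomp (map (\<lambda>i. if even i then (E (i div 2), F ^ n (i div 2))
       else (c (E (i div 2)), F ^ n' (i div 2))) [0..<2 * K])"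
proof -
  define K where "K = card Basis"
  obtain E0 where E0: "admissible K E0 (\<lambda>_. 2 * N)"
    using exists_admissible by (auto simp: K_def)
  define Q where "Q = (\<lambda>(E, m). admissible K E m)"
  define \<mu> where "\<mu> = (\<lambda>(E :: nat \<Rightarrow> 'v, m). \<Sum>l<K. m l :: nat)"
  have "Q (E0, \<lambda>_. 2 * N)" using E0 by (simp add: Q_def)
  then obtain x where x: "Q x" "\<And>y. Q y \<Longrightarrow> \<mu> x \<le> \<mu> y"
    using ex_has_least_nat[of Q _ \<mu>] by blast
  obtain E m where Em: "x = (E, m)" by (cases x)
  have adm: "admissible K E m" using x(1) by (simp add: Q_def Em)
  have min: "(\<Sum>l<K. m l) \<le> (\<Sum>l<K. m' l)" if "admissible K E' m'" for E' m'
    using x(2)[of "(E', m')"] that by (simp add: Q_def \<mu>_def Em)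
  \<comment> \<open>The roundings are the least exponents with \<open>2 * n l \<ge> m l\<close> and
    \<open>2 * n' l + 1 \<ge> m l\<close>, so that \<open>F ^ n l\<close> kills \<open>E l\<close>
    and \<open>F ^ n' l\<close> kills \<open>c (E l)\<close>.\<close>
  define n n' where "n l = (m l + 1) div 2" and "n' l = m l div 2" for l
  define P where "P = map (\<lambda>i. if even i then (E (i div 2), F ^ n (i div 2))
       else (c (E (i div 2)), F ^ n' (i div 2))) [0..<2 * K]"
  have len: "length P = 2 * K" by (simp add: P_def)
  have P_even: "P ! (2 * l) = (E l, F ^ n l)" and P_odd: "P ! (2 * l + 1) = (c (E l), F ^ n' l)"
    if "l < K" for l using that by (simp_all add: P_def)
  have index: "\<exists>l<K. i = 2 * l \<or> i = 2 * l + 1" if "i < 2 * K" for i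
    using that by presburger
  have killed: "(c ^^ m l) (E l) = 0" if "l < K" for l
    using adm that by (simp add: admissible_def)
  have deg_pow: "Polynomial.degree (F ^ i) = 4 * i" for i
    using monic_F by (subst degree_power_eq) (auto simp: degree_F)
  have "cyc_decomp P"
  proof (rule cyc_decompI)
    fix i assume "i < length P"
    then obtain l where l: "l < K" "i = 2 * l \<or> i = 2 * l + 1"
      using index len by auto
    have "F ^ n l \<triangleright> E l = 0"
      unfolding c_even_power[symmetric]
      by (rule c_power_mono[OF killed[OF l(1)]]) (simp add: n_def)
    moreover have "F ^ n' l \<triangleright> c (E l) = 0"
      unfolding c_odd_power[symmetric]
      by (rule c_power_mono[OF killed[OF l(1)]]) (simp add: n'_def)
    ultimately show "snd (P ! i) \<triangleright> fst (P ! i) = 0"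
      using l(2) P_even[OF l(1)] P_odd[OF l(1)] by auto
    show "monic (snd (P ! i))"
      using l(2) P_even[OF l(1)] P_odd[OF l(1)] monic_power[OF monic_F] by auto
  next
    fix S assume S: "subspace S" and mem: "\<And>i f. i < length P \<Longrightarrow> f \<triangleright> fst (P ! i) \<in> S"
    define B where "B = E ` {..<K} \<union> (c \<circ> E) ` {..<K}"
    have B_S: "f \<triangleright> b \<in> S" if b: "b \<in> B" for f b
    proof -
      obtain l where "l < K" "b = E l \<or> b = c (E l)" using b by (auto simp: B_def)
      thus ?thesis
        using mem[of "2 * l" f] mem[of "2 * l + 1" f] P_even[of l] P_odd[of l] len by auto
    qed
    \<comment> \<open>The polynomial span of all \<open>E l\<close> and \<open>c (E l)\<close> is
      stable under c because c applied twice is F(u); as the family generates, this span is all of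
      V.\<close>
    have "invariant (P.span B)"
      unfolding invariant_def
    proof (intro conjI ballI)
      show "subspace (P.span B)"
      proof (rule subspaceI)
        show "a *s v \<in> P.span B" if "v \<in> P.span B" for a v
          using P.span_scale[OF that, of "[:a:]"] by simp
      qed (auto intro: P.span_zero P.span_add)
      show "u v \<in> P.span B" if "v \<in> P.span B" for v
        using P.span_scale[OF that, of "[:0, 1:]"] by simp
      show "c v \<in> P.span B" if "v \<in> P.span B" for v
        using that
      proof (induction rule: P.span_induct_alt)
        case base
        show ?case by (simp add: c.zero P.span_zero)
      next
        case (step f x y)
        have "c x \<in> P.span B"
        proof -
          obtain l where l: "l < K" "x = E l \<or> x = c (E l)" using step(1) by (auto simp: B_def)
          have "E l \<in> P.span B" "c (E l) \<in> P.span B"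
            using l(1) by (auto simp: B_def intro!: P.span_base)
          thus ?thesis using l(2) P.span_scale[of "E l" B F] by (auto simp: c_c)
        qed
        thus ?case
          using step(2) by (auto simp: c.add c_act intro: P.span_add P.span_scale)
      qed
    qed
    moreover have "\<forall>l<K. E l \<in> P.span B"
      by (auto simp: B_def intro!: P.span_base)
    ultimately have "P.span B = UNIV"
      using adm by (simp add: admissible_def generates_def)
    moreover have "P.span B \<subseteq> S"
    proof
      fix v assume "v \<in> P.span B"
      thus "v \<in> S"
      proof (induction rule: P.span_induct_alt)
        case base
        show ?case using subspace_0[OF S] .
      next
        case (step f x y)
        thus ?case using B_S subspace_add[OF S] by blast
      qed
    qed
    ultimately show "S = UNIV" by auto
  next
    fix \<phi> i
    assume deg: "\<And>i. i < length P \<Longrightarrow> \<phi> i \<noteq> 0 \<Longrightarrow>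
        Polynomial.degree (\<phi> i) < Polynomial.degree (snd (P ! i))"
      and rel: "(\<Sum>i<length P. \<phi> i \<triangleright> fst (P ! i)) = 0" and i: "i < length P"
    have "(\<Sum>i<length P. \<phi> i \<triangleright> fst (P ! i)) =
        (\<Sum>l<K. \<phi> (2 * l) \<triangleright> E l + \<phi> (2 * l + 1) \<triangleright> c (E l))"
      unfolding len sum_lessThan_double using P_even P_odd by (intro sum.cong) auto
    hence rel': "(\<Sum>l<K. \<phi> (2 * l) \<triangleright> E l + \<phi> (2 * l + 1) \<triangleright> c (E l)) = 0"
      using rel by simp
    have deg1: "Polynomial.degree (\<phi> (2 * l)) < 4 * ((m l + 1) div 2)" if "l < K" "\<phi> (2 * l) \<noteq> 0" for l
      using deg[of "2 * l"] that P_even[OF that(1)] len deg_pow by (simp add: n_def)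
    have deg2: "Polynomial.degree (\<phi> (2 * l + 1)) < 4 * (m l div 2)" if "l < K" "\<phi> (2 * l + 1) \<noteq> 0" for l
      using deg[of "2 * l + 1"] that P_odd[OF that(1)] len deg_pow by (simp add: n'_def)
    show "\<phi> i = 0"
    proof (rule ccontr)
      assume nz: "\<phi> i \<noteq> 0"
      obtain l where l: "l < K" "i = 2 * l \<or> i = 2 * l + 1"
        using index i len by auto
      hence nz': "\<phi> (2 * l) \<noteq> 0 \<or> \<phi> (2 * l + 1) \<noteq> 0" using nz by blast
      from admissible_reduce[OF adm rel' deg1 deg2 l(1) nz'] show False
        using min by (meson not_le)
    qed
  qed
  moreover have "n l = n' l \<or> n l = n' l + 1" for l
    unfolding n_def n'_def by presburger
  ultimately show ?thesis using that unfolding P_def by blast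
qed

end

section \<open>The equivalences\<close>

lemma diag_block_mat_concat: "diag_block_mat (map diag_block_mat Ass) = diag_block_mat (concat Ass)"
  by (induction Ass) (simp_all add: diag_block_mat_append Let_def)

text \<open>Serves to list a decomposition in a prescribed order of its annihilators.\<close>

lemma permute_to_match_map:
  assumes "mset (map f xs) = mset ys"
  shows "\<exists>xs'. mset xs' = mset xs \<and> map f xs' = ys"
  using assms
proof (induction ys arbitrary: xs)
  case (Cons y ys)
  have "y \<in> set (map f xs)"
    using mset_eq_setD[OF Cons.prems] by simp
  then obtain x where x: "x \<in> set xs" "f x = y" by auto
  then obtain us vs where xs: "xs = us @ x # vs" by (meson split_list)
  have "mset (map f (us @ vs)) = mset ys"
    using Cons.prems x(2) by (simp add: xs)
  from Cons.IH[OF this] obtain zs where "mset zs = mset (us @ vs)" "map f zs = ys" by blast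
  thus ?case
    using x(2) by (intro exI[of _ "x # zs"]) (simp add: xs)
qed simp

lemma map_concat_blocks:
  assumes "map c (concat (map f Q)) = concat (map g Q)" "\<And>x. x \<in> set Q \<Longrightarrow> length (f x) = length (g x)" "x \<in> set Q"
  shows "map c (f x) = g x"
  using assms by (induction Q) auto

text \<open>A gap of at least 2 after position \<open>2 * k\<close> leaves the value
  \<open>t = s ! (2 * k + 1) + 1\<close> unattained, while exactly the first
  \<open>2 * k + 1\<close> entries reach it, an odd number.\<close>

lemma sorted_pair_gap:
  fixes s :: "nat list"
  assumes sorted: "sorted_wrt (\<ge>) s" and even: "even (length s)"
    and parity: "\<And>t. t > 0 \<Longrightarrow> t \<notin> set s \<Longrightarrow> even (length (filter (\<lambda>x. t \<le> x) s))"
    and k: "2 * k < length s"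
  shows "s ! (2 * k) = s ! (2 * k + 1) \<or> s ! (2 * k) = s ! (2 * k + 1) + 1"
proof (rule ccontr)
  assume *: "\<not> ?thesis"
  have k': "2 * k + 1 < length s" using k even by presburger
  have dec: "s ! j \<le> s ! i" if "i \<le> j" "j < length s" for i j
    using sorted_wrt_nth_less[OF sorted, of i j] that by (cases "i = j") auto
  define t where "t = s ! (2 * k + 1) + 1"
  have t: "t < s ! (2 * k)"
    using * dec[of "2 * k" "2 * k + 1"] k' by (simp add: t_def)
  have high: "t < s ! i" if "i \<le> 2 * k" for i
    using dec[OF that k] t by simp
  have low: "s ! i < t" if "2 * k < i" "i < length s" for i
    using dec[of "2 * k + 1" i] that by (simp add: t_def)
  have "t \<notin> set s"
  proof
    assume "t \<in> set s"
    then obtain i where "i < length s" "s ! i = t" by (auto simp: in_set_conv_nth)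
    thus False using high[of i] low[of i] by (cases "i \<le> 2 * k") auto
  qed
  hence "even (length (filter (\<lambda>x. t \<le> x) s))"
    by (intro parity) (simp add: t_def)
  also have "length (filter (\<lambda>x. t \<le> x) s) = card {i. i < length s \<and> t \<le> s ! i}"
    by (rule length_filter_conv_card)
  also have "{i. i < length s \<and> t \<le> s ! i} = {..2 * k}"
  proof (intro equalityI subsetI)
    fix i assume "i \<in> {i. i < length s \<and> t \<le> s ! i}"
    thus "i \<in> {..2 * k}" using low[of i] by (auto intro: leI)
  next
    fix i assume "i \<in> {..2 * k}"
    thus "i \<in> {i. i < length s \<and> t \<le> s ! i}"
      using high[of i] k by auto
  qed
  finally show False by simp
qed

locale endo_distinct = endo_pair scale Basis u p q + distinct_quadratic_pair p q
  for scale :: "'a::field \<Rightarrow> 'v::ab_group_add \<Rightarrow> 'v" (infixr \<open>*s\<close> 75) and Basis and u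
    and p q :: "'a poly"
begin

section \<open>Pairs of cyclic blocks\<close>

definition blocks :: "(('v \<times> nat) \<times> ('v \<times> nat)) list \<Rightarrow> ('v \<times> 'a poly) list" where
  "blocks Q = concat (map (\<lambda>((e, n), (e', m)). [(e, F ^ n), (e', F ^ m)]) Q)"

text \<open>The common form with which the three conditions are compared. Zero exponents are
  allowed: a pair with n = m = 0 contributes nothing to the basis and serves as padding.\<close>

definition paired :: "(('v \<times> nat) \<times> ('v \<times> nat)) list \<Rightarrow> bool" where
  "paired Q \<longleftrightarrow> (\<forall>((e, n), (e', m))\<in>set Q. n = m \<or> n = m + 1) \<and> cyc_decomp (blocks Q)"

lemma blocks_simps [simp]:
  "blocks [] = []"
  "blocks (((e, n), (e', m)) # Q) = (e, F ^ n) # (e', F ^ m) # blocks Q"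
  by (simp_all add: blocks_def)

lemma degree_F_power: "Polynomial.degree (F ^ i) = 4 * i"
  using monic_F by (subst degree_power_eq) (auto simp: degree_F)

lemma monic_F_power: "monic (F ^ i)"
  using monic_F by (rule monic_power)

lemma F_power_inject: "F ^ i = F ^ j \<longleftrightarrow> i = j"
proof
  assume "F ^ i = F ^ j"
  hence "4 * i = 4 * j" unfolding degree_F_power[symmetric] by (rule arg_cong)
  thus "i = j" by simp
qed (rule arg_cong)

lemma F_power_pcompose_tau: "F ^ i \<circ>\<^sub>p \<tau> = F ^ i"
  by (induction i) (simp_all add: pcompose_mult F_pcompose_tau one_pCons)

lemma blocks_of_exponents:
  assumes "map snd P = concat (map (\<lambda>x. [F ^ n x, F ^ m x]) xs)"
  shows "\<exists>Q. P = blocks Q \<and> map (\<lambda>((e, i), (e', j)). (i, j)) Q = map (\<lambda>x. (n x, m x)) xs"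
  using assms
proof (induction xs arbitrary: P)
  case Nil
  thus ?case by (intro exI[of _ "[]"]) simp
next
  case (Cons x xs)
  then obtain e e' P' where P: "P = (e, F ^ n x) # (e', F ^ m x) # P'"
      "map snd P' = concat (map (\<lambda>x. [F ^ n x, F ^ m x]) xs)"
    by (auto simp: map_eq_Cons_conv)
  from Cons.IH[OF P(2)] obtain Q where
    "P' = blocks Q" "map (\<lambda>((e, i), (e', j)). (i, j)) Q = map (\<lambda>x. (n x, m x)) xs" by blast
  thus ?case
    using P(1) by (intro exI[of _ "((e, n x), (e', m x)) # Q"]) simp
qed

text \<open>The way into \<open>paired\<close> from block matrices, from invariant factors and from
  the twisted decomposition; each indexes its exponent pairs by a list xs of its own.\<close>

lemma paired_of_exponents:
  assumes "map snd P = concat (map (\<lambda>x. [F ^ n x, F ^ m x]) xs)" "cyc_decomp P"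
    "\<And>x. x \<in> set xs \<Longrightarrow> n x = m x \<or> n x = m x + 1"
  shows "\<exists>Q. paired Q"
proof -
  obtain Q where Q: "P = blocks Q" "map (\<lambda>((e, i), (e', j)). (i, j)) Q = map (\<lambda>x. (n x, m x)) xs"
    using blocks_of_exponents[OF assms(1)] by blast
  have "i = j \<or> i = j + 1" if "((e, i), (e', j)) \<in> set Q" for e i e' j
  proof -
    have "(i, j) \<in> set (map (\<lambda>((e, i), (e', j)). (i, j)) Q)"
      using that by force
    thus ?thesis using assms(3) unfolding Q(2) by auto
  qed
  hence "paired Q" using Q(1) assms(2) by (auto simp: paired_def)
  thus ?thesis ..
qed

lemma set_blocks:
  assumes "(e, r) \<in> set (blocks Q)"
  obtains n where "r = F ^ n" "n \<le> sum_list (map (\<lambda>((e, n), (e', m)). n + m) Q)"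
proof -
  obtain x y n m where mem: "((x, n), (y, m)) \<in> set Q" and r: "r = F ^ n \<or> r = F ^ m"
    using assms by (auto simp: blocks_def)
  have "n + m \<in> set (map (\<lambda>((e, n), (e', m)). n + m) Q)"
    using mem by force
  hence "n + m \<le> sum_list (map (\<lambda>((e, n), (e', m)). n + m) Q)"
    by (rule member_le_sum_list) simp
  thus ?thesis using r that[of n] that[of m] by linarith
qed

lemma paired_nilpotent:
  assumes "paired Q"
  obtains N where "\<And>v. F ^ N \<triangleright> v = 0"
proof -
  \<comment> \<open>Any common bound of the exponents would do; their sum is one.\<close>
  define N where "N = sum_list (map (\<lambda>((e :: 'v, n), (e' :: 'v, m)). n + m) Q)"
  have "F ^ N \<triangleright> v = 0" for v
  proof (rule cyc_decomp_annihilated)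
    show "cyc_decomp (blocks Q)" using assms by (simp add: paired_def)
    fix e r assume "(e, r) \<in> set (blocks Q)"
    then obtain n where "r = F ^ n" "n \<le> N"
      unfolding N_def by (rule set_blocks)
    thus "r dvd F ^ N" by (simp add: le_imp_power_dvd)
  qed
  thus ?thesis using that by blast
qed

text \<open>A \<tau>-semilinear map on the cyclic module of e is given by the image y of e, and it
  respects the annihilator r if the twist of r kills y. The values of c are known only on the basis;
  reduction modulo r extends the formula to every polynomial.\<close>

lemma semilinear_on_cyclic:
  assumes lin: "Vector_Spaces.linear scale scale c" and r: "monic r" "r \<triangleright> e = 0" "(r \<circ>\<^sub>p \<tau>) \<triangleright> y = 0"
    and c: "\<And>i. i < Polynomial.degree r \<Longrightarrow> c ((u ^^ i) e) = \<tau> ^ i \<triangleright> y"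
  shows "c (f \<triangleright> e) = (f \<circ>\<^sub>p \<tau>) \<triangleright> y"
proof -
  interpret c: Vector_Spaces.linear scale scale c by fact
  define g where "g = f mod r"
  have f: "f = f div r * r + g" by (simp add: g_def)
  have fe: "f \<triangleright> e = g \<triangleright> e"
    by (subst f) (simp only: act_add act_mult r(2) P.scale_zero_right add_0_left)
  have "(f \<circ>\<^sub>p \<tau>) \<triangleright> y = (((f div r) \<circ>\<^sub>p \<tau>) * (r \<circ>\<^sub>p \<tau>) + g \<circ>\<^sub>p \<tau>) \<triangleright> y"
    by (subst f) (simp only: pcompose_add pcompose_mult)
  also have "\<dots> = (g \<circ>\<^sub>p \<tau>) \<triangleright> y"
    by (simp only: act_add act_mult r(3) P.scale_zero_right add_0_left)
  also have "\<dots> = c (g \<triangleright> e)"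
  proof (cases "Polynomial.degree r = 0")
    case True
    hence "r = 1" using r(1) by (simp add: monic_degree_0)
    thus ?thesis by (simp add: g_def c.zero)
  next
    case False
    hence deg: "Polynomial.degree g < Polynomial.degree r"
      unfolding g_def by (rule degree_mod_less_degree)
    have "g \<circ>\<^sub>p \<tau> = (\<Sum>i\<le>Polynomial.degree g. Polynomial.smult (coeff g i) (\<tau> ^ i))"
      by (simp add: pcompose_altdef poly_altdef degree_map_poly coeff_map_poly)
    hence "(g \<circ>\<^sub>p \<tau>) \<triangleright> y = (\<Sum>i\<le>Polynomial.degree g. coeff g i *s (\<tau> ^ i \<triangleright> y))"
      by (simp only: P.scale_sum_left act_smult)
    also have "\<dots> = (\<Sum>i\<le>Polynomial.degree g. coeff g i *s c ((u ^^ i) e))"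
      using c deg by (intro sum.cong) auto
    also have "\<dots> = c (g \<triangleright> e)"
      by (simp add: endo_poly_def c.sum c.scale)
    finally show ?thesis .
  qed
  finally show ?thesis by (simp add: fe)
qed

text \<open>On each pair, c sends e to e' and e' to F e. This is compatible with the annihilators
  \<open>F ^ n\<close> of e and \<open>F ^ m\<close> of e' because \<open>m \<le> n\<close> and
  \<open>n \<le> m + 1\<close>.\<close>

lemma twisted_root_of_paired:
  assumes "paired Q"
  shows "\<exists>c. twisted_root c"
proof -
  have dec: "cyc_decomp (blocks Q)"
    and pair: "\<And>e n e' m. ((e, n), (e', m)) \<in> set Q \<Longrightarrow> n = m \<or> n = m + 1"
    using assms by (auto simp: paired_def)
  define f where "f = (\<lambda>((e, n), (e', m)). cyc e (4 * n) @ cyc e' (4 * m))"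
  define g where "g = (\<lambda>((e, n), (e', m)). map (\<lambda>i. \<tau> ^ i \<triangleright> e') [0..<4 * n] @
     map (\<lambda>i. \<tau> ^ i \<triangleright> F \<triangleright> e) [0..<4 * m])"
  have bs: "concat (map (\<lambda>(e, r). cyc e (Polynomial.degree r)) (blocks Q)) = concat (map f Q)"
    by (induction Q) (auto simp: f_def degree_F_power)
  have len: "length (f x) = length (g x)" for x
    by (simp add: f_def g_def case_prod_unfold)
  have "distinct (concat (map f Q))" "independent (set (concat (map f Q)))"
    using dec by (auto simp: cyc_decomp_def bs basis_list_def)
  moreover have "length (concat (map g Q)) = length (concat (map f Q))"
    by (simp add: length_concat len o_def)
  ultimately obtain c where lin: "Vector_Spaces.linear scale scale c"
      and c: "map c (concat (map f Q)) = concat (map g Q)"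
    by (rule linear_map_basis_list)
  interpret c: Vector_Spaces.linear scale scale c by fact
  have tau2: "h \<circ>\<^sub>p \<tau> \<circ>\<^sub>p \<tau> = h" for h :: "'a poly"
    by (simp add: pcompose_assoc[symmetric] tau_pcompose_tau pcompose_idR)
  have tau_X: "([:0, 1:] * h) \<circ>\<^sub>p \<tau> = \<tau> * (h \<circ>\<^sub>p \<tau>)" for h :: "'a poly"
    by (simp add: pcompose_pCons)
  have act_uX: "u (h \<triangleright> v) = ([:0, 1:] * h) \<triangleright> v" for h v
    by (simp only: act_mult act_X)
  have "v \<in> {v. c (u v) = \<tau> \<triangleright> c v \<and> c (c v) = F \<triangleright> v}" for v
  proof (rule cyc_decomp_induct[OF dec])
    show "subspace {v. c (u v) = \<tau> \<triangleright> c v \<and> c (c v) = F \<triangleright> v}"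
      by (rule subspaceI)
        (auto simp: u.zero u.add u.scale c.zero c.add c.scale act_add_right act_scale)
    fix e0 r h assume "(e0, r) \<in> set (blocks Q)"
    then obtain e n e' m where mem: "((e, n), (e', m)) \<in> set Q"
        and e0: "e0 = e \<or> e0 = e'"
      by (fastforce simp: blocks_def)
    have "map c (f ((e, n), (e', m))) = g ((e, n), (e', m))"
      by (rule map_concat_blocks[OF c len mem])
    hence map_c: "map c (cyc e (4 * n)) = map (\<lambda>i. \<tau> ^ i \<triangleright> e') [0..<4 * n]"
        "map c (cyc e' (4 * m)) = map (\<lambda>i. \<tau> ^ i \<triangleright> F \<triangleright> e) [0..<4 * m]"
      by (auto simp: f_def g_def)
    have c1: "c ((u ^^ i) e) = \<tau> ^ i \<triangleright> e'" if "i < 4 * n" for i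
      using map_c(1) that by (simp add: cyc_def)
    have c2: "c ((u ^^ i) e') = \<tau> ^ i \<triangleright> F \<triangleright> e" if "i < 4 * m" for i
      using map_c(2) that by (simp add: cyc_def del: P.scale_scale)
    have in_blocks: "(e, F ^ n) \<in> set (blocks Q)" "(e', F ^ m) \<in> set (blocks Q)"
      using mem by (force simp: blocks_def)+
    note zero = cyc_decomp_cyc(1)[OF dec in_blocks(1)] cyc_decomp_cyc(1)[OF dec in_blocks(2)]
    have zero': "F ^ n \<triangleright> e' = 0" "F ^ m \<triangleright> F \<triangleright> e = 0"
    proof -
      have "F ^ m dvd F ^ n" "F ^ n dvd F ^ m * F"
        using pair[OF mem] by (auto simp: le_imp_power_dvd)
      thus "F ^ n \<triangleright> e' = 0" "F ^ m \<triangleright> F \<triangleright> e = 0"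
        using zero act_dvd_eq_0 unfolding act_mult[symmetric] by blast+
    qed
    have ce: "c (h \<triangleright> e) = (h \<circ>\<^sub>p \<tau>) \<triangleright> e'" for h
      by (rule semilinear_on_cyclic[OF lin monic_F_power zero(1)])
        (simp_all add: F_power_pcompose_tau zero' degree_F_power c1)
    have ce': "c (h \<triangleright> e') = (h \<circ>\<^sub>p \<tau>) \<triangleright> F \<triangleright> e" for h
      by (rule semilinear_on_cyclic[OF lin monic_F_power zero(2)])
        (simp_all add: F_power_pcompose_tau zero' degree_F_power c2 del: P.scale_scale)
    have "c (u (h \<triangleright> e)) = \<tau> \<triangleright> c (h \<triangleright> e)" "c (u (h \<triangleright> e')) = \<tau> \<triangleright> c (h \<triangleright> e')"
      unfolding act_uX ce ce' tau_X by (rule act_mult)+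
    moreover have "c (c (h \<triangleright> e)) = F \<triangleright> h \<triangleright> e" "c (c (h \<triangleright> e')) = F \<triangleright> h \<triangleright> e'"
    proof -
      show "c (c (h \<triangleright> e)) = F \<triangleright> h \<triangleright> e"
        unfolding ce ce' tau2 by (rule act_commute)
      have "c (c (h \<triangleright> e')) = c (((h \<circ>\<^sub>p \<tau>) * F) \<triangleright> e)"
        unfolding ce' act_mult ..
      also have "\<dots> = F \<triangleright> h \<triangleright> e'"
        unfolding ce pcompose_mult tau2 F_pcompose_tau by (simp add: mult.commute)
      finally show "c (c (h \<triangleright> e')) = F \<triangleright> h \<triangleright> e'" .
    qed
    ultimately show "h \<triangleright> e0 \<in> {v. c (u v) = \<tau> \<triangleright> c v \<and> c (c v) = F \<triangleright> v}"
      using e0 by auto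
  qed
  thus ?thesis using lin by (auto simp: twisted_root_def)
qed

lemma paired_of_twisted_root:
  assumes "twisted_root c" "\<And>v. F ^ N \<triangleright> v = 0"
  shows "\<exists>Q. paired Q"
proof -
  interpret endo_twisted scale Basis u p q c N
    by unfold_locales (use assms irreducible_F in auto)
  show ?thesis
  proof (rule twisted_decomposition)
    fix K n n' E
    assume *: "\<And>l. n l = n' l \<or> n l = n' l + (1::nat)"
      "cyc_decomp (map (\<lambda>i. if even i then (E (i div 2), F ^ n (i div 2))
         else (c (E (i div 2)), F ^ n' (i div 2))) [0..<2 * K])"
    have "map snd (map (\<lambda>i. if even i then (E (i div 2), F ^ n (i div 2))
         else (c (E (i div 2)), F ^ n' (i div 2))) [0..<2 * K]) =
       concat (map (\<lambda>l. [F ^ n l, F ^ n' l]) [0..<K])"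
      by (induction K) auto
    from paired_of_exponents[OF this *(2)] show ?thesis using *(1) by blast
  qed
qed

lemma difference_iff_paired:
  "pq_difference scale p q u \<and> d_exceptional scale p q u \<longleftrightarrow> (\<exists>Q. paired Q)"
proof -
  have exc: "d_exceptional scale p q u \<longleftrightarrow> (\<exists>N. \<forall>v. F ^ N \<triangleright> v = 0)"
    unfolding d_exceptional_def Root_F[symmetric] by (rule eigenvalues_in_Root_iff[OF irreducible_F])
  have \<kappa>: "\<kappa> \<noteq> 0" using kappa_nonzero by (simp add: \<kappa>_def)
  show ?thesis
  proof
    assume L: "pq_difference scale p q u \<and> d_exceptional scale p q u"
    then obtain N where N: "\<And>v. F ^ N \<triangleright> v = 0" using exc by blast
    obtain c where "twisted_root c"
      using L twisted_root_of_pq_difference by blast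
    from paired_of_twisted_root[OF this N] show "\<exists>Q. paired Q" .
  next
    assume "\<exists>Q. paired Q"
    then obtain Q where Q: "paired Q" by blast
    obtain N where N: "\<And>v. F ^ N \<triangleright> v = 0" using paired_nilpotent[OF Q] by blast
    show "pq_difference scale p q u \<and> d_exceptional scale p q u"
      using exc N twisted_root_of_paired[OF Q]
        pq_difference_iff_twisted_root[OF irreducible_F \<kappa> N] by blast
  qed
qed

text \<open>A pair with n = 0 also has m = 0, so its lists are empty; dropping it provides the
  positive exponents demanded of the diagonal blocks.\<close>

lemma paired_positive:
  assumes "paired Q"
  shows "paired (filter (\<lambda>((e, n), _). n > 0) Q)"
proof -
  have "concat (map (\<lambda>(e, r). cyc e (Polynomial.degree r)) (blocks (filter (\<lambda>((e, n), _). n > 0) Q))) =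
      concat (map (\<lambda>(e, r). cyc e (Polynomial.degree r)) (blocks Q)) \<and>
      set (blocks (filter (\<lambda>((e, n), _). n > 0) Q)) \<subseteq> set (blocks Q)"
    using assms[unfolded paired_def, THEN conjunct1]
    by (induction Q) (auto simp: degree_F_power)
  thus ?thesis using assms by (auto simp: paired_def cyc_decomp_def)
qed

lemma block_representation_iff_paired:
  "(\<exists>Bs. represented_by scale u (diag_block_mat Bs) \<and>
      (\<forall>B\<in>set Bs. \<exists>n>0.
         B = diag_block_mat [companion_mat (F ^ n), companion_mat (F ^ n)] \<or>
         B = diag_block_mat [companion_mat (F ^ n), companion_mat (F ^ (n - 1))]))
    \<longleftrightarrow> (\<exists>Q. paired Q)" (is "?L \<longleftrightarrow> _")
proof
  assume ?L
  then obtain Bs where Bs: "represented_by scale u (diag_block_mat Bs)"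
    "\<forall>B\<in>set Bs. \<exists>n>0. B = diag_block_mat [companion_mat (F ^ n), companion_mat (F ^ n)] \<or>
         B = diag_block_mat [companion_mat (F ^ n), companion_mat (F ^ (n - 1))]" by blast
  have "\<forall>B\<in>set Bs. \<exists>n m. (n = m \<or> n = m + 1) \<and>
      B = diag_block_mat [companion_mat (F ^ n), companion_mat (F ^ m)]"
  proof
    fix B assume "B \<in> set Bs"
    then obtain n where "n > 0" "B = diag_block_mat [companion_mat (F ^ n), companion_mat (F ^ n)] \<or>
         B = diag_block_mat [companion_mat (F ^ n), companion_mat (F ^ (n - 1))]" using Bs(2) by blast
    moreover have "n = (n - 1) + 1" using \<open>n > 0\<close> by simp
    ultimately show "\<exists>n m. (n = m \<or> n = m + 1) \<and>
        B = diag_block_mat [companion_mat (F ^ n), companion_mat (F ^ m)]" by metis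
  qed
  then obtain n m where nm: "\<And>B. B \<in> set Bs \<Longrightarrow> n B = m B \<or> n B = m B + (1::nat)"
      "\<And>B. B \<in> set Bs \<Longrightarrow> B = diag_block_mat [companion_mat (F ^ n B), companion_mat (F ^ m B)]"
    by metis
  \<comment> \<open>Nested block-diagonal sums flatten, so the pairs of companion blocks become a
    single list of them.\<close>
  define rs where "rs = concat (map (\<lambda>B. [F ^ n B, F ^ m B]) Bs)"
  have "map (\<lambda>B. diag_block_mat [companion_mat (F ^ n B), companion_mat (F ^ m B)]) Bs = Bs"
    by (rule map_idI) (rule nm(2)[symmetric])
  hence "Bs = map diag_block_mat (map (\<lambda>B. [companion_mat (F ^ n B), companion_mat (F ^ m B)]) Bs)"
    unfolding map_map o_def by (rule sym)
  hence "diag_block_mat Bs = diag_block_mat (map diag_block_mat (map (\<lambda>B. [companion_mat (F ^ n B), companion_mat (F ^ m B)]) Bs))"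
    by (rule arg_cong)
  also have "\<dots> = diag_block_mat (concat (map (\<lambda>B. [companion_mat (F ^ n B), companion_mat (F ^ m B)]) Bs))"
    by (rule diag_block_mat_concat)
  also have "concat (map (\<lambda>B. [companion_mat (F ^ n B), companion_mat (F ^ m B)]) Bs) = map companion_mat rs"
    by (simp add: rs_def map_concat o_def)
  finally have "represented_by scale u (diag_block_mat (map companion_mat rs))"
    using Bs(1) by simp
  moreover have "\<forall>r\<in>set rs. monic r"
    by (auto simp: rs_def monic_F_power)
  ultimately obtain P where "map snd P = rs" "cyc_decomp P"
    using represented_by_companions[of rs] by auto
  thus "\<exists>Q. paired Q"
    unfolding rs_def using paired_of_exponents nm(1) by blast
next
  assume "\<exists>Q. paired Q"
  then obtain Q0 where "paired Q0" by blast
  define Q where "Q = filter (\<lambda>((e :: 'v, n), _). n > 0) Q0"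
  have Q: "paired Q" using paired_positive[OF \<open>paired Q0\<close>] by (simp add: Q_def)
  define Bs where "Bs = map (\<lambda>((e :: 'v, n), (e' :: 'v, m)). diag_block_mat [companion_mat (F ^ n), companion_mat (F ^ m)]) Q"
  have "Bs = map diag_block_mat (map (\<lambda>((e, n), (e', m)). [companion_mat (F ^ n), companion_mat (F ^ m)]) Q)"
    by (simp add: Bs_def o_def case_prod_unfold del: diag_block_mat.simps)
  hence "diag_block_mat Bs = diag_block_mat (concat (map (\<lambda>((e, n), (e', m)). [companion_mat (F ^ n), companion_mat (F ^ m)]) Q))"
    by (simp only: diag_block_mat_concat)
  also have "concat (map (\<lambda>((e, n), (e', m)). [companion_mat (F ^ n), companion_mat (F ^ m)]) Q) =
      map companion_mat (map snd (blocks Q))"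
    by (induction Q) auto
  finally have "diag_block_mat Bs = diag_block_mat (map companion_mat (map snd (blocks Q)))" .
  moreover have monic: "\<forall>r\<in>set (map snd (blocks Q)). monic r"
    by (auto simp: blocks_def monic_F_power)
  have "represented_by scale u (diag_block_mat (map companion_mat (map snd (blocks Q))))"
    unfolding represented_by_companions[OF monic] using Q by (auto simp: paired_def)
  ultimately have "represented_by scale u (diag_block_mat Bs)"
    by (simp only:)
  moreover have "\<exists>n>0. B = diag_block_mat [companion_mat (F ^ n), companion_mat (F ^ n)] \<or>
         B = diag_block_mat [companion_mat (F ^ n), companion_mat (F ^ (n - 1))]" if "B \<in> set Bs" for B
  proof -
    obtain e n e' m where mem: "((e, n), (e', m)) \<in> set Q"
        and B: "B = diag_block_mat [companion_mat (F ^ n), companion_mat (F ^ m)]"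
      using \<open>B \<in> set Bs\<close> unfolding Bs_def by (auto simp del: diag_block_mat.simps)
    have "n > 0" using mem by (auto simp: Q_def)
    moreover have "m = n \<or> m = n - 1" using Q mem by (fastforce simp: paired_def)
    ultimately show ?thesis using B by blast
  qed
  ultimately show ?L by blast
qed

text \<open>The bound t separates a pair only if m < t and t \<le> n; with n = m + 1 this means n =
  t, which is excluded. So each pair counts 0 or 2.\<close>

lemma exponent_parity:
  fixes Q :: "(('v \<times> nat) \<times> ('v \<times> nat)) list"
  assumes "\<forall>((e, n), (e', m))\<in>set Q. n = m \<or> n = m + 1"
    "t \<notin> set (concat (map (\<lambda>((e, n), (e', m)). [n, m]) Q))"
  shows "even (length (filter (\<lambda>x. t \<le> x) (concat (map (\<lambda>((e, n), (e', m)). [n, m]) Q))))"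
  using assms by (induction Q) auto

lemma min_poly_power_of_annihilated:
  assumes "\<And>v. F ^ N \<triangleright> v = 0"
  shows "\<exists>m. endo_min_poly scale u = F ^ m"
  using monic_dvd_irreducible_power[OF irreducible_F monic_F endo_min_poly(1) endo_min_poly(3)[OF assms]]
  by blast

lemma invariant_factors_iff_paired:
  "(\<exists>m. endo_min_poly scale u = F ^ m) \<and>
     (\<exists>r. invariant_factors scale u r \<and>
        (\<forall>k. r (2 * k) = r (2 * k + 1) \<or> r (2 * k) = r (2 * k + 1) * F))
    \<longleftrightarrow> (\<exists>Q. paired Q)" (is "?L \<longleftrightarrow> _")
proof
  assume ?L
  then obtain m r where m: "endo_min_poly scale u = F ^ m" and r: "invariant_factors scale u r"
    and pairs: "\<And>k. r (2 * k) = r (2 * k + 1) \<or> r (2 * k) = r (2 * k + 1) * F" by blast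
  obtain N where monic: "\<And>i. monic (r i)" and N: "\<And>i. i \<ge> N \<Longrightarrow> r i = 1"
    and rep: "represented_by scale u (diag_block_mat (map companion_mat (map r [0..<N])))"
    using r by (auto simp: invariant_factors_def o_def)
  obtain P where P: "map snd P = map r [0..<N]" "cyc_decomp P"
    using rep monic represented_by_companions[of "map r [0..<N]"] by auto
  \<comment> \<open>For i < N, \<open>r i\<close> is the exact annihilator of a generator and so
    divides the minimal polynomial \<open>F ^ m\<close>.\<close>
  have power: "\<exists>k. r i = F ^ k" for i
  proof (cases "i < N")
    case True
    have "snd (P ! i) = r i" "i < length P"
      using P(1) True by (auto simp: list_eq_iff_nth_eq)
    hence "(fst (P ! i), r i) \<in> set P" by (metis nth_mem prod.collapse)
    moreover have "F ^ m \<triangleright> fst (P ! i) = 0"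
      using endo_min_poly(2) unfolding m .
    ultimately have "r i dvd F ^ m"
      using cyc_decomp_dvd[OF P(2)] monic by blast
    thus ?thesis
      using monic_dvd_irreducible_power[OF irreducible_F monic_F monic] by blast
  next
    case False
    thus ?thesis using N[of i] by (intro exI[of _ 0]) simp
  qed
  then obtain k where k: "\<And>i. r i = F ^ k i" by metis
  \<comment> \<open>Since N may be odd, the list is padded to \<open>2 * N\<close> entries, which
    form the N pairs at positions \<open>2 * j\<close> and \<open>2 * j + 1\<close>.\<close>
  define P' where "P' = P @ map (\<lambda>_. (0, 1)) [N..<2 * N]"
  have concat_Nil: "concat (map (\<lambda>_. []) xs) = ([] :: 'v list)" for xs :: "nat list"
    by (induction xs) auto
  have "cyc_decomp P'"
    using P(2) by (auto simp: cyc_decomp_def P'_def o_def concat_Nil)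
  moreover have "map snd P' = map r [0..<2 * N]"
  proof -
    have "map snd P' = map r [0..<N] @ map r [N..<2 * N]"
      using P(1) N by (simp add: P'_def)
    also have "\<dots> = map r ([0..<N] @ [N..<2 * N])" by simp
    also have "[0..<N] @ [N..<2 * N] = [0..<2 * N]"
      using upt_add_eq_append[of 0 N N] by (simp add: mult_2)
    finally show ?thesis .
  qed
  moreover have "map r [0..<2 * N] = concat (map (\<lambda>j. [F ^ k (2 * j), F ^ k (2 * j + 1)]) [0..<N])"
    by (induction N) (auto simp: k)
  moreover have "k (2 * j) = k (2 * j + 1) \<or> k (2 * j) = k (2 * j + 1) + 1" for j
  proof -
    have "F ^ k (2 * j) = F ^ k (2 * j + 1) \<or> F ^ k (2 * j) = F ^ (k (2 * j + 1) + 1)"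
      using pairs[of j] unfolding k by (simp add: mult.commute)
    thus ?thesis unfolding F_power_inject .
  qed
  ultimately show "\<exists>Q. paired Q"
    using paired_of_exponents[of P' "\<lambda>j. k (2 * j)" "\<lambda>j. k (2 * j + 1)" "[0..<N]"] by simp
next
  assume "\<exists>Q. paired Q"
  then obtain Q where Q: "paired Q" by blast
  obtain N where N: "\<And>v. F ^ N \<triangleright> v = 0" using paired_nilpotent[OF Q] by blast
  have pair: "\<forall>((e, n), (e', m))\<in>set Q. n = m \<or> n = m + 1" and dec: "cyc_decomp (blocks Q)"
    using Q by (auto simp: paired_def)
  define es where "es = concat (map (\<lambda>((e :: 'v, n), (e' :: 'v, m)). [n, m]) Q)"
  \<comment> \<open>Sorting may separate the two exponents of a pair; the gaps at neighbouring
    positions are controlled by parity alone.\<close>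
  define s where "s = rev (sort es)"
  have mset_s: "mset s = mset es" by (simp add: s_def)
  have len: "length s = 2 * length Q"
  proof -
    have "length es = 2 * length Q"
      unfolding es_def by (induction Q) auto
    thus ?thesis by (simp add: s_def)
  qed
  have sorted: "sorted_wrt (\<ge>) s"
    by (simp add: s_def sorted_wrt_rev)
  have snd_blocks: "map snd (blocks Q) = map ((^) F) es"
    unfolding es_def by (induction Q) auto
  have "mset (map snd (blocks Q)) = mset (map ((^) F) s)"
    unfolding snd_blocks by (simp add: mset_s)
  then obtain P where P: "mset P = mset (blocks Q)" "map snd P = map ((^) F) s"
    using permute_to_match_map by blast
  have decP: "cyc_decomp P"
    by (rule cyc_decomp_mset[OF _ dec]) (simp add: P(1))
  define r where "r i = (if i < length s then F ^ (s ! i) else 1)" for i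
  have dec_s: "s ! Suc i \<le> s ! i" if "Suc i < length s" for i
    using sorted_wrt_nth_less[OF sorted, of i "Suc i"] that by simp
  have "invariant_factors scale u r"
    unfolding invariant_factors_def
  proof (intro conjI allI exI[of _ "length s"] impI)
    fix i show "monic (r i)" by (simp add: r_def monic_F_power)
    show "r (Suc i) dvd r i"
      using dec_s[of i] by (auto simp: r_def le_imp_power_dvd)
  next
    fix i assume "length s \<le> i"
    thus "r i = 1" by (simp add: r_def)
  next
    have "map r [0..<length s] = map ((^) F) s"
      by (rule nth_equalityI) (simp_all add: r_def)
    moreover have "map (\<lambda>i. companion_mat (r i)) [0..<length s] = map companion_mat (map r [0..<length s])"
      by simp
    ultimately have "map (\<lambda>i. companion_mat (r i)) [0..<length s] = map companion_mat (map ((^) F) s)"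
      by (simp only:)
    moreover have monic: "\<forall>r\<in>set (map ((^) F) s). monic r"
      by (auto simp: monic_F_power)
    have "represented_by scale u (diag_block_mat (map companion_mat (map ((^) F) s)))"
      unfolding represented_by_companions[OF monic] using P(2) decP by blast
    ultimately show "represented_by scale u (diag_block_mat (map (\<lambda>i. companion_mat (r i)) [0..<length s]))"
      by simp
  qed
  moreover have "r (2 * k) = r (2 * k + 1) \<or> r (2 * k) = r (2 * k + 1) * F" for k
  proof (cases "2 * k < length s")
    case True
    hence "2 * k + 1 < length s" using len by simp
    moreover have "s ! (2 * k) = s ! (2 * k + 1) \<or> s ! (2 * k) = s ! (2 * k + 1) + 1"
    proof (rule sorted_pair_gap[OF sorted _ _ True])
      show "even (length s)" by (simp add: len)
      fix t assume "t \<notin> set s"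
      hence "t \<notin> set es" using mset_eq_setD[OF mset_s] by simp
      hence "even (length (filter (\<lambda>x. t \<le> x) es))"
        using exponent_parity[OF pair] by (simp add: es_def)
      moreover have "mset (filter (\<lambda>x. t \<le> x) s) = mset (filter (\<lambda>x. t \<le> x) es)"
        by (simp add: mset_s)
      hence "length (filter (\<lambda>x. t \<le> x) s) = length (filter (\<lambda>x. t \<le> x) es)"
        by (rule mset_eq_length)
      ultimately show "even (length (filter (\<lambda>x. t \<le> x) s))" by simp
    qed
    ultimately show ?thesis using True by (auto simp: r_def mult.commute)
  next
    case False
    thus ?thesis by (simp add: r_def)
  qed
  ultimately show ?L
    using min_poly_power_of_annihilated[OF N] by blast
qed

end

theorem theorem3p27:
  fixes scale :: "'a::field \<Rightarrow> 'v::ab_group_add \<Rightarrow> 'v"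
    and Basis :: "'v set"
    and p q :: "'a poly"
    and u :: "'v \<Rightarrow> 'v"
  assumes "finite_dimensional_vector_space scale Basis"
    and "Vector_Spaces.linear scale scale u"
    and "monic p" and "Polynomial.degree p = 2"
    and "monic q" and "Polynomial.degree q = 2"
    and "Factorial_Ring.irreducible p" and "Factorial_Ring.irreducible q"
    and "separable_poly p" and "separable_poly q"
    and "splitting_field p \<noteq> splitting_field q"
    and "quad_discr p \<noteq> quad_discr q"
  shows
    "((pq_difference scale p q u \<and> d_exceptional scale p q u)
        \<longleftrightarrow>
      (\<exists>m. endo_min_poly scale u = F_poly p q ^ m) \<and>
      (\<exists>r. invariant_factors scale u r \<and>
         (\<forall>k. r (2 * k) = r (2 * k + 1) \<or> r (2 * k) = r (2 * k + 1) * F_poly p q)))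
     \<and>
     ((\<exists>m. endo_min_poly scale u = F_poly p q ^ m) \<and>
      (\<exists>r. invariant_factors scale u r \<and>
         (\<forall>k. r (2 * k) = r (2 * k + 1) \<or> r (2 * k) = r (2 * k + 1) * F_poly p q))
        \<longleftrightarrow>
      (\<exists>Bs. represented_by scale u (diag_block_mat Bs) \<and>
         (\<forall>B\<in>set Bs. \<exists>n>0.
            B = diag_block_mat [companion_mat (F_poly p q ^ n), companion_mat (F_poly p q ^ n)] \<or>
            B = diag_block_mat [companion_mat (F_poly p q ^ n), companion_mat (F_poly p q ^ (n - 1))])))"
proof -
  interpret finite_dimensional_vector_space scale Basis by fact
  interpret endo_distinct scale Basis u p q
    by (intro endo_distinct.intro endo_pair.intro endo.intro endo_axioms.intro quadratic_pair.intro
      distinct_quadratic_pair.intro distinct_quadratic_pair_axioms.intro assms)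
  show ?thesis
    unfolding difference_iff_paired invariant_factors_iff_paired block_representation_iff_paired
    by blast
qed

end
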